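(* For every $t\in(1,9]$ there are positive constants $a_1(t),a_2(t)$ (depending only on $t$) with $$a_{1}(t)\leq\frac{300(\sqrt{t}+1)t^{3/2}}{(t-1)^{2}},\qquad a_{2}(t)\leq \frac{36(\sqrt{t}+1)^{2}+162\ln\left(\frac{108e}{\sqrt{t}-1}\right)}{(\sqrt{t}-1)^{4}},$$ such that, with $c(M_1,M_2,t):=a_2(t)\ln\left(\frac{a_1(t)M_2}{M_1}\right)$, the following holds. Let $r>0$, $k\ge 1$, and let $f_1,\dots,f_k$ be holomorphic functions on $\mathbf{D}_{tr}$ such that for some $M_{i1},M_{i2}>0$, $1\le i\le k$, $$M_{f_i}(r/t)\ge M_{i1},\qquad M_{f_i}(tr)\le M_{i2},\qquad \frac{M_{f_i}(r/t)}{M_{f_i}(r/t^2)}\ge t .$$ Let $\{i_1,\dots,i_k\}$ be a permutation of $\{1,\dots,k\}$ such that $N_{f_{i_1}}(r,t)\le N_{f_{i_2}}(r,t)\le\cdots\le N_{f_{i_k}}(r,t)$. Let $g$ be a holomorphic function in $\mathbf{D}_{tr}\times\mathbf{D}_{3M_{12}}\times\cdots\times\mathbf{D}_{3M_{k2}}\subset\mathbf{C}^{k+1}$ such that for some nonnegative $p,q_1,\dots,q_k$ and all $1\le i\le k$, $$g(\cdot,w_1,\dots,w_{i-1},\cdot,w_{i+1},\dots,w_k)\in\mathcal{F}_{p,q_i}(r;t;M_{i2})\quad\text{for all } w_j\in\mathbf{D}_{3M_{j2}},\ j\ne i.$$ Put $\Phi(z):=(f_1(z),\dots,f_k(z))$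 and $g_\Phi(z):=g(z,\Phi(z))$, $z\in\mathbf{D}_{tr}$. Define $p_0:=p$ and $p_j:=c(M_{i_j1},M_{i_j2},t)(p_{j-1}+q_{i_j})$ for $1\le j\le k$. Assume that $$p_j\le\ln\left(\frac{1+t}{2\sqrt t}\right)\cdot N_{f_{i_{j+1}}}(r,t)\quad\text{for all } 0\le j\le k-1 .$$ Then $$\sup_{\mathbf{D}_r\times\mathbf{D}_{M_{12}}\times\cdots\times\mathbf{D}_{M_{k2}}}|g|\le e^{p_1+\cdots+p_k}M_{g_\Phi}(r)\qquad\text{and}\qquad M_{g_\Phi}(tr)\le e^{p_k}M_{g_\Phi}(r).$$
   Context: $\mathbf{D}_r(z_0)\subset\mathbf{C}$ is the open disc of radius $r$ centered at $z_0$, $\mathbf{D}_r:=\mathbf{D}_r(0)$. For a function $f$, $M_f(r,z_0):=\sup_{\mathbf{D}_r(z_0)}|f|$, $m_f(r,z_0):=\ln M_f(r,z_0)$, $M_f(r):=M_f(r,0)$. For a holomorphic $f$ on $\mathbf{D}_r(z_0)$: $n_f(r,z_0)$ is the number of zeros of $f$ in $\mathbf{D}_r(z_0)$, counted with multiplicity ($-\infty$ if $f\equiv0$); $v_f(r,z_0):=\sup_{c\in\mathbf{C}}n_{f+c}(r,z_0)$, $v_f(r):=v_f(r,0)$; the Bernstein index is $b_f(r,z_0):=\sup\{m_f(es,z)-m_f(s,z)\}$, the supremum over all discs $\mathbf{D}_{es}(z)$ relatively compact in $\mathbf{D}_r(z_0)$ ($b_f:=0$ if $f\equiv0$), $b_f(r):=b_f(r,0)$.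 For $f$ holomorphic on $\mathbf{D}_{tr}$, $N_f(r,t):=v_f(r/\sqrt t)$. For $p,q\ge0$, $M_2>0$, the class $\mathcal{F}_{p,q}(r;t;M_2)$ consists of the holomorphic functions $h$ on $\mathbf{D}_{tr}\times\mathbf{D}_{3M_2}$ such that $M_{h(\cdot,w)}(tr)\le e^pM_{h(\cdot,w)}(r)$ for all $w\in\mathbf{D}_{3M_2}$ and $b_{h(z,\cdot)}(3M_2)\le q$ for all $z\in\mathbf{D}_{tr}$. *)

theory Defs
  imports "HOL-Complex_Analysis.Complex_Analysis"
begin

(* Suprema and their logarithms are extended-valued: a holomorphic function on an open disc
   may be unbounded on it. *)

definition M_sup :: "(complex \<Rightarrow> complex) \<Rightarrow> real \<Rightarrow> complex \<Rightarrow> ennreal" where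
  "M_sup f r z0 = (SUP z\<in>ball z0 r. ennreal (cmod (f z)))"

definition eln :: "ennreal \<Rightarrow> ereal" where
  "eln x = (if x = 0 then -\<infinity> else if x = top then \<infinity> else ereal (ln (enn2real x)))"

definition m_sup :: "(complex \<Rightarrow> complex) \<Rightarrow> real \<Rightarrow> complex \<Rightarrow> ereal" where
  "m_sup f r z0 = eln (M_sup f r z0)"

definition n_zeros :: "(complex \<Rightarrow> complex) \<Rightarrow> real \<Rightarrow> complex \<Rightarrow> ereal" where
  "n_zeros f r z0 =
     (let Z = {z \<in> ball z0 r. f z = 0} in
      if \<forall>z\<in>ball z0 r. f z = 0 then -\<infinity>
      else if finite Z then ereal (of_int (\<Sum>z\<in>Z. zorder f z))
      else \<infinity>)"

definition valency :: "(complex \<Rightarrow> complex) \<Rightarrow> real \<Rightarrow> complex \<Rightarrow> ereal" where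
  "valency f r z0 = (SUP c. n_zeros (\<lambda>z. f z + c) r z0)"

(* If f is holomorphic and not identically zero on the disc, both terms of each difference
   are finite, because ball z (e s) has compact closure inside ball z0 r. *)

definition bernstein_index :: "(complex \<Rightarrow> complex) \<Rightarrow> real \<Rightarrow> complex \<Rightarrow> ereal" where
  "bernstein_index f r z0 =
     (if \<forall>z\<in>ball z0 r. f z = 0 then 0
      else SUP (z, s)\<in>{(z, s). s > 0 \<and> closure (ball z (exp 1 * s)) \<subseteq> ball z0 r}.
             m_sup f (exp 1 * s) z - m_sup f s z)"

definition N_val :: "(complex \<Rightarrow> complex) \<Rightarrow> real \<Rightarrow> real \<Rightarrow> ereal" where
  "N_val f r t = valency f (r / sqrt t) 0"

(* Points of the space of complex I-tuples (I finite) are the functions that are undefined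
   outside I, as in the library's PiE; this allows the number of variables to be an ordinary
   variable rather than a type. *)

definition polydisc :: "'i set \<Rightarrow> ('i \<Rightarrow> real) \<Rightarrow> ('i \<Rightarrow> complex) set" where
  "polydisc I R = (\<Pi>\<^sub>E i\<in>I. ball 0 (R i))"

(* Complex (Frechet) differentiability at every point of U, where U is an open set of
   I-tuples.  Since all members of U agree outside I, the product topology restricted to U
   is the usual topology in the finitely many coordinates from I. *)

definition holomorphic_vars_on ::
    "'i set \<Rightarrow> (('i \<Rightarrow> complex) \<Rightarrow> complex) \<Rightarrow> ('i \<Rightarrow> complex) set \<Rightarrow> bool" where
  "holomorphic_vars_on I g U \<longleftrightarrow>
     (\<forall>a\<in>U. \<exists>L :: 'i \<Rightarrow> complex.
        ((\<lambda>x. (g x - g a - (\<Sum>i\<in>I. L i * (x i - a i)))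
               / complex_of_real (L2_set (\<lambda>i. cmod (x i - a i)) I)) \<longlongrightarrow> 0) (at a within U))"

(* A function h of two variables is read as a function on pairs indexed by {0, 1}. *)

definition F_class ::
    "real \<Rightarrow> real \<Rightarrow> real \<Rightarrow> real \<Rightarrow> real \<Rightarrow> (complex \<Rightarrow> complex \<Rightarrow> complex) set" where
  "F_class p q r t M2 =
     {h. holomorphic_vars_on {0, 1 :: nat} (\<lambda>x. h (x 0) (x 1))
           (polydisc {0, 1} (\<lambda>i. if i = 0 then t * r else 3 * M2))
       \<and> (\<forall>w\<in>ball 0 (3 * M2).
            M_sup (\<lambda>z. h z w) (t * r) 0 \<le> ennreal (exp p) * M_sup (\<lambda>z. h z w) r 0)
       \<and> (\<forall>z\<in>ball 0 (t * r). bernstein_index (h z) (3 * M2) 0 \<le> ereal q)}"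

definition c_const :: "real \<Rightarrow> real \<Rightarrow> real \<Rightarrow> real \<Rightarrow> real" where
  "c_const a1 a2 M1 M2 = a2 * ln (a1 * M2 / M1)"

(* In tuples indexed by {0..k}, coordinate 0 is z and coordinates 1, ..., k are w_1, ..., w_k. *)

definition g_Phi ::
    "nat \<Rightarrow> ((nat \<Rightarrow> complex) \<Rightarrow> complex) \<Rightarrow> (nat \<Rightarrow> complex \<Rightarrow> complex) \<Rightarrow> complex \<Rightarrow> complex" where
  "g_Phi k g f z = g (\<lambda>i\<in>{0..k}. if i = 0 then z else f i z)"

end

theory Submission
  imports Defs
begin

text \<open>
  Why the theorem holds. The functions \<open>f i\<close> are substituted one at a time, in the order given by
  \<open>\<sigma>\<close>. Freezing the other variables, one such substitution concerns a function \<open>h z w\<close> whose growth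
  in \<open>z\<close> from radius \<open>r\<close> to radius \<open>t * r\<close> is at most \<open>e^p\<close> and whose Bernstein index in \<open>w\<close> is at
  most \<open>q\<close>. The claim is that \<open>\<bar>h\<bar>\<close> for \<open>\<bar>z\<bar> < t * r\<close> and \<open>\<bar>w\<bar> < M2\<close> is at most \<open>e^(c * (p + q))\<close> times the
  supremum \<open>\<delta>\<close> of \<open>\<bar>h z (f z)\<bar>\<close> over \<open>\<bar>z\<bar> < r\<close> (lemma \<open>substitution_estimate\<close>). Since this bounds
  the values on the larger disc too, the substituted function grows by at most \<open>e^(c * (p + q))\<close>,
  which is the growth hypothesis for the next substitution; multiplying the estimates
  of all the steps gives the first assertion, and the growth after the last step is the second.

  The one-variable claim. Write \<open>s = sqrt t\<close>. Choose \<open>w0\<close> such that \<open>f - w0\<close> has \<open>N\<close> zeros, counted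
  with multiplicity, in the disc of radius \<open>r / s\<close>, where \<open>N \<ge> 1\<close> and
  \<open>9 / 10 * p \<le> ln ((1 + t) / (2 * s)) * N\<close>. Dividing the zeros of \<open>f - w0\<close> out by a Blaschke
  product, Harnack's inequality for the zero-free quotient and a Chebyshev-type bound for the
  moduli of the zeros produce a
  circle of radius slightly above \<open>r / s\<close> on which \<open>f - w0\<close> is at least
  \<open>s0 = 2 * M2 * exp (- K * \<Lambda>)\<close>, where \<open>\<Lambda>\<close> is the logarithm of a multiple of \<open>M2 / M1\<close>
  (\<open>large_modulus_circle\<close>). By Rouche's theorem, \<open>f - w\<close> has at least \<open>N\<close> zeros inside that circle
  for every \<open>w\<close> with \<open>\<bar>w - w0\<bar> < s0\<close> (\<open>valency_persists\<close>).

  For such \<open>w\<close> the function \<open>h z (f z) - h z w\<close> is divisible by \<open>f - w\<close>, so it has those \<open>N\<close> zeros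
  as well. By Schwarz's lemma its supremum over the disc of radius \<open>r / s\<close> is smaller than that
  over the disc of radius \<open>r\<close> by a factor that, thanks to the hypothesis relating \<open>p\<close> to the
  valency, is at most \<open>e^(- 3 * p / 5)\<close>. By the three circles theorem, on the other hand,
  the supremum of \<open>h z w\<close> drops by at most the factor \<open>e^(- p / 2)\<close>. Hence \<open>h z w\<close> cannot be much
  larger than \<open>\<delta>\<close> (\<open>sup_le_by_many_zeros\<close>). This comparison degenerates as \<open>p\<close> tends to \<open>0\<close>; for
  small \<open>p\<close>, Harnack's inequality shows instead that \<open>h z w\<close> is nearly constant in \<open>z\<close>, and its
  value at a zero of \<open>f - w\<close> is bounded by \<open>\<delta>\<close> (\<open>sup_le_value_of_slow_growth\<close>).

  Finally, the bound on the disc of radius \<open>s0\<close> around \<open>w0\<close> spreads to the disc of radius \<open>M2\<close>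
  around \<open>0\<close> by about \<open>1 + K * \<Lambda>\<close> enlargements by the factor \<open>e\<close>, each of which costs a factor \<open>e^q\<close>
  (\<open>bernstein_chain\<close>). The total exponent is linear in \<open>p\<close> and \<open>q\<close> and is absorbed by
  \<open>c * (p + q)\<close> (\<open>exponent_le\<close>).
\<close>

section \<open>Blaschke products over a multiset of zeros\<close>

definition zprod :: "complex multiset \<Rightarrow> complex \<Rightarrow> complex" where
  "zprod A z = (\<Prod>a\<in>#A. z - a)"

text \<open>The denominators of the Blaschke factors of the disc of radius \<open>R\<close>:
  \<open>zprod A z / bprod R A z\<close> is the Blaschke product with zeros \<open>A\<close>, which has modulus \<open>1\<close> on the circle
  of radius \<open>R\<close>. Multiplying by \<open>bprod\<close> avoids division.\<close>
definition bprod :: "real \<Rightarrow> complex multiset \<Rightarrow> complex \<Rightarrow> complex" where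
  "bprod R A z = (\<Prod>a\<in>#A. (of_real (R\<^sup>2) - cnj a * z) / of_real R)"

lemma zprod_simps [simp]: "zprod {#} z = 1" "zprod (add_mset a A) z = (z - a) * zprod A z"
  by (auto simp: zprod_def)

lemma bprod_simps [simp]: "bprod R {#} z = 1"
  "bprod R (add_mset a A) z = (of_real (R\<^sup>2) - cnj a * z) / of_real R * bprod R A z"
  by (auto simp: bprod_def)

lemma zprod_holomorphic [holomorphic_intros]: "zprod A holomorphic_on S"
proof -
  have "(\<lambda>z. zprod A z) holomorphic_on S"
    by (induction A) (auto intro!: holomorphic_intros)
  thus ?thesis by simp
qed

lemma bprod_holomorphic [holomorphic_intros]: "bprod R A holomorphic_on S"
proof -
  have "(\<lambda>z. bprod R A z) holomorphic_on S"
    unfolding bprod_def divide_inverse by (induction A) (auto intro!: holomorphic_intros)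
  thus ?thesis by simp
qed

text \<open>On the circle of radius \<open>\<rho> < R\<close> the quotient of the two linear factors is close to \<open>1\<close>
  as \<open>\<rho>\<close> tends to \<open>R\<close>, so the maximum principle on slightly smaller discs gives the bound
  in the limit. This is Schwarz's lemma for a function that vanishes at \<open>a\<close>.\<close>
lemma divide_blaschke_factor:
  assumes hol: "G holomorphic_on ball 0 R" and a: "cmod a < R"
    and bd: "\<And>z. cmod z < R \<Longrightarrow> cmod ((z - a) * G z) \<le> C" and z: "cmod z < R"
  shows "cmod (G z * ((of_real (R\<^sup>2) - cnj a * z) / of_real R)) \<le> C"
proof -
  have R: "R > 0" using z by (smt (verit) norm_ge_zero)
  define V where "V = (\<lambda>z. G z * ((of_real (R\<^sup>2) - cnj a * z) / of_real R))"
  have holV: "V holomorphic_on ball 0 R"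
    unfolding V_def using hol R by (auto intro!: holomorphic_intros)
  define \<phi> where "\<phi> = (\<lambda>\<rho>. C * ((R\<^sup>2 - \<rho>\<^sup>2) / (R * (\<rho> - cmod a)) + \<rho> / R))"
  have le: "cmod (V z) \<le> \<phi> \<rho>" if \<rho>: "\<rho> > max (cmod z) (cmod a)" "\<rho> < R" for \<rho>
  proof (rule maximum_modulus_frontier[of V "cball 0 \<rho>"])
    have "0 < \<rho>" using \<rho> norm_ge_zero[of z] by linarith
    hence \<rho>2: "\<rho>\<^sup>2 \<le> R\<^sup>2" using \<rho> by (intro power_mono) auto
    show "V holomorphic_on interior (cball 0 \<rho>)"
      using \<rho> by (intro holomorphic_on_subset[OF holV]) auto
    show "continuous_on (closure (cball 0 \<rho>)) V"
      using \<rho> by (intro holomorphic_on_imp_continuous_on holomorphic_on_subset[OF holV]) auto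
    show "z \<in> cball 0 \<rho>" using \<rho> by auto
    fix w assume "w \<in> frontier (cball (0::complex) \<rho>)"
    hence w: "cmod w = \<rho>" using \<rho> by auto
    have wa: "cmod (w - a) \<ge> \<rho> - cmod a" "\<rho> - cmod a > 0"
      using w \<rho> norm_triangle_ineq2[of w a] by auto
    \<comment> \<open>On the circle itself, the denominator for radius \<open>\<rho>\<close> has the modulus of \<open>\<rho> * (w - a)\<close>.\<close>
    have eq: "of_real (\<rho>\<^sup>2) - cnj a * w = w * cnj (w - a)"
      using w by (simp add: algebra_simps complex_norm_square[symmetric] flip: of_real_power)
    have "of_real (R\<^sup>2) - cnj a * w = of_real (R\<^sup>2 - \<rho>\<^sup>2) + w * cnj (w - a)"
      unfolding eq[symmetric] by simp
    hence "cmod (of_real (R\<^sup>2) - cnj a * w) \<le> cmod (of_real (R\<^sup>2 - \<rho>\<^sup>2)) + cmod (w * cnj (w - a))"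
      by (metis norm_triangle_ineq)
    also have "\<dots> = (R\<^sup>2 - \<rho>\<^sup>2) + \<rho> * cmod (w - a)"
    proof -
      have "R\<^sup>2 - \<rho>\<^sup>2 \<ge> 0" using \<rho>2 by simp
      moreover have "cmod (cnj (w - a)) = cmod (w - a)" by (rule complex_mod_cnj)
      ultimately show ?thesis using w by (simp only: norm_mult norm_of_real)
    qed
    finally have b1: "cmod (of_real (R\<^sup>2) - cnj a * w) \<le> (R\<^sup>2 - \<rho>\<^sup>2) + \<rho> * cmod (w - a)" .
    have "cmod (V w) = cmod (G w) * cmod (of_real (R\<^sup>2) - cnj a * w) / R"
      using R by (simp add: V_def norm_mult norm_divide)
    also have "\<dots> \<le> cmod (G w) * ((R\<^sup>2 - \<rho>\<^sup>2) + \<rho> * cmod (w - a)) / R"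
      using b1 R by (intro divide_right_mono mult_left_mono) auto
    also have "\<dots> = (cmod (w - a) * cmod (G w)) * ((R\<^sup>2 - \<rho>\<^sup>2) / (R * cmod (w - a)) + \<rho> / R)"
    proof -
      have "cmod (w - a) > 0" using wa by linarith
      thus ?thesis using R by (simp add: divide_simps)
    qed
    also have "\<dots> \<le> C * ((R\<^sup>2 - \<rho>\<^sup>2) / (R * (\<rho> - cmod a)) + \<rho> / R)"
    proof (intro mult_mono add_mono divide_left_mono)
      show "cmod (w - a) * cmod (G w) \<le> C" using bd[of w] w \<rho> by (simp add: norm_mult)
      thus "0 \<le> C" by (smt (verit) norm_ge_zero mult_nonneg_nonneg)
      show "0 \<le> R\<^sup>2 - \<rho>\<^sup>2" using \<rho>2 by simp
      thus "0 \<le> (R\<^sup>2 - \<rho>\<^sup>2) / (R * cmod (w - a)) + \<rho> / R" using R \<rho> w by auto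
      have "0 < \<rho>" using \<rho> norm_ge_zero[of z] by linarith
      thus "0 \<le> \<rho>" by simp
      have "cmod (w - a) > 0" using wa by linarith
      thus "0 < R * cmod (w - a) * (R * (\<rho> - cmod a))" using wa R by simp
    qed (use wa R in auto)
    finally show "cmod (V w) \<le> \<phi> \<rho>" by (simp add: \<phi>_def)
  qed auto
  have "(\<phi> \<longlongrightarrow> C * ((R\<^sup>2 - R\<^sup>2) / (R * (R - cmod a)) + R / R)) (at_left R)"
    unfolding \<phi>_def using R a by (intro tendsto_intros) auto
  hence lim: "(\<phi> \<longlongrightarrow> C) (at_left R)" using R by simp
  have "cmod (V z) \<le> C"
  proof (rule tendsto_lowerbound[OF lim])
    show "\<forall>\<^sub>F \<rho> in at_left R. cmod (V z) \<le> \<phi> \<rho>"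
      using eventually_at_left_real[of "max (cmod z) (cmod a)" R] z a
      by (auto elim!: eventually_mono intro!: le)
  qed simp
  thus ?thesis by (simp add: V_def)
qed

lemma divide_blaschke_product:
  assumes "u holomorphic_on ball 0 R" "\<And>a. a \<in># A \<Longrightarrow> cmod a < R"
    and "\<And>z. cmod z < R \<Longrightarrow> cmod (zprod A z * u z) \<le> C" "cmod z < R"
  shows "cmod (bprod R A z * u z) \<le> C"
  using assms
proof (induction A arbitrary: u)
  case empty
  thus ?case by simp
next
  case (add a A)
  have R: "R > 0" using add.prems(4) by (smt (verit) norm_ge_zero)
  have "cmod (bprod R A z * (u z * ((of_real (R\<^sup>2) - cnj a * z) / of_real R))) \<le> C"
  proof (rule add.IH)
    show "(\<lambda>z. u z * ((of_real (R\<^sup>2) - cnj a * z) / of_real R)) holomorphic_on ball 0 R"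
      using add.prems(1) R by (auto intro!: holomorphic_intros)
    fix w :: complex assume w: "cmod w < R"
    have "cmod (zprod A w * u w * ((of_real (R\<^sup>2) - cnj a * w) / of_real R)) \<le> C"
    proof (rule divide_blaschke_factor)
      show "(\<lambda>w. zprod A w * u w) holomorphic_on ball 0 R"
        using add.prems(1) by (intro holomorphic_intros)
    qed (use add.prems(2,3) w in \<open>auto simp: mult.assoc\<close>)
    thus "cmod (zprod A w * (u w * ((of_real (R\<^sup>2) - cnj a * w) / of_real R))) \<le> C"
      by (simp add: mult.assoc)
  qed (use add.prems in auto)
  thus ?case by (simp add: mult_ac)
qed

lemma cmod_mobius_identity:
  "(cmod (of_real (R\<^sup>2) - cnj a * z))\<^sup>2
     = R\<^sup>2 * (cmod (z - a))\<^sup>2 + (R\<^sup>2 - (cmod z)\<^sup>2) * (R\<^sup>2 - (cmod a)\<^sup>2)"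
  unfolding cmod_power2 by (simp del: of_real_power) (simp add: algebra_simps power2_eq_square)

text \<open>By the preceding identity, the claim says that
  \<open>(R\<^sup>2 - \<bar>z\<bar>\<^sup>2) * (R\<^sup>2 - \<bar>a\<bar>\<^sup>2) / \<bar>z - a\<bar>\<^sup>2\<close> is minimal for opposite points of moduli \<open>x\<close> and \<open>y\<close>.\<close>
lemma pseudohyperbolic_le:
  assumes "cmod z \<le> x" "x < R" "cmod a \<le> y" "y < R"
  shows "cmod (z - a) * (R\<^sup>2 + x * y) \<le> (x + y) * cmod (of_real (R\<^sup>2) - cnj a * z)"
proof -
  have x: "x \<ge> 0" "y \<ge> 0" "R > 0" using assms norm_ge_zero[of z] norm_ge_zero[of a] by linarith+
  have sq: "(cmod z)\<^sup>2 \<le> x\<^sup>2" "(cmod a)\<^sup>2 \<le> y\<^sup>2" "x\<^sup>2 \<le> R\<^sup>2" "y\<^sup>2 \<le> R\<^sup>2"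
    using assms x by (auto intro!: power_mono)
  have "(cmod (z - a))\<^sup>2 \<le> (x + y)\<^sup>2"
    using assms norm_triangle_ineq4[of z a] by (intro power_mono) auto
  hence "(cmod (z - a))\<^sup>2 * ((R\<^sup>2 - x\<^sup>2) * (R\<^sup>2 - y\<^sup>2))
     \<le> (x + y)\<^sup>2 * ((R\<^sup>2 - (cmod z)\<^sup>2) * (R\<^sup>2 - (cmod a)\<^sup>2))"
    using sq by (intro mult_mono) (auto intro!: mult_nonneg_nonneg)
  hence "(cmod (z - a) * (R\<^sup>2 + x * y))\<^sup>2 \<le> ((x + y) * cmod (of_real (R\<^sup>2) - cnj a * z))\<^sup>2"
    unfolding power_mult_distrib cmod_mobius_identity
    by (simp add: algebra_simps power2_eq_square)
  thus ?thesis by (rule power2_le_imp_le) (use x in auto)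
qed

lemma zprod_le_bprod:
  assumes "cmod z \<le> x" "x < R" "\<And>a. a \<in># A \<Longrightarrow> cmod a \<le> y" "0 \<le> y" "y < R"
  shows "cmod (zprod A z) \<le> (R * (x + y) / (R\<^sup>2 + x * y)) ^ size A * cmod (bprod R A z)"
  using assms(3)
proof (induction A)
  case empty
  thus ?case by simp
next
  case (add a A)
  have x: "x \<ge> 0" "R > 0" using assms norm_ge_zero[of z] by linarith+
  hence pos: "R\<^sup>2 + x * y > 0" using assms by (smt (verit) mult_nonneg_nonneg zero_less_power2)
  let ?B = "R * (x + y) / (R\<^sup>2 + x * y)"
  have "cmod (z - a) * (R\<^sup>2 + x * y) \<le> (x + y) * cmod (of_real (R\<^sup>2) - cnj a * z)"
    using add.prems assms by (intro pseudohyperbolic_le) auto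
  hence "cmod (z - a) \<le> ?B * (cmod (of_real (R\<^sup>2) - cnj a * z) / R)"
    using pos x by (simp add: pos_le_divide_eq)
  hence 1: "cmod (z - a) \<le> ?B * cmod ((of_real (R\<^sup>2) - cnj a * z) / of_real R)"
    using x by (simp add: norm_divide)
  have B0: "?B \<ge> 0" using x assms pos by auto
  have "cmod (zprod (add_mset a A) z) = cmod (z - a) * cmod (zprod A z)" by (simp add: norm_mult)
  also have "\<dots> \<le> (?B * cmod ((of_real (R\<^sup>2) - cnj a * z) / of_real R)) * (?B ^ size A * cmod (bprod R A z))"
    using 1 add B0 by (intro mult_mono mult_nonneg_nonneg) auto
  also have "\<dots> = ?B ^ size (add_mset a A) * cmod (bprod R (add_mset a A) z)"
    unfolding bprod_simps norm_mult by simp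
  finally show ?case .
qed

text \<open>A lower bound for Blaschke products that only sees the moduli of the zeros: a circle
  centred at \<open>0\<close> that avoids those moduli avoids the zeros.\<close>
lemma zprod_ge_bprod:
  assumes "cmod z < R" "\<And>a. a \<in># A \<Longrightarrow> cmod a < R"
  shows "cmod (zprod A z) \<ge> (\<Prod>a\<in>#A. \<bar>cmod z - cmod a\<bar>) / (2 * R) ^ size A * cmod (bprod R A z)"
  using assms(2)
proof (induction A)
  case empty
  thus ?case by simp
next
  case (add a A)
  have R: "R > 0" using assms norm_ge_zero[of z] by linarith
  let ?b = "(of_real (R\<^sup>2) - cnj a * z) / of_real R"
  have "cmod a * cmod z \<le> R * R" using add.prems assms R by (intro mult_mono) (auto intro: less_imp_le)
  hence "cmod (of_real (R\<^sup>2) - cnj a * z) \<le> 2 * R * R"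
    using norm_triangle_ineq4[of "of_real (R\<^sup>2)" "cnj a * z"]
    by (simp add: norm_mult power2_eq_square)
  hence b: "cmod ?b \<le> 2 * R" using R by (simp add: norm_divide field_simps)
  have 1: "\<bar>cmod z - cmod a\<bar> / (2 * R) * cmod ?b \<le> cmod (z - a)"
  proof -
    have "\<bar>cmod z - cmod a\<bar> / (2 * R) * cmod ?b \<le> \<bar>cmod z - cmod a\<bar> / (2 * R) * (2 * R)"
      using b R by (intro mult_left_mono) auto
    also have "\<dots> \<le> cmod (z - a)" using R norm_triangle_ineq3[of z a] by simp
    finally show ?thesis .
  qed
  have p0: "0 \<le> (\<Prod>a\<in>#A. \<bar>cmod z - cmod a\<bar>)"
    by (induction A) auto
  have "(\<Prod>a\<in>#add_mset a A. \<bar>cmod z - cmod a\<bar>) / (2 * R) ^ size (add_mset a A) * cmod (bprod R (add_mset a A) z)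
    = (\<bar>cmod z - cmod a\<bar> / (2 * R) * cmod ?b) * ((\<Prod>a\<in>#A. \<bar>cmod z - cmod a\<bar>) / (2 * R) ^ size A * cmod (bprod R A z))"
    unfolding bprod_simps norm_mult by simp
  also have "\<dots> \<le> cmod (z - a) * cmod (zprod A z)"
    using 1 add p0 R by (intro mult_mono) auto
  finally show ?case by (simp add: norm_mult)
qed

section \<open>Harnack, Schwarz and three circles inequalities\<close>

text \<open>For \<open>Re g > 0\<close> the Cayley transform of \<open>g\<close> that vanishes at \<open>z'\<close> is bounded by \<open>1\<close>, so Schwarz's
  lemma bounds it at \<open>z\<close> by the pseudohyperbolic distance \<open>B\<close>, and \<open>(1 + B) / (1 - B)\<close> is the Harnack
  constant. The case \<open>Re g \<ge> 0\<close> follows by adding a positive constant that tends to \<open>0\<close>.\<close>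
lemma harnack_Re:
  assumes hol: "g holomorphic_on ball 0 R" and pos: "\<And>z. cmod z < R \<Longrightarrow> 0 \<le> Re (g z)"
    and z: "cmod z \<le> x" "x < R" and z': "cmod z' \<le> y" "y < R"
  shows "Re (g z) \<le> (R + x) * (R + y) / ((R - x) * (R - y)) * Re (g z')"
proof -
  have x: "x \<ge> 0" "y \<ge> 0" "R > 0"
    using assms norm_ge_zero[of z] norm_ge_zero[of z'] by linarith+
  have D: "R\<^sup>2 + x * y > 0" using x by (simp add: add_pos_nonneg)
  let ?H = "(R + x) * (R + y) / ((R - x) * (R - y))"
  have main: "Re (g z) + e \<le> ?H * (Re (g z') + e)" if e: "e > 0" for e
  proof -
    define k where "k = (\<lambda>w. g w + of_real e)"
    have holk: "k holomorphic_on ball 0 R" unfolding k_def using hol by (intro holomorphic_intros)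
    have kpos: "Re (k w) > 0" if "cmod w < R" for w using pos[OF that] e by (simp add: k_def)
    have z'R: "cmod z' < R" using z' by simp
    have den: "k w + cnj (k z') \<noteq> 0" if "cmod w < R" for w
      using kpos[OF that] kpos[OF z'R] by (auto simp: complex_eq_iff)
    define \<psi> where "\<psi> = (\<lambda>w. (k w - k z') / (k w + cnj (k z')))"
    have holpsi: "\<psi> holomorphic_on ball 0 R"
      unfolding \<psi>_def using holk den by (auto intro!: holomorphic_intros)
    have psi0: "\<psi> z' = 0" by (simp add: \<psi>_def)
    define G where "G = (\<lambda>w. if w = z' then deriv \<psi> z' else \<psi> w / (w - z'))"
    have holG: "G holomorphic_on ball 0 R"
      by (rule pole_theorem_open_0[OF holpsi]) (auto simp: G_def psi0)
    have psiG: "\<psi> w = (w - z') * G w" for w by (auto simp: G_def psi0)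
    have psile: "cmod (\<psi> w) \<le> 1" if "cmod w < R" for w
    proof -
      have "0 \<le> Re (k w) * Re (k z')" using kpos[OF that] kpos[OF z'R] by simp
      hence "(cmod (k w - k z'))\<^sup>2 \<le> (cmod (k w + cnj (k z')))\<^sup>2"
        unfolding cmod_power2 by simp (simp add: power2_eq_square algebra_simps)
      hence "cmod (k w - k z') \<le> cmod (k w + cnj (k z'))" by (rule power2_le_imp_le) auto
      thus ?thesis using den[OF that] by (simp add: \<psi>_def norm_divide)
    qed
    have zR: "cmod z < R" using z by simp
    have b: "cmod (bprod R {#z'#} z * G z) \<le> 1"
      by (rule divide_blaschke_product[OF holG]) (use z'R zR psile in \<open>auto simp: psiG[symmetric]\<close>)
    have z2: "cmod (zprod {#z'#} z) \<le> (R * (x + y) / (R\<^sup>2 + x * y)) ^ size {#z'#} * cmod (bprod R {#z'#} z)"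
      by (rule zprod_le_bprod) (use z z' x in auto)
    define B where "B = R * (x + y) / (R\<^sup>2 + x * y)"
    have B0: "B \<ge> 0" using x D by (auto simp: B_def)
    have "cmod (\<psi> z) = cmod (zprod {#z'#} z) * cmod (G z)" by (simp add: psiG norm_mult)
    also have "\<dots> \<le> B * cmod (bprod R {#z'#} z) * cmod (G z)"
      using z2 by (intro mult_right_mono) (auto simp: B_def)
    also have "\<dots> = B * cmod (bprod R {#z'#} z * G z)" by (simp only: norm_mult mult.assoc)
    also have "\<dots> \<le> B * 1" using b B0 by (intro mult_left_mono)
    finally have psiB: "cmod (\<psi> z) \<le> B" by simp
    have B1: "B < 1"
    proof -
      have "0 < (R - x) * (R - y)" using z z' by simp
      hence "R * (x + y) < R\<^sup>2 + x * y" by (simp add: algebra_simps power2_eq_square)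
      thus ?thesis using D by (simp add: B_def)
    qed
    have "Re (k z) - Re (k z') \<le> B * (Re (k z) + Re (k z'))"
    proof (cases "Re (k z) \<le> Re (k z')")
      case True
      have "0 \<le> B * (Re (k z) + Re (k z'))" using B0 kpos[OF zR] kpos[OF z'R] by simp
      thus ?thesis using True by linarith
    next
      case False
      define h where "h = Im (k z) - Im (k z')"
      define p where "p = Re (k z) - Re (k z')"
      define q where "q = Re (k z) + Re (k z')"
      have pq: "0 < p" "p \<le> q" using False kpos[OF z'R] by (auto simp: p_def q_def)
      have "cmod (k z - k z') \<le> B * cmod (k z + cnj (k z'))"
        using psiB den[OF zR] by (simp add: \<psi>_def norm_divide field_simps)
      hence "(cmod (k z - k z'))\<^sup>2 \<le> (B * cmod (k z + cnj (k z')))\<^sup>2" by (intro power_mono) auto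
      hence "p\<^sup>2 + h\<^sup>2 \<le> B\<^sup>2 * (q\<^sup>2 + h\<^sup>2)"
        unfolding power_mult_distrib by (simp add: cmod_power2 p_def q_def h_def)
      moreover have "B\<^sup>2 * h\<^sup>2 \<le> 1 * h\<^sup>2"
        using B0 B1 by (intro mult_right_mono) (auto simp: power_le_one_iff abs_square_le_1)
      ultimately have "p\<^sup>2 \<le> (B * q)\<^sup>2" by (simp add: power_mult_distrib algebra_simps)
      hence "p \<le> B * q" by (rule power2_le_imp_le) (use B0 pq in auto)
      thus ?thesis by (simp add: p_def q_def)
    qed
    hence "Re (k z) * (1 - B) \<le> (1 + B) * Re (k z')" by (simp add: algebra_simps)
    hence "Re (k z) \<le> (1 + B) / (1 - B) * Re (k z')" using B1 by (simp add: field_simps)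
    also have "(1 + B) / (1 - B) = ?H"
    proof -
      have "1 + B = (R + x) * (R + y) / (R\<^sup>2 + x * y)" "1 - B = (R - x) * (R - y) / (R\<^sup>2 + x * y)"
        using D by (simp_all add: B_def field_simps power2_eq_square)
      thus ?thesis using D by simp
    qed
    finally show ?thesis by (simp add: k_def)
  qed
  have lim1: "((\<lambda>e. Re (g z) + e) \<longlongrightarrow> Re (g z) + 0) (at_right 0)" by (intro tendsto_intros)
  have lim2: "((\<lambda>e. ?H * (Re (g z') + e)) \<longlongrightarrow> ?H * (Re (g z') + 0)) (at_right 0)"
    by (intro tendsto_intros)
  have "Re (g z) + 0 \<le> ?H * (Re (g z') + 0)"
    by (rule tendsto_le[OF _ lim2 lim1 eventually_mono[OF eventually_at_right_less main]]) simp_all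
  thus ?thesis by simp
qed

lemma schwarz_at_center:
  assumes K: "K holomorphic_on ball w R" "K w = 0" and C: "\<And>v. v \<in> ball w R \<Longrightarrow> cmod (K v) \<le> C"
    and v: "v \<in> ball w R"
  shows "cmod (K v) \<le> C / R * cmod (v - w)"
proof -
  have R: "R > 0" using v by (metis ball_eq_empty empty_iff not_le)
  define k where "k = (\<lambda>x. K (w + x))"
  have "(K \<circ> (\<lambda>x. w + x)) holomorphic_on ball 0 R"
    by (rule holomorphic_on_compose_gen[OF _ K(1)]) (auto intro!: holomorphic_intros simp: dist_norm)
  hence holk: "k holomorphic_on ball 0 R" by (simp add: k_def o_def)
  have k0: "k 0 = 0" using K by (simp add: k_def)
  define G where "G = (\<lambda>x. if x = 0 then deriv k 0 else k x / x)"
  have holG: "G holomorphic_on ball 0 R"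
    by (rule pole_theorem_open_0[OF holk, where a = 0]) (auto simp: G_def k0)
  have kG: "k x = x * G x" for x by (auto simp: G_def k0)
  have "cmod (G (v - w) * ((of_real (R\<^sup>2) - cnj 0 * (v - w)) / of_real R)) \<le> C"
  proof (rule divide_blaschke_factor[OF holG])
    fix x :: complex assume "cmod x < R"
    thus "cmod ((x - 0) * G x) \<le> C" using C[of "w + x"] kG[of x] by (simp add: k_def dist_norm)
  qed (use R v in \<open>auto simp: dist_norm norm_minus_commute\<close>)
  hence "cmod (G (v - w)) * R \<le> C" using R by (simp add: norm_mult norm_divide norm_power power2_eq_square)
  hence "cmod (G (v - w)) \<le> C / R" using R by (simp add: field_simps)
  hence "cmod (v - w) * cmod (G (v - w)) \<le> cmod (v - w) * (C / R)" by (intro mult_left_mono) auto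
  moreover have "K v = (v - w) * G (v - w)" using kG[of "v - w"] by (simp add: k_def)
  ultimately show ?thesis by (simp add: norm_mult mult.commute)
qed

text \<open>Only the case of radii \<open>R / s\<close>, \<open>R\<close>, \<open>R * s\<close> of Hadamard's theorem is needed, and there reflection
  replaces the logarithm: the product of \<open>f w\<close> and the conjugate of \<open>f\<close> at the point reflected in the
  circle through \<open>z\<close> is holomorphic on an annulus, is \<open>\<bar>f z\<bar>\<^sup>2\<close> at \<open>z\<close>, and has modulus at most
  \<open>A * B\<close> on both boundary circles.\<close>
lemma three_circles_geometric_mean:
  assumes hol: "f holomorphic_on ball 0 (R * s)" and s: "1 < s"
    and A: "\<And>z. cmod z < R / s \<Longrightarrow> cmod (f z) \<le> A"
    and B: "\<And>z. cmod z < R * s \<Longrightarrow> cmod (f z) \<le> B"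
    and z: "cmod z < R"
  shows "(cmod (f z))\<^sup>2 \<le> A * B"
proof -
  have R: "R > 0" using z norm_ge_zero[of z] by linarith
  have Rs: "R / s > 0" "R < R * s" using R s by auto
  have A0: "A \<ge> 0" using A[of 0] Rs norm_ge_zero[of "f 0"] using order_trans[OF norm_ge_zero A[of 0]] Rs by simp
  show ?thesis
  proof (cases "z = 0")
    case True
    have "cmod (f 0) \<le> A" "cmod (f 0) \<le> B" using A B Rs R s by auto
    thus ?thesis using True A0 by (auto simp: power2_eq_square intro!: mult_mono)
  next
    case False
    \<comment> \<open>Working with the circle through \<open>z\<close>, of radius below \<open>R\<close>, keeps the closed annulus inside the domain.\<close>
    define \<rho> where "\<rho> = cmod z"
    have \<rho>: "\<rho> > 0" "\<rho> < R" using False z by (auto simp: \<rho>_def)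
    have \<rho>s: "\<rho> * s < R * s" "\<rho> / s < R / s" "\<rho> / s < \<rho>" "\<rho> < \<rho> * s" "\<rho> / s > 0"
      using \<rho> s by (auto simp: field_simps)
    define f' where "f' = cnj \<circ> f \<circ> cnj"
    have holf': "f' holomorphic_on ball 0 (R * s)"
      unfolding f'_def using hol
      by (intro holomorphic_on_compose_cnj_cnj holomorphic_on_subset[OF hol]) auto
    define S where "S = cball 0 (\<rho> * s) - ball (0::complex) (\<rho> / s)"
    define T where "T = ball 0 (R * s) - {0::complex}"
    define G where "G = (\<lambda>w. f w * f' (of_real (\<rho>\<^sup>2) / w))"
    have S_sub: "cmod w \<le> \<rho> * s" "\<rho> / s \<le> cmod w" if "w \<in> S" for w using that by (auto simp: S_def)
    have quot: "cmod (of_real (\<rho>\<^sup>2) / w) = \<rho>\<^sup>2 / cmod w" for w by (simp add: norm_divide norm_power)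
    have quot_le: "cmod (of_real (\<rho>\<^sup>2) / w) \<le> \<rho> * s" if "w \<in> S" for w
    proof -
      have "\<rho>\<^sup>2 / cmod w \<le> \<rho>\<^sup>2 / (\<rho> / s)" using S_sub[OF that] \<rho> \<rho>s by (intro divide_left_mono) (auto intro!: mult_pos_pos divide_pos_pos)
      also have "\<dots> = \<rho> * s" using \<rho> by (simp add: power2_eq_square)
      finally show ?thesis using quot by simp
    qed
    have holG: "G holomorphic_on S"
    proof -
      have "(f' \<circ> (\<lambda>w. of_real (\<rho>\<^sup>2) / w)) holomorphic_on S"
      proof (rule holomorphic_on_compose_gen[OF _ holf'])
        show "(\<lambda>w. of_real (\<rho>\<^sup>2) / w) holomorphic_on S"
          using \<rho>s by (intro holomorphic_intros) (auto simp: S_def)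
        show "(\<lambda>w. of_real (\<rho>\<^sup>2) / w) ` S \<subseteq> ball 0 (R * s)"
        proof (rule image_subsetI)
          fix w assume "w \<in> S"
          hence "cmod (of_real (\<rho>\<^sup>2) / w) < R * s" using quot_le \<rho>s(1) order_le_less_trans by blast
          thus "of_real (\<rho>\<^sup>2) / w \<in> ball 0 (R * s)" by (simp only: mem_ball_0)
        qed
      qed
      moreover have "f holomorphic_on S"
        using order_le_less_trans[OF S_sub(1) \<rho>s(1)]
        by (intro holomorphic_on_subset[OF hol]) auto
      ultimately show ?thesis unfolding G_def o_def by (intro holomorphic_intros)
    qed
    have clS: "closed S" unfolding S_def by (intro closed_Diff) auto
    have "cmod (G z) \<le> A * B"
    proof (rule maximum_modulus_frontier[of G S])
      show "G holomorphic_on interior S" by (rule holomorphic_on_subset[OF holG interior_subset])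
      show "continuous_on (closure S) G" using clS holG by (simp add: holomorphic_on_imp_continuous_on)
      show "bounded S" unfolding S_def by (rule bounded_subset[OF bounded_cball]) auto
      show "z \<in> S" using \<rho>s by (auto simp: S_def \<rho>_def)
      fix w assume w: "w \<in> frontier S"
      hence wS: "w \<in> S" using clS by (simp add: frontier_def)
      have "open (ball 0 (\<rho> * s) - cball (0::complex) (\<rho> / s))" by (intro open_Diff) auto
      hence "ball 0 (\<rho> * s) - cball 0 (\<rho> / s) \<subseteq> interior S"
        by (intro interior_maximal) (auto simp: S_def)
      hence "cmod w = \<rho> * s \<or> cmod w = \<rho> / s"
        using w S_sub[OF wS] by (force simp: frontier_def)
      thus "cmod (G w) \<le> A * B"
      proof
        assume e: "cmod w = \<rho> * s"
        have "cmod (of_real (\<rho>\<^sup>2) / w) = \<rho> / s" using e \<rho> s unfolding quot by (simp add: power2_eq_square)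
        hence "cmod (cnj (of_real (\<rho>\<^sup>2) / w)) < R / s" using \<rho>s(2) by (simp only: complex_mod_cnj)
        from A[OF this] have "cmod (f' (of_real (\<rho>\<^sup>2) / w)) \<le> A" by (simp add: f'_def)
        moreover have "cmod (f w) \<le> B" using e \<rho>s(1) by (intro B) simp
        ultimately show ?thesis unfolding G_def norm_mult
          using A0 by (subst mult.commute) (intro mult_mono, auto)
      next
        assume e: "cmod w = \<rho> / s"
        have "cmod (of_real (\<rho>\<^sup>2) / w) = \<rho> * s" using e \<rho> s unfolding quot by (simp add: power2_eq_square)
        hence "cmod (cnj (of_real (\<rho>\<^sup>2) / w)) < R * s" using \<rho>s(1) by (simp only: complex_mod_cnj)
        from B[OF this] have "cmod (f' (of_real (\<rho>\<^sup>2) / w)) \<le> B" by (simp add: f'_def)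
        moreover have "cmod (f w) \<le> A" using e \<rho>s(2) by (intro A) simp
        ultimately show ?thesis unfolding G_def norm_mult
          using A0 by (intro mult_mono) auto
      qed
    qed
    also have "G z = f z * cnj (f z)"
    proof -
      have "of_real (\<rho>\<^sup>2) = z * cnj z" unfolding \<rho>_def by (rule complex_norm_square)
      hence "of_real (\<rho>\<^sup>2) / z = cnj z" using False by simp
      thus ?thesis by (simp only: G_def f'_def o_apply complex_cnj_cnj)
    qed
    finally show ?thesis by (simp add: norm_mult power2_eq_square)
  qed
qed

lemma strict_bound_of_nonconstant:
  assumes "f holomorphic_on S" "open S" "connected S" "\<And>z. z \<in> S \<Longrightarrow> cmod (f z) \<le> M"
    and "x \<in> S" "y \<in> S" "f x \<noteq> f y" "z \<in> S"
  shows "cmod (f z) < M"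
proof (rule ccontr)
  assume "\<not> cmod (f z) < M"
  hence "cmod (f u) \<le> cmod (f z)" if "u \<in> S" for u using assms(4)[OF that] by linarith
  hence "f constant_on S" using maximum_modulus_principle[OF assms(1-3) assms(2) order_refl assms(8)] by blast
  thus False using assms(5-7) unfolding constant_on_def by auto
qed

section \<open>Large values of monic products on an interval\<close>

primrec fdiff :: "real \<Rightarrow> nat \<Rightarrow> (real \<Rightarrow> real) \<Rightarrow> real \<Rightarrow> real" where
  "fdiff h 0 f x = f x"
| "fdiff h (Suc n) f x = fdiff h n f (x + h) - fdiff h n f x"

lemma fdiff_le:
  assumes "\<And>i. i \<le> n \<Longrightarrow> \<bar>f (x + real i * h)\<bar> \<le> K"
  shows "\<bar>fdiff h n f x\<bar> \<le> 2 ^ n * K"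
  using assms
proof (induction n arbitrary: x)
  case 0
  from 0[of 0] show ?case by simp
next
  case (Suc n)
  have "\<bar>fdiff h n f x\<bar> \<le> 2 ^ n * K" using Suc.prems by (intro Suc.IH) auto
  moreover have "\<bar>fdiff h n f (x + h)\<bar> \<le> 2 ^ n * K"
  proof (rule Suc.IH)
    fix i assume "i \<le> n"
    thus "\<bar>f (x + h + real i * h)\<bar> \<le> K" using Suc.prems[of "Suc i"] by (simp add: algebra_simps)
  qed
  ultimately show ?case by simp
qed

lemma fdiff_linear_factor:
  "fdiff h n (\<lambda>x. (x - \<alpha>) * f x) x = (x - \<alpha>) * fdiff h n f x + real n * h * fdiff h (n - 1) f (x + h)"
proof (induction n arbitrary: x)
  case (Suc n)
  show ?case
  proof (cases n)
    case 0 thus ?thesis by (simp add: algebra_simps)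
  next
    case (Suc m)
    show ?thesis unfolding fdiff.simps Suc.IH[of x] Suc.IH[of "x+h"] using Suc by (simp add: algebra_simps)
  qed
qed simp

text \<open>The \<open>n\<close>-th difference of a monic polynomial of degree \<open>n\<close> is \<open>n! * h^n\<close>, by induction on the number
  of roots with the Leibniz rule for a linear factor.\<close>
lemma fdiff_prod:
  "size A \<le> n \<Longrightarrow> fdiff h n (\<lambda>x. \<Prod>\<alpha>\<in>#A. x - \<alpha>) x = (if n = size A then fact n * h ^ n else 0)"
proof (induction A arbitrary: n x)
  case empty
  have "fdiff h (Suc m) (\<lambda>x. 1) x = 0" for m x by (induction m arbitrary: x) (simp, subst fdiff.simps(2), simp only: diff_self)
  thus ?case by (cases n) auto
next
  case (add a A)
  then obtain m where n: "n = Suc m" by (cases n) auto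
  have "fdiff h n (\<lambda>x. \<Prod>\<alpha>\<in>#add_mset a A. x - \<alpha>) x
     = (x - a) * fdiff h n (\<lambda>x. \<Prod>\<alpha>\<in>#A. x - \<alpha>) x + real n * h * fdiff h m (\<lambda>x. \<Prod>\<alpha>\<in>#A. x - \<alpha>) (x + h)"
    using fdiff_linear_factor[of h n a "\<lambda>x. \<Prod>\<alpha>\<in>#A. x - \<alpha>" x] n by simp
  also have "\<dots> = (if n = size (add_mset a A) then fact n * h ^ n else 0)"
    using add.prems n by (subst (1 2) add.IH) (auto simp: algebra_simps)
  finally show ?case .
qed

text \<open>A Chebyshev-type bound. The \<open>n\<close>-th difference over equally spaced points of the interval is
  \<open>n! * h^n\<close>, but it is at most \<open>2^n\<close> times the largest value at these points.
  The exponential dependence on \<open>n\<close> is essential for the application; picking a point at a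
  definite distance from all roots would lose a factor of the order of \<open>n^n\<close>.\<close>
lemma exists_large_monic_product:
  fixes a b :: real
  assumes "a < b"
  obtains x where "a \<le> x" "x \<le> b" "((b - a) / (2 * exp 1)) ^ size A \<le> (\<Prod>\<alpha>\<in>#A. \<bar>x - \<alpha>\<bar>)"
proof (cases "size A = 0")
  case True
  hence "A = {#}" by simp
  thus ?thesis using assms by (intro that[of a]) auto
next
  case False
  define n where "n = size A"
  define h where "h = (b - a) / real n"
  have n: "n > 0" using False by (auto simp: n_def nonempty_has_size)
  have h: "h > 0" using assms n by (simp add: h_def)
  define f where "f = (\<lambda>x. \<Prod>\<alpha>\<in>#A. x - \<alpha>)"
  have absf: "\<bar>f x\<bar> = (\<Prod>\<alpha>\<in>#A. \<bar>x - \<alpha>\<bar>)" for x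
    unfolding f_def by (induction A) (auto simp: abs_mult)
  define K where "K = Max ((\<lambda>i. \<bar>f (a + real i * h)\<bar>) ` {..n})"
  have "K \<in> (\<lambda>i. \<bar>f (a + real i * h)\<bar>) ` {..n}" unfolding K_def by (rule Max_in) auto
  then obtain i where i: "i \<le> n" "K = \<bar>f (a + real i * h)\<bar>" by auto
  have "\<bar>fdiff h n f a\<bar> \<le> 2 ^ n * K"
    by (rule fdiff_le) (auto simp: K_def intro!: Max_ge)
  hence "fact n * h ^ n \<le> 2 ^ n * K"
    using fdiff_prod[of A n h a] h by (simp add: f_def n_def)
  \<comment> \<open>One term of the exponential series of \<open>e^n\<close>.\<close>
  moreover have "(real n / exp 1) ^ n \<le> fact n"
  proof -
    have "real n ^ n / fact n \<le> (\<Sum>k. real n ^ k / fact k)"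
      using sum_le_suminf[of "\<lambda>k. real n ^ k / fact k" "{n}"] summable_exp[of "real n"]
      by (simp add: divide_inverse mult.commute)
    also have "\<dots> = exp (real n)" by (simp add: exp_def divide_inverse mult.commute)
    also have "\<dots> = exp 1 ^ n" by (simp add: exp_of_nat_mult[of n 1, simplified])
    finally show ?thesis by (simp add: power_divide field_simps)
  qed
  hence "(real n / exp 1) ^ n * h ^ n \<le> fact n * h ^ n" using h by (intro mult_right_mono) auto
  ultimately have "(real n / exp 1 * h) ^ n \<le> 2 ^ n * K"
    unfolding power_mult_distrib by linarith
  moreover have "real n / exp 1 * h = (b - a) / exp 1" using n by (simp add: h_def)
  ultimately have "((b - a) / exp 1) ^ n \<le> 2 ^ n * K" by simp
  moreover have "((b - a) / (2 * exp 1)) ^ n = ((b - a) / exp 1) ^ n / 2 ^ n"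
    by (simp add: power_divide power_mult_distrib)
  ultimately have "((b - a) / (2 * exp 1)) ^ n \<le> K" by (simp add: field_simps)
  moreover have "real i * h \<le> b - a"
  proof -
    have "real i * h \<le> real n * h" using i h by (intro mult_right_mono) auto
    thus ?thesis using n by (simp add: h_def)
  qed
  ultimately show ?thesis using that[of "a + real i * h"] i h absf by (simp add: n_def)
qed

section \<open>Factoring out zeros with multiplicity\<close>

lemma zprod_eq_0_iff: "zprod A z = 0 \<longleftrightarrow> z \<in># A"
  by (induction A) auto

lemma bprod_nonzero:
  assumes "cmod z < R" "\<And>a. a \<in># A \<Longrightarrow> cmod a < R"
  shows "bprod R A z \<noteq> 0"
  using assms(2)
proof (induction A)
  case (add a A)
  have R: "R > 0" using assms(1) norm_ge_zero[of z] by linarith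
  have "cmod (cnj a * z) < R * R"
    unfolding norm_mult using assms(1) add.prems[of a] by (intro mult_strict_mono') auto
  hence "cnj a * z \<noteq> of_real (R\<^sup>2)"
    using R by (metis abs_of_nonneg less_irrefl mult_nonneg_nonneg norm_of_real order_less_imp_le power2_eq_square)
  thus ?case using add R by auto
qed simp

text \<open>Riemann's theorem on removable singularities, applied to one linear factor at a time. The
  hypothesis is a growth condition and not an order of vanishing so that it can be checked
  for functions known only through an inequality.\<close>
lemma holomorphic_divide_zprod:
  assumes "\<Phi> holomorphic_on S" "open S" "set_mset A \<subseteq> S"
    and "\<And>b. b \<in># A \<Longrightarrow> \<exists>L. \<forall>\<^sub>F z in at b. cmod (\<Phi> z) \<le> L * cmod (zprod A z)"
  shows "\<exists>v. v holomorphic_on S \<and> (\<forall>z\<in>S. \<Phi> z = zprod A z * v z)"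
  using assms
proof (induction A arbitrary: \<Phi>)
  case empty
  thus ?case by auto
next
  case (add a A)
  have aS: "a \<in> S" using add.prems by auto
  have inS: "\<forall>\<^sub>F z in at b. z \<in> S" if "b \<in> S" for b
    using add.prems(2) that by (rule eventually_at_in_open')
  from add.prems(4)[of a] obtain L where L: "\<forall>\<^sub>F z in at a. cmod (\<Phi> z) \<le> L * cmod (zprod (add_mset a A) z)"
    by auto
  have "(zprod A \<longlongrightarrow> zprod A a) (at a)"
    using holomorphic_on_imp_continuous_on[OF zprod_holomorphic[of A UNIV]]
    by (simp add: continuous_on_def)
  hence "((\<lambda>z. cmod (zprod A z)) \<longlongrightarrow> cmod (zprod A a)) (at a)" by (rule tendsto_norm)
  hence near: "\<forall>\<^sub>F z in at a. cmod (zprod A z) < cmod (zprod A a) + 1"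
    by (rule order_tendstoD) simp
  have ev: "\<forall>\<^sub>F z in at a. cmod (\<Phi> z / (z - a)) \<le> \<bar>L\<bar> * (cmod (zprod A a) + 1)"
    using L near eventually_neq_at_within[of a a UNIV]
  proof eventually_elim
    case (elim z)
    have "cmod (\<Phi> z / (z - a)) \<le> L * cmod (zprod A z)"
      using elim(1,3) unfolding norm_divide zprod_simps norm_mult
      by (simp add: pos_divide_le_eq mult_ac)
    also have "\<dots> \<le> \<bar>L\<bar> * (cmod (zprod A a) + 1)" using elim(2) by (intro mult_mono) auto
    finally show ?case .
  qed
  have "(\<lambda>z. \<Phi> z / (z - a)) holomorphic_on S - {a}"
    by (intro holomorphic_intros holomorphic_on_subset[OF add.prems(1)]) auto
  moreover have "a \<in> interior S" using aS add.prems(2) by (simp add: interior_open)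
  ultimately obtain g where g: "g holomorphic_on S" "\<And>z. z \<in> S - {a} \<Longrightarrow> g z = \<Phi> z / (z - a)"
    using ev holomorphic_on_extend_bounded[of "\<lambda>z. \<Phi> z / (z - a)" S a] by blast
  have "\<exists>v. v holomorphic_on S \<and> (\<forall>z\<in>S. g z = zprod A z * v z)"
  proof (rule add.IH[OF g(1) add.prems(2)])
    fix b assume b: "b \<in># A"
    with add.prems(4)[of b] obtain M where
      M: "\<forall>\<^sub>F z in at b. cmod (\<Phi> z) \<le> M * cmod (zprod (add_mset a A) z)" by auto
    have bS: "b \<in> S" using b add.prems by auto
    have "\<forall>\<^sub>F z in at b. cmod (g z) \<le> M * cmod (zprod A z)"
      using M inS[OF bS] eventually_neq_at_within[of a b UNIV]
    proof eventually_elim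
      case (elim z)
      have "cmod (g z) = cmod (\<Phi> z) / cmod (z - a)" using elim by (simp add: g norm_divide)
      thus ?case using elim(1,3) unfolding zprod_simps norm_mult
        by (simp add: pos_divide_le_eq mult_ac)
    qed
    thus "\<exists>L. \<forall>\<^sub>F z in at b. cmod (g z) \<le> L * cmod (zprod A z)" by blast
  qed (use add.prems in auto)
  then obtain v where v: "v holomorphic_on S" "\<And>z. z \<in> S \<Longrightarrow> g z = zprod A z * v z" by blast
  have cont: "(h \<longlongrightarrow> h a) (at a)" if "h holomorphic_on S" for h :: "complex \<Rightarrow> complex"
    using holomorphic_on_imp_continuous_on[OF that] aS add.prems(2)
    by (metis continuous_on_def at_within_open)
  have "((\<lambda>z. (z - a) * g z) \<longlongrightarrow> (a - a) * g a) (at a)"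
    by (intro tendsto_intros cont g)
  moreover have "\<forall>\<^sub>F z in at a. (z - a) * g z = \<Phi> z"
    using inS[OF aS] eventually_neq_at_within[of a a UNIV] by eventually_elim (simp add: g)
  ultimately have "(\<Phi> \<longlongrightarrow> 0) (at a)" using Lim_transform_eventually by fastforce
  hence "\<Phi> a = 0" using cont[OF add.prems(1)] tendsto_unique at_neq_bot by blast
  hence "\<Phi> z = (z - a) * g z" if "z \<in> S" for z using that g by (cases "z = a") auto
  thus ?case using v by (intro exI[of _ v]) auto
qed

text \<open>The zeros of \<open>F\<close> in \<open>Z\<close>, each repeated according to its order; \<open>nat\<close> is harmless because the order
  of a holomorphic function is not negative.\<close>
definition zeros_mset :: "(complex \<Rightarrow> complex) \<Rightarrow> complex set \<Rightarrow> complex multiset" where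
  "zeros_mset F Z = (\<Sum>a\<in>Z. replicate_mset (nat (zorder F a)) a)"

lemma zprod_union: "zprod (A + B) z = zprod A z * zprod B z"
  by (simp add: zprod_def)

lemma zprod_replicate: "zprod (replicate_mset n a) z = (z - a) ^ n"
  by (induction n) auto

lemma set_zeros_mset: "finite Z \<Longrightarrow> set_mset (zeros_mset F Z) \<subseteq> Z"
  unfolding zeros_mset_def by (induction Z rule: finite_induct) (auto split: if_splits)

lemma size_zeros_mset: "size (zeros_mset F Z) = (\<Sum>a\<in>Z. nat (zorder F a))"
  unfolding zeros_mset_def by (induction Z rule: infinite_finite_induct) auto

text \<open>Near \<open>a\<close>, \<open>F\<close> is \<open>(z - a)^n\<close> times a function \<open>g\<close> without zero at \<open>a\<close>, and \<open>zprod\<close> is \<open>(z - a)^n\<close> times the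
  product \<open>Q a\<close> of the other linear factors. The local bound makes the division possible, and
  comparing the two forms gives \<open>Q a a * u a = g a\<close>, which is not zero.\<close>
lemma factor_out_zeros:
  assumes F: "F holomorphic_on S" "open S" "connected S" "\<exists>w\<in>S. F w \<noteq> 0"
    and Z: "finite Z" "Z \<subseteq> S"
  obtains u where "u holomorphic_on S" "\<And>z. z \<in> S \<Longrightarrow> F z = zprod (zeros_mset F Z) z * u z"
    "\<And>a. a \<in> Z \<Longrightarrow> u a \<noteq> 0"
proof -
  define A where "A = zeros_mset F Z"
  define Q where "Q = (\<lambda>a. zprod (zeros_mset F (Z - {a})))"
  have ZQ: "zprod A z = (z - a) ^ nat (zorder F a) * Q a z" if "a \<in> Z" for a z
    unfolding A_def Q_def zeros_mset_def using Z that
    by (subst sum.remove[of Z a]) (auto simp: zprod_union zprod_replicate)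
  have Qa: "Q a a \<noteq> 0" for a
    using set_zeros_mset[of "Z - {a}" F] Z by (auto simp: Q_def zprod_eq_0_iff)
  have Qlim: "(Q a \<longlongrightarrow> Q a a) (at a)" for a
    using holomorphic_on_imp_continuous_on[OF zprod_holomorphic[of _ UNIV]]
    by (simp add: continuous_on_def Q_def)
  have loc: "\<exists>g r. r > 0 \<and> (g \<longlongrightarrow> g a) (at a) \<and> g a \<noteq> 0 \<and>
      (\<forall>z\<in>ball a r. F z = g z * (z - a) ^ nat (zorder F a))" if a: "a \<in> Z" for a
  proof -
    have "a \<in> S" using a Z by auto
    from zorder_exist_zero[OF F(1-3) this F(4)] obtain r where r: "r > 0"
      "zor_poly F a holomorphic_on cball a r"
      "\<forall>w\<in>cball a r. F w = zor_poly F a w * (w - a) ^ nat (zorder F a) \<and> zor_poly F a w \<noteq> 0" by blast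
    have "continuous_on (ball a r) (zor_poly F a)"
      using r by (intro holomorphic_on_imp_continuous_on holomorphic_on_subset[OF r(2)]) auto
    hence "(zor_poly F a \<longlongrightarrow> zor_poly F a a) (at a)"
      using r(1) by (metis centre_in_ball continuous_on_def at_within_open open_ball)
    thus ?thesis using r by (intro exI[of _ "zor_poly F a"] exI[of _ r]) auto
  qed
  have "\<exists>v. v holomorphic_on S \<and> (\<forall>z\<in>S. F z = zprod A z * v z)"
  proof (rule holomorphic_divide_zprod[OF F(1,2)])
    show "set_mset A \<subseteq> S" using set_zeros_mset Z unfolding A_def by blast
    fix a assume "a \<in># A"
    hence a: "a \<in> Z" using set_zeros_mset Z unfolding A_def by blast
    from loc[OF a] obtain g r where g: "r > 0" "(g \<longlongrightarrow> g a) (at a)"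
      "\<forall>z\<in>ball a r. F z = g z * (z - a) ^ nat (zorder F a)" by blast
    have "((\<lambda>z. cmod (g z / Q a z)) \<longlongrightarrow> cmod (g a / Q a a)) (at a)"
      by (intro tendsto_intros g Qlim Qa)
    hence "\<forall>\<^sub>F z in at a. cmod (g z / Q a z) < cmod (g a / Q a a) + 1"
      by (rule order_tendstoD) simp
    moreover have "\<forall>\<^sub>F z in at a. z \<in> ball a r"
      using g(1) by (intro eventually_at_in_open') auto
    moreover have "\<forall>\<^sub>F z in at a. Q a z \<noteq> 0"
      using Qlim Qa by (rule tendsto_imp_eventually_ne)
    ultimately have "\<forall>\<^sub>F z in at a. cmod (F z) \<le> (cmod (g a / Q a a) + 1) * cmod (zprod A z)"
    proof eventually_elim
      case (elim z)
      have "cmod (F z) = cmod (z - a) ^ nat (zorder F a) * (cmod (g z / Q a z) * cmod (Q a z))"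
        using elim g(3) by (simp add: norm_mult norm_power norm_divide)
      also have "\<dots> \<le> cmod (z - a) ^ nat (zorder F a) * ((cmod (g a / Q a a) + 1) * cmod (Q a z))"
        using elim by (intro mult_left_mono mult_right_mono) auto
      finally show ?case by (simp add: ZQ[OF a] norm_mult norm_power mult_ac)
    qed
    thus "\<exists>L. \<forall>\<^sub>F z in at a. cmod (F z) \<le> L * cmod (zprod A z)" by blast
  qed
  then obtain u where u: "u holomorphic_on S" "\<And>z. z \<in> S \<Longrightarrow> F z = zprod A z * u z" by blast
  have "u a \<noteq> 0" if a: "a \<in> Z" for a
  proof -
    from loc[OF a] obtain g r where g: "r > 0" "(g \<longlongrightarrow> g a) (at a)" "g a \<noteq> 0"
      "\<forall>z\<in>ball a r. F z = g z * (z - a) ^ nat (zorder F a)" by blast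
    have aS: "a \<in> S" using a Z by auto
    have "(u \<longlongrightarrow> u a) (at a)"
      using holomorphic_on_imp_continuous_on[OF u(1)] aS F(2) by (metis continuous_on_def at_within_open)
    hence "((\<lambda>z. Q a z * u z) \<longlongrightarrow> Q a a * u a) (at a)" by (intro tendsto_intros Qlim)
    moreover have "\<forall>\<^sub>F z in at a. Q a z * u z = g z"
      using eventually_at_in_open'[OF F(2) aS] eventually_at_in_open'[OF open_ball centre_in_ball[THEN iffD2, OF g(1)]]
        eventually_neq_at_within[of a a UNIV]
    proof eventually_elim
      case (elim z)
      have "(z - a) ^ nat (zorder F a) * (Q a z * u z) = (z - a) ^ nat (zorder F a) * g z"
        using u(2)[of z] g(4) elim ZQ[OF a, of z] by (simp add: mult_ac)
      thus ?case using elim by simp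
    qed
    ultimately have "(g \<longlongrightarrow> Q a a * u a) (at a)" by (rule Lim_transform_eventually)
    hence "Q a a * u a = g a" using g(2) tendsto_unique at_neq_bot by blast
    thus ?thesis using g(3) by auto
  qed
  thus ?thesis using that u unfolding A_def by blast
qed

lemma finite_zeros_cball:
  assumes "F holomorphic_on ball 0 R" "\<rho> < R" "w \<in> ball 0 R" "F w \<noteq> 0"
  shows "finite {z \<in> cball 0 \<rho>. F z = 0}"
proof (cases "F constant_on ball 0 R")
  case True
  hence "F z \<noteq> 0" if "z \<in> cball 0 \<rho>" for z
    using assms that unfolding constant_on_def by force
  thus ?thesis by (auto simp: Collect_empty_eq[THEN iffD2])
next
  case False
  show ?thesis
    by (rule holomorphic_compact_finite_zeros[OF assms(1)]) (use assms False in auto)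
qed

lemma zorder_nonneg_on:
  assumes "F holomorphic_on ball 0 R" "w \<in> ball 0 R" "F w \<noteq> 0" "z \<in> ball 0 R"
  shows "zorder F z \<ge> 0"
proof -
  have "\<exists>w\<in>ball 0 R. F w \<noteq> 0" using assms(2,3) by blast
  from zorder_exist_zero[OF assms(1) open_ball connected_ball assms(4) this]
  show "zorder F z \<ge> 0" by (auto split: if_splits)
qed

section \<open>Circles on which a function is large, and stability of the zero count\<close>

text \<open>Rouche's theorem for the addition of a constant, with all winding numbers evaluated. The open
  set in which Rouche's theorem is applied is a slightly larger disc, so that the zeros in it
  form a finite set.\<close>
lemma rouche_circle_shift:
  assumes F: "F holomorphic_on ball 0 R" and \<rho>: "0 < \<rho>" "\<rho> < R"
    and big: "\<And>z. cmod z = \<rho> \<Longrightarrow> cmod c < cmod (F z)"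
  shows "(\<Sum>z | z \<in> ball 0 \<rho> \<and> F z + c = 0. zorder (\<lambda>z. F z + c) z)
       = (\<Sum>z | z \<in> ball 0 \<rho> \<and> F z = 0. zorder F z)"
proof -
  define r' where "r' = (\<rho> + R) / 2"
  have r': "\<rho> < r'" "r' < R" using \<rho> by (auto simp: r'_def)
  define \<gamma> where "\<gamma> = circlepath (0::complex) \<rho>"
  have w1: "winding_number \<gamma> z = 1" if "z \<in> ball 0 \<rho>" for z
    using that unfolding \<gamma>_def by (intro winding_number_circlepath) auto
  have w0: "winding_number \<gamma> z = 0" if "z \<notin> cball 0 \<rho>" for z
    using that \<rho> unfolding \<gamma>_def by (intro winding_number_zero_outside[of _ "cball 0 \<rho>"]) auto
  have \<rho>in: "of_real \<rho> \<in> ball (0::complex) R" "cmod (of_real \<rho>) = \<rho>" using \<rho> by auto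
  have fin: "finite {z \<in> ball 0 r'. G z = 0}"
    if "G holomorphic_on ball 0 R" "G (of_real \<rho>) \<noteq> 0" for G
    by (rule finite_subset[OF _ finite_zeros_cball[OF that(1) r'(2) \<rho>in(1) that(2)]]) auto
  have nz: "F (of_real \<rho>) \<noteq> 0" using big[OF \<rho>in(2)] by auto
  have nz2: "F z + c \<noteq> 0" if "cmod z = \<rho>" for z
    using big[OF that] by (auto simp: add_eq_0_iff)
  have holc: "(\<lambda>z. F z + c) holomorphic_on ball 0 R" by (intro holomorphic_intros F)
  have "(\<Sum>p\<in>{p\<in>ball 0 r'. F p + c = 0}. winding_number \<gamma> p * zorder (\<lambda>p. F p + c) p)
      = (\<Sum>p\<in>{p\<in>ball 0 r'. F p = 0}. winding_number \<gamma> p * zorder F p)"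
  proof (rule Rouche_theorem)
    show "finite {p \<in> ball 0 r'. F p + c = 0}" by (rule fin[OF holc nz2]) (use \<rho>in in simp)
    show "finite {p \<in> ball 0 r'. F p = 0}" by (rule fin[OF F nz])
    show "F holomorphic_on ball 0 r'" by (rule holomorphic_on_subset[OF F]) (use r' in auto)
    show "path_image \<gamma> \<subseteq> ball 0 r'" using \<rho> r' by (auto simp: \<gamma>_def)
    show "\<forall>z\<in>path_image \<gamma>. cmod c < cmod (F z)" using \<rho> big by (auto simp: \<gamma>_def)
    show "\<forall>z. z \<notin> ball 0 r' \<longrightarrow> winding_number \<gamma> z = 0" using r' w0 by auto
  qed (auto simp: \<gamma>_def)
  also have "(\<Sum>p\<in>{p\<in>ball 0 r'. F p + c = 0}. winding_number \<gamma> p * zorder (\<lambda>p. F p + c) p)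
    = (\<Sum>p | p \<in> ball 0 \<rho> \<and> F p + c = 0. of_int (zorder (\<lambda>p. F p + c) p))"
  proof (rule sum.mono_neutral_cong_right)
    show "finite {p \<in> ball 0 r'. F p + c = 0}" by (rule fin[OF holc nz2]) (use \<rho>in in simp)
    show "\<forall>p\<in>{p \<in> ball 0 r'. F p + c = 0} - {p. p \<in> ball 0 \<rho> \<and> F p + c = 0}.
        winding_number \<gamma> p * of_int (zorder (\<lambda>p. F p + c) p) = 0"
    proof
      fix p assume "p \<in> {p \<in> ball 0 r'. F p + c = 0} - {p. p \<in> ball 0 \<rho> \<and> F p + c = 0}"
      hence "p \<notin> cball 0 \<rho>" using nz2[of p] by (auto simp: order_le_less)
      thus "winding_number \<gamma> p * of_int (zorder (\<lambda>p. F p + c) p) = 0" by (simp add: w0)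
    qed
  qed (use r' w1 in auto)
  also have "(\<Sum>p\<in>{p\<in>ball 0 r'. F p = 0}. winding_number \<gamma> p * zorder F p)
    = (\<Sum>p | p \<in> ball 0 \<rho> \<and> F p = 0. of_int (zorder F p))"
  proof (rule sum.mono_neutral_cong_right)
    have nz3: "F z \<noteq> 0" if "cmod z = \<rho>" for z using big[OF that] by auto
    show "finite {p \<in> ball 0 r'. F p = 0}" by (rule fin[OF F nz])
    show "\<forall>p\<in>{p \<in> ball 0 r'. F p = 0} - {p. p \<in> ball 0 \<rho> \<and> F p = 0}.
        winding_number \<gamma> p * of_int (zorder F p) = 0"
    proof
      fix p assume "p \<in> {p \<in> ball 0 r'. F p = 0} - {p. p \<in> ball 0 \<rho> \<and> F p = 0}"
      hence "p \<notin> cball 0 \<rho>" using nz3[of p] by (auto simp: order_le_less)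
      thus "winding_number \<gamma> p * of_int (zorder F p) = 0" by (simp add: w0)
    qed
  qed (use r' w1 in auto)
  finally have "complex_of_int (\<Sum>z | z \<in> ball 0 \<rho> \<and> F z + c = 0. zorder (\<lambda>z. F z + c) z)
       = complex_of_int (\<Sum>z | z \<in> ball 0 \<rho> \<and> F z = 0. zorder F z)" by simp
  thus ?thesis by (simp only: of_int_eq_iff)
qed

text \<open>The minimum modulus principle. Let \<open>V\<close> be \<open>F\<close> divided by the Blaschke product of its \<open>n\<close> zeros in the
  disc of radius \<open>r\<close>. Then \<open>ln (C / \<bar>V\<bar>)\<close> is a nonnegative harmonic function on that disc, and its value at
  \<open>zz\<close> is at most \<open>ln (C / A0)\<close>; Harnack's inequality gives the first summand of \<open>K\<close>. Each zero
  diminishes \<open>\<bar>F zz\<bar>\<close> by a factor \<open>\<beta>\<close>, so \<open>n\<close> is at most \<open>ln (C / A0) / ln (1 / \<beta>)\<close>, and on a suitable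
  circle each zero costs on average a factor \<open>(hi - lo) / (4 * e * R)\<close>; this gives the second
  summand.\<close>
lemma large_modulus_circle:
  assumes F: "F holomorphic_on ball 0 R" and C: "\<And>z. cmod z < R \<Longrightarrow> cmod (F z) \<le> C"
    and r: "0 \<le> x" "x < r" "r < R"
    and zz: "cmod zz \<le> x" "A0 \<le> cmod (F zz)" "0 < A0"
    and lohi: "0 \<le> lo" "lo < hi" "hi < r"
  defines "\<beta> \<equiv> R * (x + r) / (R\<^sup>2 + x * r)"
  defines "K \<equiv> (r + hi) * (r + x) / ((r - hi) * (r - x)) + ln (4 * exp 1 * R / (hi - lo)) / ln (1 / \<beta>)"
  obtains \<rho> where "lo \<le> \<rho>" "\<rho> \<le> hi"
    "\<And>z. cmod z = \<rho> \<Longrightarrow> C * exp (- (K * ln (C / A0))) \<le> cmod (F z)"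
proof -
  define Z where "Z = {z \<in> cball 0 r. F z = 0}"
  have R: "R > 0" using r by linarith
  have zzR: "zz \<in> ball 0 R" "cmod zz < R" using zz r by auto
  have zznz: "F zz \<noteq> 0" using zz by auto
  have C0: "A0 \<le> C" "C > 0" using C[OF zzR(2)] zz by linarith+
  have finZ: "finite Z" unfolding Z_def by (rule finite_zeros_cball[OF F r(3) zzR(1) zznz])
  have ZR: "Z \<subseteq> ball 0 R" using r by (auto simp: Z_def)
  obtain u where u: "u holomorphic_on ball 0 R"
    "\<And>z. z \<in> ball 0 R \<Longrightarrow> F z = zprod (zeros_mset F Z) z * u z" "\<And>a. a \<in> Z \<Longrightarrow> u a \<noteq> 0"
    by (rule factor_out_zeros[OF F _ _ _ finZ ZR]) (use zzR zznz in auto)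
  define A where "A = zeros_mset F Z"
  have A: "cmod a \<le> r" "cmod a < R" if "a \<in># A" for a
    using that set_zeros_mset[OF finZ, of F] r by (auto simp: A_def Z_def)
  define V where "V = (\<lambda>z. bprod R A z * u z)"
  have holV: "V holomorphic_on ball 0 R" unfolding V_def by (intro holomorphic_intros u)
  have VC: "cmod (V z) \<le> C" if "cmod z < R" for z
    unfolding V_def
  proof (rule divide_blaschke_product[OF u(1) A(2) _ that])
    fix w assume "cmod w < R"
    thus "cmod (zprod A w * u w) \<le> C" using C[of w] u(2)[of w] by (simp add: A_def)
  qed
  have Vnz: "V z \<noteq> 0" if "cmod z \<le> r" for z
  proof -
    have "z \<in> ball 0 R" using that r by auto
    hence "u z \<noteq> 0" using u(2)[of z] u(3)[of z] that by (auto simp: Z_def)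
    moreover have "bprod R A z \<noteq> 0" using that r A(2) by (intro bprod_nonzero) auto
    ultimately show ?thesis by (simp add: V_def)
  qed
  define n where "n = size A"
  define \<Lambda> where "\<Lambda> = ln (C / A0)"
  have \<Lambda>0: "\<Lambda> \<ge> 0" using C0 zz by (simp add: \<Lambda>_def)
  have D: "R\<^sup>2 + x * r > 0" using R r by (simp add: add_pos_nonneg)
  have \<beta>: "0 < \<beta>" "\<beta> < 1"
  proof -
    show "0 < \<beta>" using R r D by (simp add: \<beta>_def)
    have "0 < (R - x) * (R - r)" using r by simp
    hence "R * (x + r) < R\<^sup>2 + x * r" by (simp add: algebra_simps power2_eq_square)
    thus "\<beta> < 1" using D by (simp add: \<beta>_def)
  qed
  have zzV: "A0 \<le> \<beta> ^ n * cmod (V zz)"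
  proof -
    have "cmod (F zz) = cmod (zprod A zz) * cmod (u zz)" using u(2)[OF zzR(1)] by (simp add: A_def norm_mult)
    also have "\<dots> \<le> (\<beta> ^ n * cmod (bprod R A zz)) * cmod (u zz)"
      unfolding \<beta>_def n_def using zz r A by (intro mult_right_mono zprod_le_bprod) auto
    finally show ?thesis using zz by (simp add: V_def norm_mult mult.assoc)
  qed
  have "A0 \<le> \<beta> ^ n * C"
    by (rule order_trans[OF zzV mult_left_mono[OF VC[OF zzR(2)]]]) (use \<beta> in auto)
  hence "A0 / C \<le> \<beta> ^ n" using C0 by (simp add: field_simps)
  hence "ln (A0 / C) \<le> ln (\<beta> ^ n)" using C0 zz \<beta> by (subst ln_le_cancel_iff) auto
  hence "real n * ln (1 / \<beta>) \<le> \<Lambda>" using \<beta> C0 zz by (simp add: ln_realpow ln_div \<Lambda>_def)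
  hence n_le: "real n \<le> \<Lambda> / ln (1 / \<beta>)" using \<beta> by (simp add: field_simps)
  have "\<beta> ^ n * cmod (V zz) \<le> 1 * cmod (V zz)"
    using \<beta> by (intro mult_right_mono power_le_one) auto
  hence VA0: "A0 \<le> cmod (V zz)" using zzV by simp
  have "(\<lambda>z. of_real C / V z) holomorphic_on ball 0 r"
    by (intro holomorphic_intros holomorphic_on_subset[OF holV]) (use r Vnz in auto)
  then obtain g where g: "g holomorphic_on ball 0 r" "\<And>z. z \<in> ball 0 r \<Longrightarrow> of_real C / V z = exp (g z)"
    by (rule contractible_imp_holomorphic_log) (use Vnz C0 in \<open>auto simp: convex_imp_contractible\<close>)
  have exp_g: "exp (Re (g z)) = C / cmod (V z)" if "cmod z < r" for z
  proof -
    have "cmod (of_real C / V z) = cmod (exp (g z))" using g(2)[of z] that by simp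
    thus ?thesis using C0 by (simp add: norm_divide)
  qed
  have Reg: "0 \<le> Re (g z)" if "cmod z < r" for z
  proof -
    have "1 \<le> C / cmod (V z)" using VC[of z] Vnz[of z] that r by simp
    thus ?thesis using exp_g[OF that] by (metis exp_le_cancel_iff exp_zero)
  qed
  define H where "H = (r + hi) * (r + x) / ((r - hi) * (r - x))"
  have H0: "H \<ge> 0" using r lohi by (simp add: H_def)
  have zzr: "cmod zz < r" using zz r by linarith
  have "exp (Re (g zz)) \<le> C / A0" unfolding exp_g[OF zzr] using VA0 zz(3) C0(2)
    by (intro divide_left_mono mult_pos_pos) auto
  hence "ln (exp (Re (g zz))) \<le> ln (C / A0)" using C0(2) zz(3) by (subst ln_le_cancel_iff) auto
  hence Regzz: "Re (g zz) \<le> \<Lambda>" by (simp add: \<Lambda>_def)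
  have Vbig: "C * exp (- (H * \<Lambda>)) \<le> cmod (V z)" if z: "cmod z \<le> hi" for z
  proof -
    have "Re (g z) \<le> H * Re (g zz)"
      unfolding H_def by (rule harnack_Re[OF g(1) Reg]) (use z lohi zz r in auto)
    also have "\<dots> \<le> H * \<Lambda>" using Regzz H0 by (rule mult_left_mono)
    finally have "exp (Re (g z)) \<le> exp (H * \<Lambda>)" by simp
    hence "C / cmod (V z) \<le> exp (H * \<Lambda>)" using exp_g[of z] z lohi by simp
    hence "C \<le> exp (H * \<Lambda>) * cmod (V z)" using Vnz[of z] z lohi by (simp add: pos_divide_le_eq)
    hence "C / exp (H * \<Lambda>) \<le> cmod (V z)" by (simp add: pos_divide_le_eq mult.commute)
    thus ?thesis by (simp add: exp_minus divide_inverse)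
  qed
  obtain \<rho> where \<rho>: "lo \<le> \<rho>" "\<rho> \<le> hi"
    "((hi - lo) / (2 * exp 1)) ^ size (image_mset cmod A) \<le> (\<Prod>\<alpha>\<in>#image_mset cmod A. \<bar>\<rho> - \<alpha>\<bar>)"
    by (rule exists_large_monic_product[OF lohi(2), of "image_mset cmod A"])
  \<comment> \<open>The average loss per zero: \<open>2 * e / (hi - lo)\<close> from the moduli of the zeros, \<open>2 * R\<close> from the Blaschke denominators.\<close>
  define E where "E = 4 * exp 1 * R / (hi - lo)"
  have E1: "E \<ge> 1"
  proof -
    have "hi - lo \<le> 4 * 1 * R" using r lohi by simp
    also have "\<dots> \<le> 4 * exp 1 * R" using R by (intro mult_right_mono) auto
    finally show ?thesis using lohi by (simp add: E_def)
  qed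
  have "C * exp (- (K * \<Lambda>)) \<le> cmod (F z)" if z: "cmod z = \<rho>" for z
  proof -
    have zR: "cmod z < R" using z \<rho> lohi r by linarith
    have "real n * ln E \<le> \<Lambda> / ln (1 / \<beta>) * ln E" using n_le E1 by (intro mult_right_mono) auto
    hence "exp (- (\<Lambda> / ln (1 / \<beta>) * ln E)) \<le> exp (- (real n * ln E))" by simp
    also have "\<dots> = (1 / E) ^ n" using E1 by (simp add: exp_minus exp_of_nat_mult power_divide inverse_eq_divide)
    finally have e1: "exp (- (\<Lambda> / ln (1 / \<beta>) * ln E)) \<le> (1 / E) ^ n" .
    have "C * exp (- (K * \<Lambda>)) = exp (- (\<Lambda> / ln (1 / \<beta>) * ln E)) * (C * exp (- (H * \<Lambda>)))"
    proof -
      have "- (K * \<Lambda>) = - (\<Lambda> / ln (1 / \<beta>) * ln E) + - (H * \<Lambda>)"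
        unfolding K_def H_def E_def by (simp add: distrib_right)
      thus ?thesis by (simp only: exp_add mult_ac)
    qed
    also have "\<dots> \<le> (1 / E) ^ n * cmod (V z)"
      using e1 Vbig[of z] z \<rho> E1 C0 by (intro mult_mono) auto
    also have "\<dots> = (((hi - lo) / (2 * exp 1)) ^ n / (2 * R) ^ n * cmod (bprod R A z)) * cmod (u z)"
    proof -
      have "1 / E = (hi - lo) / (2 * exp 1) / (2 * R)" using lohi R by (simp add: E_def)
      hence "(1 / E) ^ n = ((hi - lo) / (2 * exp 1)) ^ n / (2 * R) ^ n"
        by (simp only: power_divide)
      thus ?thesis by (simp add: V_def norm_mult)
    qed
    also have "\<dots> \<le> ((\<Prod>a\<in>#A. \<bar>cmod z - cmod a\<bar>) / (2 * R) ^ n * cmod (bprod R A z)) * cmod (u z)"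
      using \<rho>(3) R z by (intro mult_right_mono divide_right_mono) (auto simp: n_def image_mset.compositionality o_def)
    also have "\<dots> \<le> cmod (zprod A z) * cmod (u z)"
      unfolding n_def using zR A by (intro mult_right_mono zprod_ge_bprod) auto
    also have "\<dots> = cmod (F z)" using u(2)[of z] zR by (simp add: A_def norm_mult)
    finally show ?thesis .
  qed
  thus ?thesis unfolding \<Lambda>_def by (rule that[OF \<rho>(1,2)])
qed

section \<open>The explicit constants\<close>

text \<open>The circle provided by the minimum modulus principle has its radius between \<open>r / s\<close> and
  \<open>mid_radius s * r\<close>. This is one sixth of the way from \<open>r / s\<close> to \<open>r\<close>: close enough to \<open>r / s\<close> for
  \<open>mid_radius_exponent\<close>, and far enough for the length of the interval to be of the order of \<open>s - 1\<close>.\<close>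
definition mid_radius :: "real \<Rightarrow> real" where
  "mid_radius s = (s + 5) / (6 * s)"

text \<open>With \<open>t = s\<^sup>2\<close>, the Harnack constant for two points of the disc of radius \<open>r\<close> inside the disc of radius
  \<open>t * r\<close>.\<close>
definition growth_const :: "real \<Rightarrow> real" where
  "growth_const s = ((s\<^sup>2 + 1) / (s\<^sup>2 - 1))\<^sup>2"

text \<open>The constant \<open>K\<close> of \<open>large_modulus_circle\<close> for the radii \<open>r / s\<^sup>2\<close>, \<open>r\<close>, \<open>s\<^sup>2 * r\<close> and the interval from
  \<open>r / s\<close> to \<open>mid_radius s * r\<close>.\<close>
definition circle_const :: "real \<Rightarrow> real" where
  "circle_const s = (1 + mid_radius s) * (s\<^sup>2 + 1) / ((1 - mid_radius s) * (s\<^sup>2 - 1))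
     + ln (24 * exp 1 * s ^ 3 / (s - 1)) / ln ((s ^ 4 - s\<^sup>2 + 1) / s\<^sup>2)"

text \<open>The constants \<open>a1\<close> and \<open>a2\<close> are taken as large as the theorem permits, with \<open>t = s\<^sup>2\<close>.\<close>
definition a1_const :: "real \<Rightarrow> real" where
  "a1_const s = 300 * (s + 1) * s ^ 3 / (s\<^sup>2 - 1)\<^sup>2"

definition a2_const :: "real \<Rightarrow> real" where
  "a2_const s = (36 * (s + 1)\<^sup>2 + 162 * ln (108 * exp 1 / (s - 1))) / (s - 1) ^ 4"

lemma mid_radius_bounds:
  assumes "1 < s"
  shows "1 / s < mid_radius s" "mid_radius s < 1" "mid_radius s - 1 / s = (s - 1) / (6 * s)" "0 < mid_radius s"
  using assms by (auto simp: mid_radius_def field_simps)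

text \<open>Zeros in the disc of radius \<open>r / s\<close> would give the Schwarz factor \<open>(1 + s\<^sup>2) / (2 * s)\<close> per zero; moving
  them out to radius \<open>mid_radius s * r\<close> is shown to preserve two thirds of its logarithm. What matters later is that
  two thirds exceeds one half, the share of the growth that the three circles theorem allows.\<close>
lemma mid_radius_exponent:
  assumes s: "1 < s" "s \<le> 3"
  shows "((1 + s\<^sup>2) / (2 * s))\<^sup>2 \<le> ((s + mid_radius s) / (1 + s * mid_radius s)) ^ 3"
proof -
  define d where "d = s - 1"
  have d: "0 < d" "d \<le> 2" "s = 1 + d" using s by (auto simp: d_def)
  have "d ^ 5 \<le> 2 * d ^ 4" "d ^ 6 \<le> 4 * d ^ 4"
  proof -
    show "d ^ 5 \<le> 2 * d ^ 4" using mult_right_mono[OF d(2), of "d ^ 4"] d by (simp add: eval_nat_numeral)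
    have "d\<^sup>2 \<le> 2\<^sup>2" using d by (intro power_mono) auto
    from mult_right_mono[OF this, of "d ^ 4"] d show "d ^ 6 \<le> 4 * d ^ 4"
      by (simp flip: power_add)
  qed
  hence "0 \<le> 1728 + 3168 * d + 2940 * d\<^sup>2 + 1280 * d ^ 3 + 240 * d ^ 4 - 41 * d ^ 5 - d ^ 6"
    using d zero_le_power[of d 3] zero_le_power[of d 4] zero_le_power[of d 2] by linarith
  hence "0 \<le> d\<^sup>2 * (1728 + 3168 * d + 2940 * d\<^sup>2 + 1280 * d ^ 3 + 240 * d ^ 4 - 41 * d ^ 5 - d ^ 6)"
    by simp
  \<comment> \<open>Expanded at \<open>s = 1\<close>, where both sides agree to first order, the difference of the two polynomials has a factor \<open>d\<^sup>2\<close>, and the negative terms are small for \<open>d \<le> 2\<close>.\<close>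
  also have "\<dots> = 4 * (6 * s\<^sup>2 + s + 5) ^ 3 - s * (s\<^sup>2 + 1)\<^sup>2 * (s + 11) ^ 3"
    unfolding d(3) by (simp add: eval_nat_numeral algebra_simps)
  finally have key: "s * (s\<^sup>2 + 1)\<^sup>2 * (s + 11) ^ 3 \<le> 4 * (6 * s\<^sup>2 + s + 5) ^ 3" by simp
  have X: "(s + mid_radius s) / (1 + s * mid_radius s) = (6 * s\<^sup>2 + s + 5) / (s * (s + 11))"
  proof -
    have "s + mid_radius s = (6 * s\<^sup>2 + s + 5) / (6 * s)" "1 + s * mid_radius s = (s + 11) / 6"
      using s by (simp_all add: mid_radius_def field_simps power2_eq_square)
    thus ?thesis by simp
  qed
  have pos: "4 * s\<^sup>2 > 0" "(s * (s + 11)) ^ 3 > 0" using s by auto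
  have "(1 + s\<^sup>2)\<^sup>2 * (s * (s + 11)) ^ 3 = s\<^sup>2 * (s * (s\<^sup>2 + 1)\<^sup>2 * (s + 11) ^ 3)"
    by (simp add: eval_nat_numeral algebra_simps)
  also have "\<dots> \<le> s\<^sup>2 * (4 * (6 * s\<^sup>2 + s + 5) ^ 3)" using key by (intro mult_left_mono) auto
  also have "\<dots> = (6 * s\<^sup>2 + s + 5) ^ 3 * (4 * s\<^sup>2)" by simp
  finally have "(1 + s\<^sup>2)\<^sup>2 / (4 * s\<^sup>2) \<le> (6 * s\<^sup>2 + s + 5) ^ 3 / (s * (s + 11)) ^ 3"
    using pos by (simp only: pos_divide_le_eq times_divide_eq_left pos_le_divide_eq)
  thus ?thesis unfolding X by (simp add: power_divide power_mult_distrib)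
qed

lemma log_const_ge:
  fixes s :: real
  assumes "1 < s" "s \<le> 3"
  shows "1 \<le> ln (108 * exp 1 / (s - 1))"
proof -
  have "exp 1 * (s - 1) \<le> exp 1 * 108" using assms by (intro mult_left_mono) auto
  hence "exp 1 \<le> 108 * exp 1 / (s - 1)" using assms by (simp add: field_simps)
  thus ?thesis using assms by (simp add: ln_ge_iff)
qed

lemma circle_const_le:
  assumes s: "1 < s" "s \<le> 3"
  shows "circle_const s \<le> a2_const s"
proof -
  define d where "d = s - 1"
  have d: "0 < d" "d \<le> 2" "s = 1 + d" using s by (auto simp: d_def)
  have d2: "d\<^sup>2 \<le> 4" using power_mono[OF d(2), of 2] d by simp
  define l where "l = ln (108 * exp 1 / d)"
  have l: "1 \<le> l" using log_const_ge[OF s] by (simp add: l_def d_def)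
  have ss: "0 < s\<^sup>2 - 1" "s\<^sup>2 - 1 = d * (s + 1)" using one_less_power[of s 2] s d by (auto simp: power2_eq_square algebra_simps)
  have 1: "(1 + mid_radius s) * (s\<^sup>2 + 1) / ((1 - mid_radius s) * (s\<^sup>2 - 1)) \<le> 36 * (s + 1)\<^sup>2 / d ^ 4"
  proof -
    have e: "1 + mid_radius s = (7 * s + 5) / (6 * s)" "1 - mid_radius s = 5 * d / (6 * s)"
      using s by (simp_all add: mid_radius_def d_def field_simps)
    have "(1 + mid_radius s) * (s\<^sup>2 + 1) / ((1 - mid_radius s) * (s\<^sup>2 - 1))
        = (7 * s + 5) * (s\<^sup>2 + 1) / (5 * d * (d * (s + 1)))"
      unfolding e ss(2) using s by simp
    also have "\<dots> \<le> 7 * (s + 1) * (s + 1)\<^sup>2 / (5 * d * (d * (s + 1)))"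
      using s d by (intro divide_right_mono mult_mono) (auto simp: power2_eq_square algebra_simps)
    also have "\<dots> = 7 / 5 * (s + 1)\<^sup>2 * d\<^sup>2 / d ^ 4"
      using s d by (simp add: eval_nat_numeral)
    also have "\<dots> \<le> 7 / 5 * (s + 1)\<^sup>2 * 4 / d ^ 4"
      using d2 d by (intro divide_right_mono mult_left_mono) auto
    also have "\<dots> \<le> 36 * (s + 1)\<^sup>2 / d ^ 4" using d by (intro divide_right_mono) auto
    finally show ?thesis .
  qed
  have 2: "ln (24 * exp 1 * s ^ 3 / (s - 1)) \<le> 2 * l"
  proof -
    have "s ^ 3 \<le> 3 ^ 3" using s by (intro power_mono) auto
    hence "24 * s ^ 3 * d \<le> 24 * 27 * 2" using d s by (intro mult_mono) auto
    also have "\<dots> \<le> 108 * 108 * exp (1::real)" using exp_ge_add_one_self[of "1::real"] by linarith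
    finally have "24 * exp 1 * s ^ 3 * d \<le> 108 * 108 * exp 1 * exp 1"
      using mult_left_mono[of "24 * s ^ 3 * d" "108 * 108 * exp 1" "exp 1"] by (simp add: mult_ac)
    hence "24 * exp 1 * s ^ 3 * d / d\<^sup>2 \<le> 108 * 108 * exp 1 * exp 1 / d\<^sup>2" by (rule divide_right_mono) simp
    hence "24 * exp 1 * s ^ 3 / d \<le> (108 * exp 1 / d)\<^sup>2"
      using d by (simp add: power2_eq_square)
    hence "ln (24 * exp 1 * s ^ 3 / d) \<le> ln ((108 * exp 1 / d)\<^sup>2)"
      using d s by (subst ln_le_cancel_iff) auto
    also have "\<dots> = 2 * l" using d by (simp add: l_def ln_realpow)
    finally show ?thesis by (simp add: d_def)
  qed
  define Q where "Q = (s ^ 4 - s\<^sup>2 + 1) / s\<^sup>2"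
  have Qe: "Q = 1 + (s\<^sup>2 - 1)\<^sup>2 / s\<^sup>2" using s by (simp add: Q_def field_simps eval_nat_numeral)
  have "(s\<^sup>2 - 1)\<^sup>2 / s\<^sup>2 > 0" using ss(1) s by (intro divide_pos_pos zero_less_power) auto
  hence Q1: "Q > 1" by (simp add: Qe)
  have "ln (1 / Q) \<le> 1 / Q - 1" using Q1 by (intro ln_le_minus_one) simp
  hence lnQ: "1 - 1 / Q \<le> ln Q" using Q1 by (simp add: ln_div)
  have "1 - 1 / Q > 0" using Q1 by simp
  hence "1 / ln Q \<le> 1 / (1 - 1 / Q)" using lnQ Q1 by (intro divide_left_mono mult_pos_pos) auto
  also have "\<dots> = Q / (Q - 1)" using Q1 by (simp add: field_simps)
  also have "\<dots> = (s ^ 4 - s\<^sup>2 + 1) / (d * (s + 1))\<^sup>2"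
  proof -
    have "Q - 1 = (d * (s + 1))\<^sup>2 / s\<^sup>2" unfolding Qe ss(2) by simp
    thus ?thesis using s by (simp add: Q_def)
  qed
  also have "\<dots> \<le> 9 * (s + 1)\<^sup>2 / (d * (s + 1))\<^sup>2"
  proof (rule divide_right_mono)
    have "s\<^sup>2 \<le> 3\<^sup>2" using s by (intro power_mono) auto
    hence "s\<^sup>2 * s\<^sup>2 \<le> 9 * s\<^sup>2" by (intro mult_right_mono) auto
    moreover have "9 * s\<^sup>2 \<le> 9 * (s + 1)\<^sup>2" using s by (simp add: power_mono)
    ultimately show "s ^ 4 - s\<^sup>2 + 1 \<le> 9 * (s + 1)\<^sup>2" using ss by (simp add: eval_nat_numeral)
  qed simp
  also have "\<dots> = 9 * d\<^sup>2 / d ^ 4" using s d by (simp add: power_mult_distrib) (simp add: eval_nat_numeral)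
  also have "\<dots> \<le> 9 * 4 / d ^ 4" using d2 d by (intro divide_right_mono) auto
  finally have 3: "1 / ln Q \<le> 36 / d ^ 4" by simp
  have "ln (24 * exp 1 * s ^ 3 / (s - 1)) * (1 / ln Q) \<le> 2 * l * (1 / ln Q)"
    using 2 Q1 by (intro mult_right_mono) auto
  also have "\<dots> \<le> 2 * l * (36 / d ^ 4)" using 3 l by (intro mult_left_mono) auto
  also have "\<dots> \<le> 162 * l / d ^ 4" using l d by (simp add: divide_right_mono)
  finally have "circle_const s \<le> 36 * (s + 1)\<^sup>2 / d ^ 4 + 162 * l / d ^ 4"
    using 1 unfolding circle_const_def Q_def[symmetric] by simp
  thus ?thesis by (simp add: a2_const_def l_def d_def add_divide_distrib)
qed

lemma growth_const_ge_1: "1 < s \<Longrightarrow> 1 \<le> growth_const s"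
  unfolding growth_const_def using one_less_power[of s 2] by (intro one_le_power) auto

text \<open>All quantities are compared with \<open>V = ((s + 1) / (s - 1))\<^sup>2 \<ge> 4\<close>: the left side is at most \<open>12 * V\<^sup>2\<close>,
  whereas \<open>a2_const s\<close> is at least \<open>2.8 * V\<^sup>2\<close>.\<close>
lemma growth_log_le:
  assumes s: "1 < s" "s \<le> 3"
  defines "T \<equiv> growth_const s"
  shows "2 + 4 * T * ln (2 + 80 * T) \<le> 5 * a2_const s" "1 \<le> a2_const s"
proof -
  define d where "d = s - 1"
  have d: "0 < d" "d \<le> 2" "s = 1 + d" using s by (auto simp: d_def)
  define V where "V = (s + 1)\<^sup>2 / d\<^sup>2"
  have V: "V \<ge> 4"
  proof -
    have "(2 * d)\<^sup>2 \<le> (s + 1)\<^sup>2" using d by (intro power_mono) auto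
    hence "4 * d\<^sup>2 \<le> (s + 1)\<^sup>2" by (simp add: power_mult_distrib)
    thus ?thesis using d by (simp add: V_def field_simps)
  qed
  have T1: "T \<ge> 1" using growth_const_ge_1 s by (simp add: T_def)
  have TV: "T \<le> V"
  proof -
    have "(s\<^sup>2 + 1) / (s\<^sup>2 - 1) \<le> (s + 1)\<^sup>2 / (s\<^sup>2 - 1)"
    proof (rule divide_right_mono)
      show "s\<^sup>2 + 1 \<le> (s + 1)\<^sup>2" using s by (simp add: power2_eq_square algebra_simps)
    qed (use one_less_power[of s 2] s in auto)
    also have "\<dots> = (s + 1) / d"
    proof -
      have "s\<^sup>2 - 1 = (s + 1) * d" by (simp add: d_def power2_eq_square algebra_simps)
      thus ?thesis using s by (simp add: power2_eq_square)
    qed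
    finally have "((s\<^sup>2 + 1) / (s\<^sup>2 - 1))\<^sup>2 \<le> ((s + 1) / d)\<^sup>2"
      using s by (intro power_mono) auto
    thus ?thesis by (simp add: T_def growth_const_def V_def power_divide)
  qed
  have s4: "(s + 1)\<^sup>2 \<le> 16" using power_mono[of "s + 1" 4 2] s by simp
  have "36 * V\<^sup>2 / 16 + 162 * V\<^sup>2 / 256 \<le> a2_const s"
  proof -
    have V2: "V\<^sup>2 = (s + 1)\<^sup>2 * (s + 1)\<^sup>2 / d ^ 4" by (simp add: V_def power_divide power2_eq_square eval_nat_numeral)
    have "36 * ((s + 1)\<^sup>2 * (s + 1)\<^sup>2) / 16 \<le> 36 * (s + 1)\<^sup>2"
      using mult_left_mono[OF s4, of "(s + 1)\<^sup>2"] by simp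
    moreover have "162 * ((s + 1)\<^sup>2 * (s + 1)\<^sup>2) / 256 \<le> 162 * ln (108 * exp 1 / (s - 1))"
      using mult_mono[OF s4 s4] log_const_ge[OF s] by simp
    ultimately have "36 * ((s + 1)\<^sup>2 * (s + 1)\<^sup>2) / 16 + 162 * ((s + 1)\<^sup>2 * (s + 1)\<^sup>2) / 256
       \<le> 36 * (s + 1)\<^sup>2 + 162 * ln (108 * exp 1 / (s - 1))" by (rule add_mono)
    hence "(36 * ((s + 1)\<^sup>2 * (s + 1)\<^sup>2) / 16 + 162 * ((s + 1)\<^sup>2 * (s + 1)\<^sup>2) / 256) / d ^ 4 \<le> a2_const s"
      unfolding a2_const_def d_def by (intro divide_right_mono) auto
    thus ?thesis unfolding V2 by (simp add: add_divide_distrib)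
  qed
  hence a2: "28 / 10 * V\<^sup>2 \<le> a2_const s" using zero_le_power2[of V] by linarith
  have VV: "4 * V \<le> V\<^sup>2" using V by (simp add: power2_eq_square)
  hence V16: "16 \<le> V\<^sup>2" using V by linarith
  show "1 \<le> a2_const s" using a2 V16 by linarith
  have "(40::real) \<le> exp 4"
  proof -
    have "(27 / 10) ^ 4 \<le> exp (1::real) ^ 4" using e_approx_32 by (intro power_mono) (auto simp: abs_if split: if_splits)
    also have "exp (1::real) ^ 4 = exp 4" by (simp add: exp_of_nat_mult[of 4 1, simplified])
    finally show ?thesis by (simp add: eval_nat_numeral)
  qed
  hence "ln (40::real) \<le> ln (exp 4)" by (subst ln_le_cancel_iff) auto
  hence ln40: "ln (40::real) \<le> 4" by simp
  \<comment> \<open>The tangent of \<open>ln\<close> at \<open>40\<close> keeps the coefficient of \<open>T\<close> small enough.\<close>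
  have "ln ((2 + 80 * T) / 40) \<le> (2 + 80 * T) / 40 - 1" using T1 by (intro ln_le_minus_one) auto
  hence lnT: "ln (2 + 80 * T) \<le> 2 * T + 31 / 10" 
  proof -
    note \<open>ln ((2 + 80 * T) / 40) \<le> (2 + 80 * T) / 40 - 1\<close>
    moreover have "ln ((2 + 80 * T) / 40) = ln (2 + 80 * T) - ln 40" using T1 by (simp add: ln_div)
    ultimately show ?thesis using ln40 by (simp add: add_divide_distrib)
  qed
  have "4 * T * ln (2 + 80 * T) \<le> 4 * V * (2 * V + 31 / 10)"
    using lnT TV T1 by (intro mult_mono) auto
  also have "\<dots> = 8 * V\<^sup>2 + 124 / 10 * V" by (simp add: power2_eq_square algebra_simps)
  finally show "2 + 4 * T * ln (2 + 80 * T) \<le> 5 * a2_const s" using a2 VV V16 by linarith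
qed

lemma a1_const_bounds:
  assumes s: "1 < s"
  shows "300 \<le> a1_const s" "3 * (4 * s\<^sup>2 / (s\<^sup>2 - 1)) \<le> a1_const s"
proof -
  have ss: "s\<^sup>2 - 1 > 0" "s\<^sup>2 - 1 = (s - 1) * (s + 1)" using one_less_power[of s 2] s by (auto simp: power2_eq_square algebra_simps)
  have "(s\<^sup>2 - 1)\<^sup>2 \<le> (s + 1) * s ^ 3"
  proof -
    have "(s + 1) * s ^ 3 - (s\<^sup>2 - 1)\<^sup>2 = s ^ 3 + s\<^sup>2 + (s\<^sup>2 - 1)" by (simp add: eval_nat_numeral algebra_simps)
    thus ?thesis using ss s by (smt (verit) zero_le_power)
  qed
  hence "300 * (s\<^sup>2 - 1)\<^sup>2 \<le> 300 * ((s + 1) * s ^ 3)" by (rule mult_left_mono) simp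
  hence "300 * (s\<^sup>2 - 1)\<^sup>2 \<le> 300 * (s + 1) * s ^ 3" by (simp only: mult.assoc)
  thus "300 \<le> a1_const s" 
  proof -
    have "300 * (s\<^sup>2 - 1)\<^sup>2 \<le> 300 * (s + 1) * s ^ 3" by fact
    moreover have "(s\<^sup>2 - 1)\<^sup>2 > 0" using ss(1) by (rule zero_less_power)
    ultimately show ?thesis unfolding a1_const_def by (simp only: pos_le_divide_eq)
  qed
  have "a1_const s = 4 * s\<^sup>2 / (s\<^sup>2 - 1) * (75 * s / (s - 1))"
    using s unfolding a1_const_def ss(2) by (simp add: eval_nat_numeral divide_simps)
  moreover have "3 \<le> 75 * s / (s - 1)" using s by (simp add: field_simps)
  hence "4 * s\<^sup>2 / (s\<^sup>2 - 1) * 3 \<le> 4 * s\<^sup>2 / (s\<^sup>2 - 1) * (75 * s / (s - 1))" using ss by (intro mult_left_mono) auto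
  ultimately show "3 * (4 * s\<^sup>2 / (s\<^sup>2 - 1)) \<le> a1_const s" by simp
qed

text \<open>The left side collects the losses of the one-variable argument: \<open>p\<close> for passing from radius \<open>r\<close> to
  radius \<open>s\<^sup>2 * r\<close>, the second summand for the bound near \<open>w0\<close>, and \<open>q\<close> for each enlargement in \<open>w\<close>.
  Writing \<open>L\<close> for the logarithm on the right, \<open>L \<ge> 5\<close> takes care of \<open>p\<close>, and \<open>L \<ge> 1 + \<Lambda>\<close> of \<open>q\<close>.\<close>
lemma exponent_le:
  assumes s: "1 < s" "s \<le> 3" and M: "0 < M1" "M1 \<le> M2" and pq: "0 \<le> p" "0 \<le> q"
  defines "\<Lambda> \<equiv> ln (4 * s\<^sup>2 * M2 / ((s\<^sup>2 - 1) * M1))" and "T \<equiv> growth_const s"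
  shows "p + (1 + 4 * T * ln (2 + 80 * T)) * p + (circle_const s * \<Lambda> + 1) * q
     \<le> a2_const s * ln (a1_const s * M2 / M1) * (p + q)"
proof -
  define L where "L = ln (a1_const s * M2 / M1)"
  have ss: "s\<^sup>2 - 1 > 0" using one_less_power[of s 2] s by auto
  have MM: "1 \<le> M2 / M1" using M by simp
  note a1 = a1_const_bounds[OF s(1)] and a2 = growth_log_le[OF s]
  have e3: "exp (1::real) \<le> 3" by (rule exp_le)
  have "exp (5::real) \<le> 300"
  proof -
    have "exp (5::real) = exp 1 ^ 5" by (simp add: exp_of_nat_mult[of 5 1, simplified])
    also have "\<dots> \<le> 3 ^ 5" using e3 by (intro power_mono) auto
    finally show ?thesis by simp
  qed
  also have "300 \<le> a1_const s * (M2 / M1)" using mult_mono[OF a1(1) MM] a1(1) by simp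
  finally have L5: "5 \<le> L" using a1 M by (simp add: L_def ln_ge_iff)
  have "exp 1 * (4 * s\<^sup>2 * M2 / ((s\<^sup>2 - 1) * M1)) \<le> 3 * (4 * s\<^sup>2 * M2 / ((s\<^sup>2 - 1) * M1))"
    using ss M s e3 by (intro mult_right_mono) auto
  also have "\<dots> = 3 * (4 * s\<^sup>2 / (s\<^sup>2 - 1)) * (M2 / M1)" by simp
  also have "\<dots> \<le> a1_const s * (M2 / M1)" using a1(2) MM by (intro mult_right_mono) auto
  finally have le: "exp 1 * (4 * s\<^sup>2 * M2 / ((s\<^sup>2 - 1) * M1)) \<le> a1_const s * (M2 / M1)" .
  have "ln (exp 1 * (4 * s\<^sup>2 * M2 / ((s\<^sup>2 - 1) * M1))) \<le> L"
  proof -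
    have "exp 1 * (4 * s\<^sup>2 * M2 / ((s\<^sup>2 - 1) * M1)) > 0"
      using ss M s by (intro divide_pos_pos mult_pos_pos) auto
    thus ?thesis unfolding L_def using le by (intro ln_mono) (auto simp: mult.assoc)
  qed
  also have "ln (exp 1 * (4 * s\<^sup>2 * M2 / ((s\<^sup>2 - 1) * M1))) = 1 + \<Lambda>"
    
  proof -
    have "4 * s\<^sup>2 * M2 / ((s\<^sup>2 - 1) * M1) > 0"
      using ss M s by (intro divide_pos_pos mult_pos_pos) auto
    thus ?thesis unfolding \<Lambda>_def by (subst ln_mult) auto
  qed
  finally have L\<Lambda>: "1 + \<Lambda> \<le> L" .
  have \<Lambda>0: "0 \<le> \<Lambda>"
  proof -
    have "(s\<^sup>2 - 1) * M1 \<le> 4 * s\<^sup>2 * M2" using M ss by (intro mult_mono) auto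
    moreover have "(s\<^sup>2 - 1) * M1 > 0" using ss M by simp
    ultimately have "1 \<le> 4 * s\<^sup>2 * M2 / ((s\<^sup>2 - 1) * M1)" by (simp only: le_divide_eq_1_pos)
    thus ?thesis unfolding \<Lambda>_def by (rule ln_ge_zero)
  qed
  have "circle_const s * \<Lambda> + 1 \<le> a2_const s * \<Lambda> + a2_const s"
    using circle_const_le[OF s] \<Lambda>0 a2 by (intro add_mono mult_right_mono) auto
  also have "\<dots> = a2_const s * (1 + \<Lambda>)" by (simp add: algebra_simps)
  also have "\<dots> \<le> a2_const s * L" using L\<Lambda> a2 by (intro mult_left_mono) auto
  finally have q: "(circle_const s * \<Lambda> + 1) * q \<le> a2_const s * L * q" using pq by (intro mult_right_mono)
  have "2 + 4 * T * ln (2 + 80 * T) \<le> a2_const s * 5" using a2 by (simp add: T_def)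
  also have "\<dots> \<le> a2_const s * L" using L5 a2 by (intro mult_left_mono) auto
  finally have "(2 + 4 * T * ln (2 + 80 * T)) * p \<le> a2_const s * L * p" using pq by (intro mult_right_mono)
  thus ?thesis using q unfolding L_def[symmetric] by (simp add: algebra_simps)
qed

section \<open>Substituting a function for one variable\<close>

text \<open>\<open>large_modulus_circle\<close> provides a circle on which \<open>f - w0\<close> exceeds \<open>\<bar>w - w0\<bar>\<close>, and Rouche's theorem
  compares \<open>f - w\<close> with \<open>f - w0\<close> inside it. The point where \<open>f - w0\<close> is bounded below is \<open>z1\<close> or \<open>0\<close>: as
  \<open>f\<close> takes quite different values at these two points, \<open>w0\<close> cannot be close to both.\<close>
lemma valency_persists:
  fixes f :: "complex \<Rightarrow> complex"
  assumes s: "1 < s" and r: "0 < r" and f: "f holomorphic_on ball 0 (s\<^sup>2 * r)"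
    and M2: "\<And>z. z \<in> ball 0 (s\<^sup>2 * r) \<Longrightarrow> cmod (f z) \<le> M2" and M1: "0 < M1"
    and z1: "cmod z1 \<le> r / s\<^sup>2" "M1 * (s\<^sup>2 - 1) / s\<^sup>2 \<le> cmod (f z1 - f 0)"
    and a: "a \<in> ball 0 (s\<^sup>2 * r)" "f a = w0"
  defines "\<Lambda> \<equiv> ln (4 * s\<^sup>2 * M2 / ((s\<^sup>2 - 1) * M1))"
  obtains \<rho> where "r / s \<le> \<rho>" "\<rho> \<le> mid_radius s * r"
    "\<And>w. w \<in> ball w0 (2 * M2 * exp (- (circle_const s * \<Lambda>))) \<Longrightarrow>
       (\<Sum>z | z \<in> ball 0 (r / s) \<and> f z - w0 = 0. zorder (\<lambda>z. f z - w0) z)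
         \<le> (\<Sum>z | z \<in> ball 0 \<rho> \<and> f z - w = 0. zorder (\<lambda>z. f z - w) z)"
proof -
  define R where "R = s\<^sup>2 * r"
  define F where "F = (\<lambda>z. f z - w0)"
  note mid = mid_radius_bounds[OF s]
  have s2: "1 < s\<^sup>2" using one_less_power[of s 2] s by simp
  have holF: "F holomorphic_on ball 0 R" using f by (auto simp: F_def R_def intro!: holomorphic_intros)
  have FC: "cmod (F z) \<le> 2 * M2" if "cmod z < R" for z
    using M2[of z] M2[OF a(1)] that a(2) norm_triangle_ineq4[of "f z" w0] by (auto simp: F_def R_def)
  define A0 where "A0 = M1 * (s\<^sup>2 - 1) / (2 * s\<^sup>2)"
  have A0: "0 < A0" using M1 s2 s by (simp add: A0_def)
  have "cmod (F z1 - F 0) \<le> cmod (F z1) + cmod (F 0)" by (rule norm_triangle_ineq4)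
  moreover have "2 * A0 \<le> cmod (F z1 - F 0)" using z1(2) by (simp add: F_def A0_def)
  ultimately have "A0 \<le> cmod (F z1) \<or> A0 \<le> cmod (F 0)" by linarith
  then obtain zz where zz: "cmod zz \<le> r / s\<^sup>2" "A0 \<le> cmod (F zz)"
    using z1(1) r by (metis norm_zero divide_nonneg_nonneg less_imp_le zero_le_power2)
  have rR: "r < R" using s2 r by (simp add: R_def)
  have rs: "r / s\<^sup>2 < r" using s s2 r divide_strict_left_mono[of 1 "s\<^sup>2" r] by simp
  have yr: "mid_radius s * r < r" "r / s < mid_radius s * r"
    using mid r s mult_strict_right_mono[OF mid(1) r] by auto
  define \<beta> where "\<beta> = R * (r / s\<^sup>2 + r) / (R\<^sup>2 + r / s\<^sup>2 * r)"
  define K where "K = (r + mid_radius s * r) * (r + r / s\<^sup>2) / ((r - mid_radius s * r) * (r - r / s\<^sup>2))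
     + ln (4 * exp 1 * R / (mid_radius s * r - r / s)) / ln (1 / \<beta>)"
  obtain \<rho> where \<rho>: "r / s \<le> \<rho>" "\<rho> \<le> mid_radius s * r"
    "\<And>z. cmod z = \<rho> \<Longrightarrow> 2 * M2 * exp (- (K * ln (2 * M2 / A0))) \<le> cmod (F z)"
    by (rule large_modulus_circle[OF holF FC _ rs rR zz A0 _ yr(2,1)])
       (use r s in \<open>auto simp: K_def \<beta>_def\<close>)
  have \<Lambda>: "ln (2 * M2 / A0) = \<Lambda>"
    using s M1 s2 by (simp add: \<Lambda>_def A0_def mult_ac)
  have K: "K = circle_const s"
  proof -
    have "1 / \<beta> = (s ^ 4 - s\<^sup>2 + 1) / s\<^sup>2"
    proof -
      have e: "R * (r / s\<^sup>2 + r) = r\<^sup>2 * (s\<^sup>2 + 1)" "R\<^sup>2 + r / s\<^sup>2 * r = r\<^sup>2 * (s\<^sup>2 + 1) * (s ^ 4 - s\<^sup>2 + 1) / s\<^sup>2"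
        using s by (simp_all add: R_def field_simps eval_nat_numeral)
      have "s\<^sup>2 + 1 > 0" using s2 by simp
      thus ?thesis unfolding \<beta>_def e using r s by simp
    qed
    moreover have "4 * exp 1 * R / (mid_radius s * r - r / s) = 24 * exp 1 * s ^ 3 / (s - 1)"
    proof -
      have e: "mid_radius s * r - r / s = (mid_radius s - 1 / s) * r" by (simp add: algebra_simps)
      show ?thesis unfolding e mid(3) R_def using s r by (simp add: field_simps eval_nat_numeral)
    qed
    moreover have "(r + mid_radius s * r) * (r + r / s\<^sup>2) / ((r - mid_radius s * r) * (r - r / s\<^sup>2))
        = (1 + mid_radius s) * (s\<^sup>2 + 1) / ((1 - mid_radius s) * (s\<^sup>2 - 1))"
    proof -
      have e: "r + mid_radius s * r = (1 + mid_radius s) * r" "r - mid_radius s * r = (1 - mid_radius s) * r"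
        "r + r / s\<^sup>2 = (s\<^sup>2 + 1) * (r / s\<^sup>2)" "r - r / s\<^sup>2 = (s\<^sup>2 - 1) * (r / s\<^sup>2)"
        using s by (simp_all add: field_simps)
      show ?thesis unfolding e using r s by simp
    qed
    ultimately show ?thesis by (simp add: K_def circle_const_def)
  qed
  have \<rho>0: "0 < \<rho>" "\<rho> < R"
  proof -
    have "0 < r / s" using r s by simp
    thus "0 < \<rho>" using \<rho>(1) by linarith
    show "\<rho> < R" using \<rho>(2) yr rR by linarith
  qed
  show ?thesis
  proof (rule that[OF \<rho>(1,2)])
    fix w assume w: "w \<in> ball w0 (2 * M2 * exp (- (circle_const s * \<Lambda>)))"
    have "F (of_real \<rho>) \<noteq> 0 \<and> of_real \<rho> \<in> ball (0::complex) R"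
    proof -
      have "cmod (w0 - w) < cmod (F (of_real \<rho>))"
        using w \<rho>(3)[of "of_real \<rho>"] \<rho>0 by (simp add: K \<Lambda> dist_norm)
      thus ?thesis using \<rho>0 by auto
    qed
    hence nz: "F (of_real \<rho>) \<noteq> 0" "of_real \<rho> \<in> ball (0::complex) R" by auto
    have eq: "F z + (w0 - w) = f z - w" for z by (simp add: F_def)
    have "(\<Sum>z | z \<in> ball 0 (r / s) \<and> F z = 0. zorder F z) \<le> (\<Sum>z | z \<in> ball 0 \<rho> \<and> F z = 0. zorder F z)"
    proof (rule sum_mono2)
      show "finite {z. z \<in> ball 0 \<rho> \<and> F z = 0}"
        by (rule finite_subset[OF _ finite_zeros_cball[OF holF \<rho>0(2) nz(2,1)]]) auto
      show "{z. z \<in> ball 0 (r / s) \<and> F z = 0} \<subseteq> {z. z \<in> ball 0 \<rho> \<and> F z = 0}" using \<rho>(1) by auto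
      fix z assume "z \<in> {z. z \<in> ball 0 \<rho> \<and> F z = 0} - {z. z \<in> ball 0 (r / s) \<and> F z = 0}"
      hence "z \<in> ball 0 R" using \<rho>0 by auto
      thus "0 \<le> zorder F z" by (rule zorder_nonneg_on[OF holF nz(2,1)])
    qed
    also have "\<dots> = (\<Sum>z | z \<in> ball 0 \<rho> \<and> F z + (w0 - w) = 0. zorder (\<lambda>z. F z + (w0 - w)) z)"
    proof (rule rouche_circle_shift[OF holF \<rho>0, symmetric])
      fix z :: complex assume "cmod z = \<rho>"
      from \<rho>(3)[OF this] w show "cmod (w0 - w) < cmod (F z)" by (simp add: K \<Lambda> dist_norm)
    qed
    finally show "(\<Sum>z | z \<in> ball 0 (r / s) \<and> f z - w0 = 0. zorder (\<lambda>z. f z - w0) z)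
         \<le> (\<Sum>z | z \<in> ball 0 \<rho> \<and> f z - w = 0. zorder (\<lambda>z. f z - w) z)"
      unfolding eq unfolding F_def .
  qed
qed

text \<open>\<open>h\<close> is bounded near \<open>(a, f a)\<close> by continuity, and Schwarz's lemma in the second variable turns this
  bound into a Lipschitz constant that is uniform in \<open>z\<close>.\<close>
lemma substitution_locally_lipschitz:
  fixes f :: "complex \<Rightarrow> complex" and h :: "complex \<Rightarrow> complex \<Rightarrow> complex"
  assumes cont: "continuous_on (U \<times> W) (\<lambda>(z, v). h z v)" and UW: "open U" "open W"
    and hol: "\<And>z. z \<in> U \<Longrightarrow> h z holomorphic_on W"
    and f: "isCont f a" and a: "a \<in> U" "f a \<in> W"
  shows "\<exists>L. \<forall>\<^sub>F z in at a. cmod (h z (f z) - h z (f a)) \<le> L * cmod (f z - f a)"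
proof -
  obtain d1 where d1: "d1 > 0" "cball a d1 \<subseteq> U" using UW(1) a(1) open_contains_cball by blast
  obtain d2 where d2: "d2 > 0" "cball (f a) d2 \<subseteq> W" using UW(2) a(2) open_contains_cball by blast
  have "compact (cball a d1 \<times> cball (f a) d2)" by (intro compact_Times compact_cball)
  moreover have "continuous_on (cball a d1 \<times> cball (f a) d2) (\<lambda>(z, v). h z v)"
    by (rule continuous_on_subset[OF cont]) (use d1 d2 in auto)
  ultimately have "bounded ((\<lambda>(z, v). h z v) ` (cball a d1 \<times> cball (f a) d2))"
    by (intro compact_imp_bounded compact_continuous_image)
  then obtain B where B: "\<And>z v. z \<in> cball a d1 \<Longrightarrow> v \<in> cball (f a) d2 \<Longrightarrow> cmod (h z v) \<le> B"
    unfolding bounded_iff by fastforce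
  have "\<forall>\<^sub>F z in at a. z \<in> ball a d1" using d1 by (intro eventually_at_in_open') auto
  moreover have "\<forall>\<^sub>F z in at a. f z \<in> ball (f a) d2"
    using f d2(1) unfolding isCont_def by (intro topological_tendstoD[of f "f a"]) auto
  ultimately have "\<forall>\<^sub>F z in at a. cmod (h z (f z) - h z (f a)) \<le> 2 * B / d2 * cmod (f z - f a)"
  proof eventually_elim
    case (elim z)
    have zU: "z \<in> U" using elim d1 by auto
    show ?case
    proof (rule schwarz_at_center[of "\<lambda>v. h z v - h z (f a)"])
      show "(\<lambda>v. h z v - h z (f a)) holomorphic_on ball (f a) d2"
        using d2 by (intro holomorphic_intros holomorphic_on_subset[OF hol[OF zU]]) auto
      fix v assume "v \<in> ball (f a) d2"
      hence "cmod (h z v) \<le> B" "cmod (h z (f a)) \<le> B" using elim d2 by (auto intro!: B)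
      thus "cmod (h z v - h z (f a)) \<le> 2 * B" using norm_triangle_ineq4[of "h z v" "h z (f a)"] by linarith
    qed (use elim in auto)
  qed
  thus ?thesis by blast
qed

text \<open>Near a zero of \<open>f - w\<close> the Lipschitz estimate bounds \<open>h z (f z) - h z w\<close> by a multiple of \<open>f z - w\<close>,
  so it vanishes there with at least the multiplicity of \<open>f - w\<close>.\<close>
lemma substitution_difference_factor:
  fixes f :: "complex \<Rightarrow> complex"
  assumes f: "f holomorphic_on ball 0 R" "\<And>z. z \<in> ball 0 R \<Longrightarrow> f z \<in> W" and W: "open W"
    and nc: "z2 \<in> ball 0 R" "f z2 \<noteq> w"
    and cont: "continuous_on (ball 0 R \<times> W) (\<lambda>(z, v). h z v)"
    and holW: "\<And>z. z \<in> ball 0 R \<Longrightarrow> h z holomorphic_on W"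
    and hol: "(\<lambda>z. h z w) holomorphic_on ball 0 R" "(\<lambda>z. h z (f z)) holomorphic_on ball 0 R"
    and \<rho>: "\<rho> < R" 
  obtains A v where "int (size A) = (\<Sum>z | z \<in> ball 0 \<rho> \<and> f z - w = 0. zorder (\<lambda>z. f z - w) z)"
    "set_mset A \<subseteq> ball 0 \<rho>" "v holomorphic_on ball 0 R"
    "\<And>z. z \<in> ball 0 R \<Longrightarrow> h z (f z) - h z w = zprod A z * v z"
proof -
  define F where "F = (\<lambda>z. f z - w)"
  define Z where "Z = {z. z \<in> ball 0 \<rho> \<and> f z - w = 0}"
  have F: "F holomorphic_on ball 0 R" "F z2 \<noteq> 0" using f nc by (auto simp: F_def intro!: holomorphic_intros)
  have finZ: "finite Z"
    by (rule finite_subset[OF _ finite_zeros_cball[OF F(1) \<rho> nc(1) F(2)]]) (auto simp: Z_def F_def)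
  have ZR: "Z \<subseteq> ball 0 R" using \<rho> by (auto simp: Z_def)
  define A where "A = zeros_mset F Z"
  obtain u where u: "u holomorphic_on ball 0 R" "\<And>z. z \<in> ball 0 R \<Longrightarrow> F z = zprod A z * u z"
    unfolding A_def
    by (rule factor_out_zeros[OF F(1) open_ball connected_ball _ finZ ZR]) (use nc F in blast)+
  have A: "set_mset A \<subseteq> Z" unfolding A_def by (rule set_zeros_mset[OF finZ])
  have cont_at: "isCont g b" if "g holomorphic_on ball 0 R" "b \<in> ball 0 R" for g :: "complex \<Rightarrow> complex" and b
    using holomorphic_on_imp_continuous_on[OF that(1)] that(2) by (simp add: continuous_on_eq_continuous_at)
  have "\<exists>v. v holomorphic_on ball 0 R \<and> (\<forall>z\<in>ball 0 R. h z (f z) - h z w = zprod A z * v z)"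
  proof (rule holomorphic_divide_zprod)
    show "(\<lambda>z. h z (f z) - h z w) holomorphic_on ball 0 R" using hol by (intro holomorphic_intros)
    show "set_mset A \<subseteq> ball 0 R" using A ZR by blast
    fix b assume "b \<in># A"
    hence b: "b \<in> ball 0 R" "f b = w" using A ZR by (auto simp: Z_def)
    from substitution_locally_lipschitz[OF cont open_ball W holW cont_at[OF f(1) b(1)] b(1) f(2)[OF b(1)]]
    obtain L where L: "\<forall>\<^sub>F z in at b. cmod (h z (f z) - h z w) \<le> L * cmod (f z - w)"
      using b by auto
    have "((\<lambda>z. cmod (u z)) \<longlongrightarrow> cmod (u b)) (at b)"
      using cont_at[OF u(1) b(1)] by (intro tendsto_norm) (simp add: isCont_def)
    hence "\<forall>\<^sub>F z in at b. cmod (u z) < cmod (u b) + 1" by (rule order_tendstoD) simp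
    moreover have "\<forall>\<^sub>F z in at b. z \<in> ball 0 R" using b by (intro eventually_at_in_open') auto
    ultimately have "\<forall>\<^sub>F z in at b. cmod (h z (f z) - h z w) \<le> (\<bar>L\<bar> * (cmod (u b) + 1)) * cmod (zprod A z)"
      using L
    proof eventually_elim
      case (elim z)
      have "cmod (h z (f z) - h z w) \<le> L * (cmod (u z) * cmod (zprod A z))"
        using elim u(2)[of z] by (simp add: F_def norm_mult mult.commute)
      also have "\<dots> \<le> \<bar>L\<bar> * ((cmod (u b) + 1) * cmod (zprod A z))"
        using elim by (intro mult_mono mult_right_mono) auto
      finally show ?case by (simp add: mult.assoc)
    qed
    thus "\<exists>L. \<forall>\<^sub>F z in at b. cmod (h z (f z) - h z w) \<le> L * cmod (zprod A z)" by blast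
  qed auto
  then obtain v where v: "v holomorphic_on ball 0 R" "\<And>z. z \<in> ball 0 R \<Longrightarrow> h z (f z) - h z w = zprod A z * v z"
    by blast
  have "int (size A) = (\<Sum>z\<in>Z. int (nat (zorder F z)))" by (simp add: A_def size_zeros_mset)
  also have "\<dots> = (\<Sum>z\<in>Z. zorder F z)"
    using ZR by (intro sum.cong refl) (use zorder_nonneg_on[OF F(1) nc(1) F(2)] in auto)
  finally have "int (size A) = (\<Sum>z | z \<in> ball 0 \<rho> \<and> f z - w = 0. zorder (\<lambda>z. f z - w) z)"
    by (simp add: Z_def F_def[abs_def])
  thus ?thesis by (rule that[OF _ _ v]) (use A in \<open>auto simp: Z_def\<close>)
qed

text \<open>If \<open>p\<close> is small, a value \<open>H z0\<close> close to the supremum \<open>m\<close> is also close to the bound \<open>e^p * m\<close> on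
  the larger disc. Then \<open>1 - \<omega> * H / (e^p * m)\<close>, with \<open>\<omega>\<close> the rotation that makes \<open>\<omega> * H z0\<close>
  positive, has nonnegative real part and is small at \<open>z0\<close>, so by Harnack's inequality it is small at
  \<open>a\<close> as well.\<close>
lemma sup_le_value_of_slow_growth:
  fixes H :: "complex \<Rightarrow> complex"
  assumes t: "1 < t" and r: "0 < r" and H: "H holomorphic_on ball 0 (t * r)"
    and m: "\<And>C. (\<And>z. cmod z < r \<Longrightarrow> cmod (H z) \<le> C) \<Longrightarrow> m \<le> C" "0 \<le> m"
    and g: "\<And>z. cmod z < t * r \<Longrightarrow> cmod (H z) \<le> exp p * m"
    and a: "cmod a < r" "cmod (H a) \<le> \<delta>"
    and T: "T = ((t + 1) / (t - 1))\<^sup>2" and p: "0 \<le> p" "p \<le> 1 / (4 * T)"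
  shows "m \<le> exp (4 * T * p) * \<delta>"
proof (cases "m = 0")
  case True
  have "0 \<le> \<delta>" using a(2) norm_ge_zero order_trans by blast
  thus ?thesis using True by simp
next
  case False
  hence m0: "m > 0" using m by simp
  define M where "M = exp p * m"
  have M: "M > 0" using m0 by (simp add: M_def)
  have T1: "T \<ge> 1" unfolding T using t by (simp add: field_simps)
  have rt: "r < t * r" using t r by simp
  have bnd: "cmod (H z0) \<le> ((T - 1) * M + \<delta>) / T" if z0: "cmod z0 < r" for z0
  proof -
    define \<omega> where "\<omega> = cnj (sgn (H z0))"
    have \<omega>: "cmod \<omega> \<le> 1" by (simp add: \<omega>_def norm_sgn)
    have "sgn (H z0) * cnj (H z0) = cmod (H z0)"
      by (simp add: sgn_eq complex_norm_square[symmetric] power2_eq_square)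
    hence "cnj (sgn (H z0) * cnj (H z0)) = cmod (H z0)" by simp
    hence \<omega>z0: "\<omega> * H z0 = cmod (H z0)" by (simp add: \<omega>_def)
    define k where "k = (\<lambda>z. 1 - \<omega> * H z / of_real M)"
    have small: "cmod (\<omega> * H z / of_real M) \<le> cmod (H z) / M" for z
      using \<omega> M by (simp add: norm_mult norm_divide divide_right_mono mult_left_le_one_le)
    have Re_k: "Re (k z) \<ge> 1 - cmod (H z) / M" for z
      using complex_Re_le_cmod[of "\<omega> * H z / of_real M"] small[of z] by (simp add: k_def)
    have "Re (k a) \<le> (t * r + r) * (t * r + r) / ((t * r - r) * (t * r - r)) * Re (k z0)"
    proof (rule harnack_Re[where g = k])
      show "k holomorphic_on ball 0 (t * r)" unfolding k_def using H M by (intro holomorphic_intros) auto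
      fix z assume "cmod z < t * r"
      hence "cmod (H z) / M \<le> 1" using g[of z] M by (simp add: M_def)
      thus "0 \<le> Re (k z)" using Re_k[of z] by linarith
    qed (use a z0 rt in auto)
    also have "(t * r + r) * (t * r + r) / ((t * r - r) * (t * r - r)) = T"
    proof -
      have "t * r + r = (t + 1) * r" "t * r - r = (t - 1) * r" by (simp_all add: algebra_simps)
      thus ?thesis using r by (simp add: T power2_eq_square)
    qed
    also have "Re (k z0) = 1 - cmod (H z0) / M" by (simp add: k_def \<omega>z0)
    finally have "1 - \<delta> / M \<le> T * (1 - cmod (H z0) / M)"
      using Re_k[of a] a(2) M by (smt (verit) divide_right_mono)
    hence "(1 - \<delta> / M) * M \<le> T * (1 - cmod (H z0) / M) * M" using M by (intro mult_right_mono) auto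
    hence "M - \<delta> \<le> T * (M - cmod (H z0))" using M by (simp add: algebra_simps)
    thus ?thesis using T1 by (simp add: field_simps)
  qed
  have "m \<le> ((T - 1) * M + \<delta>) / T" by (rule m(1)[OF bnd])
  hence "T * m \<le> (T - 1) * (exp p * m) + \<delta>" using T1 by (simp add: M_def field_simps)
  moreover have "exp p \<le> 1 + 2 * p"
  proof -
    have "1 / (4 * T) \<le> 1" using T1 by (simp add: field_simps)
    hence "p \<le> 1" using p by linarith
    moreover from this have "p\<^sup>2 \<le> p * 1" unfolding power2_eq_square using p by (intro mult_left_mono) auto
    ultimately show ?thesis using exp_bound[of p] p by simp
  qed
  hence "(T - 1) * (exp p * m) \<le> (T - 1) * ((1 + 2 * p) * m)"
    using T1 m0 by (intro mult_left_mono mult_right_mono) auto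
  ultimately have "m * (1 - 2 * (T - 1) * p) \<le> \<delta>" by (simp add: algebra_simps)
  moreover have "m * (1 - 2 * T * p) \<le> m * (1 - 2 * (T - 1) * p)" using m0 p by (intro mult_left_mono) (auto simp: algebra_simps)
  ultimately have 1: "m * (1 - 2 * T * p) \<le> \<delta>" by linarith
  define y where "y = 2 * T * p"
  have y: "0 \<le> y" "y \<le> 1 / 2" using p T1 by (auto simp: y_def field_simps)
  have "1 + 2 * y \<le> exp (2 * y)" by (rule exp_ge_add_one_self)
  hence "(1 + 2 * y) * (1 - y) \<le> exp (2 * y) * (1 - y)" using y by (intro mult_right_mono) auto
  moreover have "1 \<le> (1 + 2 * y) * (1 - y)"
  proof -
    have "0 \<le> y * (1 - 2 * y)" using y by simp
    thus ?thesis by (simp add: algebra_simps)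
  qed
  ultimately have "m * 1 \<le> m * (exp (2 * y) * (1 - y))" using m0 by (intro mult_left_mono) auto
  also have "\<dots> = exp (2 * y) * (m * (1 - y))" by simp
  also have "\<dots> \<le> exp (2 * y) * \<delta>" using 1 by (intro mult_left_mono) (auto simp: y_def)
  finally show ?thesis by (simp add: y_def mult.assoc)
qed

text \<open>With \<open>B\<close> the Schwarz factor of all zeros together, \<open>\<bar>H\<bar> \<le> \<delta> + (m + \<delta>) * B\<close> for \<open>\<bar>z\<bar> < r / s\<close>.
  The three circles inequality for the radii \<open>r\<close>, \<open>r * s\<close>, \<open>r * s\<^sup>2\<close> bounds \<open>\<bar>H\<bar>\<close> by
  \<open>e^(p / 2) * m\<close> for \<open>\<bar>z\<bar> < r * s\<close>; for the radii \<open>r / s\<close>, \<open>r\<close>, \<open>r * s\<close> it then gives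
  \<open>m \<le> e^(p / 2) * (\<delta> + (m + \<delta>) * B)\<close>. As \<open>B\<close> is at most \<open>e^(- 3 * p / 5)\<close>, the term in \<open>m\<close> on the right
  is absorbed on the left.\<close>
lemma sup_le_by_many_zeros:
  fixes H G :: "complex \<Rightarrow> complex"
  assumes s: "1 < s" and r: "0 < r" and H: "H holomorphic_on ball 0 (r * s * s)"
    and m: "\<And>C. (\<And>z. cmod z < r \<Longrightarrow> cmod (H z) \<le> C) \<Longrightarrow> m \<le> C"
      "\<And>z. cmod z < r \<Longrightarrow> cmod (H z) \<le> m"
    and g: "\<And>z. cmod z < r * s * s \<Longrightarrow> cmod (H z) \<le> exp p * m"
    and G: "\<And>z. cmod z < r \<Longrightarrow> cmod (G z) \<le> \<delta>"
    and fac: "v holomorphic_on ball 0 r" "\<And>z. cmod z < r \<Longrightarrow> G z - H z = zprod A z * v z"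
    and A: "\<And>a. a \<in># A \<Longrightarrow> cmod a \<le> y * r" "0 \<le> y" "y < 1"
    and B: "((1 + s * y) / (s + y)) ^ size A \<le> exp (- (3 / 5 * p))"
    and p: "0 < p"
  shows "m \<le> exp (p / 2) * (2 * (1 + 10 / p)) * \<delta>"
proof -
  have m0: "m \<ge> 0" using order_trans[OF norm_ge_zero m(2)[of 0]] r by simp
  have \<delta>0: "\<delta> \<ge> 0" using order_trans[OF norm_ge_zero G[of 0]] r by simp
  define E where "E = exp (- (3 / 5 * p))"
  have E: "0 < E" "E \<le> 1" using p by (auto simp: E_def)
  have diff: "cmod (G z - H z) \<le> m + \<delta>" if "cmod z < r" for z
    using norm_triangle_ineq4[of "G z" "H z"] G[OF that] m(2)[OF that] by linarith
  have inner: "cmod (H z) \<le> \<delta> + (m + \<delta>) * E" if z: "cmod z < r / s" for z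
  proof -
    have rs: "r / s < r" using r s by (simp add: field_simps)
    have zr: "cmod z < r" using z rs by linarith
    have yr: "y * r < r" using A r by simp
    have B': "r * (r / s + y * r) / (r\<^sup>2 + r / s * (y * r)) = (1 + s * y) / (s + y)"
    proof -
      have "r * (r / s + y * r) = r\<^sup>2 / s * (1 + s * y)" "r\<^sup>2 + r / s * (y * r) = r\<^sup>2 / s * (s + y)"
        using s by (simp_all add: field_simps power2_eq_square)
      thus ?thesis using r s by simp
    qed
    have "cmod (zprod A z) \<le> (r * (r / s + y * r) / (r\<^sup>2 + r / s * (y * r))) ^ size A * cmod (bprod r A z)"
      by (rule zprod_le_bprod) (use z rs A r yr in auto)
    also have "\<dots> \<le> E * cmod (bprod r A z)" unfolding B' using B by (intro mult_right_mono) (auto simp: E_def)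
    finally have 1: "cmod (zprod A z) \<le> E * cmod (bprod r A z)" .
    have 2: "cmod (bprod r A z * v z) \<le> m + \<delta>"
    proof (rule divide_blaschke_product[OF fac(1) _ _ zr])
      fix a assume "a \<in># A" thus "cmod a < r" using A(1)[of a] yr by linarith
    qed (use diff fac(2) in auto)
    have "cmod (G z - H z) = cmod (zprod A z) * cmod (v z)" using fac(2)[OF zr] by (simp add: norm_mult)
    also have "\<dots> \<le> (E * cmod (bprod r A z)) * cmod (v z)" using 1 by (intro mult_right_mono) auto
    also have "\<dots> = E * cmod (bprod r A z * v z)" by (simp add: norm_mult)
    also have "\<dots> \<le> E * (m + \<delta>)" using 2 E by (intro mult_left_mono) auto
    finally have "cmod (G z - H z) \<le> E * (m + \<delta>)" .
    thus ?thesis using G[OF zr] norm_triangle_ineq2[of "H z" "G z"]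
      by (simp add: norm_minus_commute algebra_simps)
  qed
  have outer: "cmod (H z) \<le> exp (p / 2) * m" if z: "cmod z < r * s" for z
  proof -
    have "(cmod (H z))\<^sup>2 \<le> m * (exp p * m)"
      by (rule three_circles_geometric_mean[of H "r * s" s]) (use H s m(2) g z in auto)
    also have "\<dots> = (exp (p / 2) * m)\<^sup>2" by (simp add: power_mult_distrib power2_eq_square exp_add[symmetric])
    finally show ?thesis by (rule power2_le_imp_le) (use m0 in auto)
  qed
  define A' where "A' = \<delta> + (m + \<delta>) * E"
  have A'0: "A' \<ge> 0" using m0 \<delta>0 E by (simp add: A'_def)
  have "cmod (H z) \<le> sqrt (A' * (exp (p / 2) * m))" if z: "cmod z < r" for z
  proof -
    have "(cmod (H z))\<^sup>2 \<le> A' * (exp (p / 2) * m)"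
    proof (rule three_circles_geometric_mean[of H r s])
      show "H holomorphic_on ball 0 (r * s)"
      proof (rule holomorphic_on_subset[OF H])
        have "r * s * 1 \<le> r * s * s" using r s by (intro mult_left_mono) auto
        thus "ball 0 (r * s) \<subseteq> ball (0::complex) (r * s * s)" by auto
      qed
    qed (use s inner outer z in \<open>auto simp: A'_def\<close>)
    thus ?thesis by (rule real_le_rsqrt)
  qed
  hence "m \<le> sqrt (A' * (exp (p / 2) * m))" by (rule m(1))
  hence "m\<^sup>2 \<le> (sqrt (A' * (exp (p / 2) * m)))\<^sup>2" using m0 by (intro power_mono)
  hence "m * m \<le> A' * exp (p / 2) * m" using A'0 m0 by (simp add: power2_eq_square)
  hence m_le: "m \<le> A' * exp (p / 2)"
    using m0 A'0 by (cases "m = 0") (auto simp: mult_le_cancel_right)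
  also have "\<dots> \<le> (2 * \<delta> + m * E) * exp (p / 2)"
  proof (rule mult_right_mono)
    have "E * \<delta> \<le> 1 * \<delta>" using E \<delta>0 by (intro mult_right_mono) auto
    thus "A' \<le> 2 * \<delta> + m * E" by (simp add: A'_def algebra_simps)
  qed simp
  also have "E * exp (p / 2) = exp (- (p / 10))" by (simp add: E_def exp_add[symmetric])
  hence "(2 * \<delta> + m * E) * exp (p / 2) = 2 * \<delta> * exp (p / 2) + m * exp (- (p / 10))"
    by (simp add: algebra_simps)
  finally have 3: "m * (1 - exp (- (p / 10))) \<le> 2 * \<delta> * exp (p / 2)" by (simp add: algebra_simps)
  have "1 + p / 10 \<le> exp (p / 10)" by (rule exp_ge_add_one_self)
  hence "exp (- (p / 10)) \<le> 1 / (1 + p / 10)" using p by (simp add: exp_minus field_simps)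
  hence "1 - 1 / (1 + p / 10) \<le> 1 - exp (- (p / 10))" by simp
  hence "m * (1 - 1 / (1 + p / 10)) \<le> 2 * \<delta> * exp (p / 2)" using 3 m0 by (meson mult_left_mono order_trans)
  moreover have "1 - 1 / (1 + p / 10) = 1 / (1 + 10 / p)" using p by (simp add: field_simps)
  ultimately have "m / (1 + 10 / p) \<le> 2 * \<delta> * exp (p / 2)" by simp
  moreover have "1 + 10 / p > 0" using p by (simp add: add_pos_pos)
  ultimately have "m \<le> 2 * \<delta> * exp (p / 2) * (1 + 10 / p)" by (simp only: pos_divide_le_eq)
  thus ?thesis by (simp only: mult_ac)
qed

text \<open>The radius grows by the factor \<open>e\<close> in each of \<open>n\<close> steps. All the intermediate discs lie in the last
  one, which is relatively compact in the domain, so the Bernstein bound applies at each step.\<close>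
lemma bernstein_chain:
  assumes bern: "\<And>v \<sigma> C. 0 < \<sigma> \<Longrightarrow> cball v (exp 1 * \<sigma>) \<subseteq> ball 0 D \<Longrightarrow> (\<And>w. w \<in> ball v \<sigma> \<Longrightarrow> cmod (k w) \<le> C)
      \<Longrightarrow> (\<And>w. w \<in> ball v (exp 1 * \<sigma>) \<Longrightarrow> cmod (k w) \<le> exp q * C)"
    and \<rho>: "0 < \<rho>" "cmod v + \<rho> < D"
    and C: "\<And>w. w \<in> ball v (\<rho> / exp 1 ^ n) \<Longrightarrow> cmod (k w) \<le> C"
    and w: "w \<in> ball v \<rho>"
  shows "cmod (k w) \<le> exp (real n * q) * C"
  using C
proof (induction n arbitrary: C)
  case 0
  thus ?case using w by simp
next
  case (Suc n)
  have e: "(1::real) \<le> exp 1" by simp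
  have "cmod (k w) \<le> exp (real n * q) * (exp q * C)"
  proof (rule Suc.IH)
    fix x assume x: "x \<in> ball v (\<rho> / exp 1 ^ n)"
    define \<sigma> where "\<sigma> = \<rho> / exp 1 ^ Suc n"
    have \<sigma>: "\<sigma> > 0" "exp 1 * \<sigma> = \<rho> / exp 1 ^ n" using \<rho> by (auto simp: \<sigma>_def)
    have "\<rho> / exp 1 ^ n \<le> \<rho> / 1" using \<rho> e by (intro divide_left_mono one_le_power) auto
    hence "cball v (exp 1 * \<sigma>) \<subseteq> ball 0 D" unfolding \<sigma>(2) using \<rho>
      by (auto simp: dist_norm) (smt (verit) norm_minus_commute norm_triangle_sub)
    from bern[OF \<sigma>(1) this Suc.prems] x show "cmod (k x) \<le> exp q * C" by (simp add: \<sigma>(2) \<sigma>_def)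
  qed
  thus ?case by (simp add: exp_add algebra_simps)
qed

text \<open>The two regimes for \<open>p\<close> meet at \<open>1 / (4 * T)\<close>. Below it, \<open>h z w\<close> is compared with its value at a
  zero of \<open>f - w\<close>; above it, the factor \<open>2 + 20 / p\<close> lost by \<open>sup_le_by_many_zeros\<close> is at most \<open>2 + 80 * T\<close>,
  which is a power of \<open>e\<close> with exponent proportional to \<open>p\<close>.\<close>
lemma bound_where_valency_is_large:
  fixes f :: "complex \<Rightarrow> complex" and h :: "complex \<Rightarrow> complex \<Rightarrow> complex"
  assumes s: "1 < s" "s \<le> 3" and r: "0 < r" and f: "f holomorphic_on ball 0 (s\<^sup>2 * r)"
    and fW: "\<And>z. z \<in> ball 0 (s\<^sup>2 * r) \<Longrightarrow> f z \<in> W" and W: "open W" "w \<in> W"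
    and nc: "z2 \<in> ball 0 (s\<^sup>2 * r)" "f z2 \<noteq> w"
    and cont: "continuous_on (ball 0 (s\<^sup>2 * r) \<times> W) (\<lambda>(z, v). h z v)"
    and hol1: "(\<lambda>z. h z w) holomorphic_on ball 0 (s\<^sup>2 * r)"
    and hol2: "\<And>z. z \<in> ball 0 (s\<^sup>2 * r) \<Longrightarrow> h z holomorphic_on W"
    and holf: "(\<lambda>z. h z (f z)) holomorphic_on ball 0 (s\<^sup>2 * r)"
    and growth: "\<And>C z. (\<And>z. z \<in> ball 0 r \<Longrightarrow> cmod (h z w) \<le> C) \<Longrightarrow> z \<in> ball 0 (s\<^sup>2 * r) \<Longrightarrow>
        cmod (h z w) \<le> exp p * C"
    and N: "1 \<le> N" "9 / 10 * p \<le> ln ((1 + s\<^sup>2) / (2 * s)) * of_int N"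
      "N \<le> (\<Sum>z | z \<in> ball 0 \<rho> \<and> f z - w = 0. zorder (\<lambda>z. f z - w) z)"
    and \<rho>: "\<rho> \<le> mid_radius s * r"
    and \<delta>: "\<And>z. z \<in> ball 0 r \<Longrightarrow> cmod (h z (f z)) \<le> \<delta>" and p: "0 \<le> p"
    and z: "z \<in> ball 0 r"
  defines "T \<equiv> growth_const s"
  shows "cmod (h z w) \<le> exp ((1 + 4 * T * ln (2 + 80 * T)) * p) * \<delta>"
proof -
  define R where "R = s\<^sup>2 * r"
  note mid = mid_radius_bounds[OF s(1)]
  have s2: "1 < s\<^sup>2" using one_less_power[of s 2] s by simp
  have rR: "r < R" using s2 r by (simp add: R_def)
  have yr: "mid_radius s * r < r" using mid r by simp
  have T1: "1 \<le> T" using growth_const_ge_1 s by (simp add: T_def)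
  have \<delta>0: "0 \<le> \<delta>" using \<delta>[of 0] r order_trans[OF norm_ge_zero] by simp
  have lnT: "1 \<le> ln (2 + 80 * T)"
  proof -
    have "exp 1 \<le> 2 + 80 * T" using exp_le T1 by linarith
    thus ?thesis using T1 by (simp add: ln_ge_iff)
  qed
  define H where "H = (\<lambda>z. h z w)"
  have holH: "H holomorphic_on ball 0 R" using hol1 by (simp add: H_def R_def)
  define m where "m = (SUP z\<in>ball 0 r. cmod (H z))"
  have "compact ((\<lambda>z. cmod (H z)) ` cball 0 r)"
    by (intro compact_continuous_image continuous_on_norm holomorphic_on_imp_continuous_on
        holomorphic_on_subset[OF holH]) (use rR in auto)
  hence "bdd_above ((\<lambda>z. cmod (H z)) ` cball 0 r)" by (intro bounded_imp_bdd_above compact_imp_bounded)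
  hence bdd: "bdd_above ((\<lambda>z. cmod (H z)) ` ball 0 r)" by (rule bdd_above_mono) auto
  have m_upper: "cmod (H x) \<le> m" if "cmod x < r" for x
    unfolding m_def using that by (intro cSUP_upper[OF _ bdd]) auto
  have m_least: "m \<le> C" if "\<And>x. cmod x < r \<Longrightarrow> cmod (H x) \<le> C" for C
    unfolding m_def using that r by (intro cSUP_least) auto
  have m0: "0 \<le> m" using m_upper[of 0] r order_trans[OF norm_ge_zero] by simp
  have Hg: "cmod (H x) \<le> exp p * m" if "cmod x < R" for x
    using growth[of m x] m_upper that by (auto simp: H_def R_def)
  have "m \<le> exp ((1 + 4 * T * ln (2 + 80 * T)) * p) * \<delta>"
  proof (cases "p \<le> 1 / (4 * T)")
    case True
    have "{z. z \<in> ball 0 \<rho> \<and> f z - w = 0} \<noteq> {}" using N by (metis (no_types, lifting) not_one_le_zero order_trans sum.empty)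
    then obtain a where a: "a \<in> ball 0 \<rho>" "f a = w" by auto
    have ar: "cmod a < r" using a \<rho> yr by simp
    have "m \<le> exp (4 * T * p) * \<delta>"
    proof (rule sup_le_value_of_slow_growth[OF s2 r, where H = H and a = a])
      show "cmod (H a) \<le> \<delta>" using \<delta>[of a] a ar by (simp add: H_def)
      show "T = ((s\<^sup>2 + 1) / (s\<^sup>2 - 1))\<^sup>2" by (simp add: T_def growth_const_def)
    qed (use holH m_least m0 Hg ar p True in \<open>auto simp: R_def\<close>)
    also have "\<dots> \<le> exp ((1 + 4 * T * ln (2 + 80 * T)) * p) * \<delta>"
    proof (intro mult_right_mono \<delta>0)
      have "4 * T * 1 \<le> 4 * T * ln (2 + 80 * T)" using lnT T1 by (intro mult_left_mono) auto
      hence "4 * T * p \<le> (1 + 4 * T * ln (2 + 80 * T)) * p" using p by (intro mult_right_mono) auto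
      thus "exp (4 * T * p) \<le> exp ((1 + 4 * T * ln (2 + 80 * T)) * p)" by simp
    qed
    finally show ?thesis .
  next
    case False
    have p0: "0 < p" using False T1 by (smt (verit) divide_pos_pos)
    have Tp: "1 \<le> 4 * T * p" using False T1 by (simp add: field_simps)
    obtain A v where A: "int (size A) = (\<Sum>z | z \<in> ball 0 \<rho> \<and> f z - w = 0. zorder (\<lambda>z. f z - w) z)"
      "set_mset A \<subseteq> ball 0 \<rho>" "v holomorphic_on ball 0 R"
      "\<And>z. z \<in> ball 0 R \<Longrightarrow> h z (f z) - h z w = zprod A z * v z"
      by (rule substitution_difference_factor[of f R W z2 w h \<rho>])
         (use f fW W nc cont hol1 hol2 holf \<rho> yr rR in \<open>auto simp: R_def\<close>)
    have "m \<le> exp (p / 2) * (2 * (1 + 10 / p)) * \<delta>"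
    proof (rule sup_le_by_many_zeros[where G = "\<lambda>z. h z (f z)" and H = H and s = s and r = r and A = A
          and v = v and y = "mid_radius s"])
      have Rss: "r * s * s = R" by (simp add: R_def power2_eq_square)
      show "H holomorphic_on ball 0 (r * s * s)" using holH by (simp add: Rss)
      show "cmod (H z) \<le> exp p * m" if "cmod z < r * s * s" for z using Hg that by (simp add: Rss)
      show "v holomorphic_on ball 0 r" by (rule holomorphic_on_subset[OF A(3)]) (use rR in auto)
      show "h z (f z) - H z = zprod A z * v z" if "cmod z < r" for z
        using A(4)[of z] that rR by (simp add: H_def)
      show "cmod a \<le> mid_radius s * r" if "a \<in># A" for a using A(2) that \<rho> by force
      define X where "X = (s + mid_radius s) / (1 + s * mid_radius s)"
      define Y where "Y = (1 + s\<^sup>2) / (2 * s)"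
      have X0: "X > 0" using s mid by (simp add: X_def add_pos_pos)
      have Y0: "Y > 0" using s by (simp add: Y_def add_pos_pos)
      have "ln (Y\<^sup>2) \<le> ln (X ^ 3)" using mid_radius_exponent[OF s] X0 Y0
        by (subst ln_le_cancel_iff) (auto simp: X_def Y_def)
      hence XY: "2 / 3 * ln Y \<le> ln X" using X0 Y0 by (simp add: ln_realpow)
      have lnY: "0 \<le> ln Y"
      proof -
        have "0 \<le> (s - 1)\<^sup>2" by simp
        hence "2 * s \<le> 1 + s\<^sup>2" by (simp add: power2_eq_square algebra_simps)
        hence "1 \<le> Y" using s by (simp add: Y_def)
        thus ?thesis by simp
      qed
      have NA: "of_int N \<le> real (size A)" using N(3) A(1) by linarith
      have "9 / 10 * p \<le> ln Y * real (size A)"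
        using N(2) mult_left_mono[OF NA lnY] by (simp add: Y_def)
      hence "3 / 5 * p \<le> 2 / 3 * ln Y * real (size A)" by simp
      also have "\<dots> \<le> ln X * real (size A)" using XY by (intro mult_right_mono) auto
      finally have "exp (- (real (size A) * ln X)) \<le> exp (- (3 / 5 * p))" by (simp add: mult.commute)
      moreover have "exp (- (real (size A) * ln X)) = (1 / X) ^ size A"
        using X0 by (simp add: exp_minus exp_of_nat_mult power_divide inverse_eq_divide)
      moreover have "1 / X = (1 + s * mid_radius s) / (s + mid_radius s)" by (simp add: X_def)
      ultimately show "((1 + s * mid_radius s) / (s + mid_radius s)) ^ size A \<le> exp (- (3 / 5 * p))"
        by (simp only:)
    qed (use s r m_least m_upper \<delta> mid p0 in auto)
    also have "\<dots> \<le> exp ((1 + 4 * T * ln (2 + 80 * T)) * p) * \<delta>"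
    proof (intro mult_right_mono \<delta>0)
      have "10 / p \<le> 40 * T" using Tp p0 by (simp add: field_simps)
      hence "2 * (1 + 10 / p) \<le> 2 + 80 * T" by simp
      also have "\<dots> = exp (1 * ln (2 + 80 * T))" using T1 by simp
      also have "\<dots> \<le> exp (4 * T * p * ln (2 + 80 * T))" using Tp lnT by (subst exp_le_cancel_iff) (intro mult_right_mono, auto)
      finally have "exp (p / 2) * (2 * (1 + 10 / p)) \<le> exp p * exp (4 * T * p * ln (2 + 80 * T))"
        using p0 by (intro mult_mono) auto
      also have "\<dots> = exp ((1 + 4 * T * ln (2 + 80 * T)) * p)" by (simp add: exp_add[symmetric] algebra_simps)
      finally show "exp (p / 2) * (2 * (1 + 10 / p)) \<le> exp ((1 + 4 * T * ln (2 + 80 * T)) * p)" .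
    qed
    finally show ?thesis .
  qed
  thus ?thesis using m_upper[of z] z by (simp add: H_def)
qed

text \<open>\<open>s0\<close> is the radius of the disc around \<open>w0\<close> in which the number of zeros persists. As \<open>\<bar>w0\<bar> < M2\<close>, the
  disc of radius \<open>\<bar>w0\<bar> + M2\<close> around \<open>w0\<close> contains the disc of radius \<open>M2\<close> around \<open>0\<close> and lies
  inside the disc of radius \<open>3 * M2\<close>; this is where the constant \<open>3\<close> comes from.\<close>
lemma substitution_estimate:
  fixes f :: "complex \<Rightarrow> complex" and h :: "complex \<Rightarrow> complex \<Rightarrow> complex"
  assumes s: "1 < s" "s \<le> 3" and r: "0 < r" and f: "f holomorphic_on ball 0 (s\<^sup>2 * r)"
    and M2: "\<And>z. z \<in> ball 0 (s\<^sup>2 * r) \<Longrightarrow> cmod (f z) \<le> M2" and M1: "0 < M1" "M1 \<le> M2"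
    and z1: "cmod z1 \<le> r / s\<^sup>2" "M1 * (s\<^sup>2 - 1) / s\<^sup>2 \<le> cmod (f z1 - f 0)"
    and cont: "continuous_on (ball 0 (s\<^sup>2 * r) \<times> ball 0 (3 * M2)) (\<lambda>(z, v). h z v)"
    and hol1: "\<And>w. w \<in> ball 0 (3 * M2) \<Longrightarrow> (\<lambda>z. h z w) holomorphic_on ball 0 (s\<^sup>2 * r)"
    and hol2: "\<And>z. z \<in> ball 0 (s\<^sup>2 * r) \<Longrightarrow> h z holomorphic_on ball 0 (3 * M2)"
    and holf: "(\<lambda>z. h z (f z)) holomorphic_on ball 0 (s\<^sup>2 * r)"
    and growth: "\<And>w C z. w \<in> ball 0 (3 * M2) \<Longrightarrow> (\<And>z. z \<in> ball 0 r \<Longrightarrow> cmod (h z w) \<le> C) \<Longrightarrow>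
        z \<in> ball 0 (s\<^sup>2 * r) \<Longrightarrow> cmod (h z w) \<le> exp p * C"
    and bern: "\<And>z v \<sigma> C w. z \<in> ball 0 (s\<^sup>2 * r) \<Longrightarrow> 0 < \<sigma> \<Longrightarrow> cball v (exp 1 * \<sigma>) \<subseteq> ball 0 (3 * M2) \<Longrightarrow>
        (\<And>w. w \<in> ball v \<sigma> \<Longrightarrow> cmod (h z w) \<le> C) \<Longrightarrow> w \<in> ball v (exp 1 * \<sigma>) \<Longrightarrow> cmod (h z w) \<le> exp q * C"
    and N: "1 \<le> N" "9 / 10 * p \<le> ln ((1 + s\<^sup>2) / (2 * s)) * of_int N"
      "N = (\<Sum>z | z \<in> ball 0 (r / s) \<and> f z - w0 = 0. zorder (\<lambda>z. f z - w0) z)"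
    and \<delta>: "\<And>z. z \<in> ball 0 r \<Longrightarrow> cmod (h z (f z)) \<le> \<delta>" and pq: "0 \<le> p" "0 \<le> q"
    and zw: "z \<in> ball 0 (s\<^sup>2 * r)" "w \<in> ball 0 M2"
  shows "cmod (h z w) \<le> exp (a2_const s * ln (a1_const s * M2 / M1) * (p + q)) * \<delta>"
proof -
  define T where "T = growth_const s"
  define C where "C = 1 + 4 * T * ln (2 + 80 * T)"
  define \<Lambda> where "\<Lambda> = ln (4 * s\<^sup>2 * M2 / ((s\<^sup>2 - 1) * M1))"
  define K where "K = circle_const s"
  define s0 where "s0 = 2 * M2 * exp (- (K * \<Lambda>))"
  have s2: "1 < s\<^sup>2" using one_less_power[of s 2] s by simp
  have rR: "r < s\<^sup>2 * r" using s2 r by simp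
  have \<delta>0: "0 \<le> \<delta>" using \<delta>[of 0] r order_trans[OF norm_ge_zero] by simp
  have M20: "0 < M2" using M1 by simp
  have z1R: "z1 \<in> ball 0 (s\<^sup>2 * r)" "0 \<in> ball (0::complex) (s\<^sup>2 * r)"
  proof -
    have "r / s\<^sup>2 < r" using s s2 r divide_strict_left_mono[of 1 "s\<^sup>2" r] by simp
    thus "z1 \<in> ball 0 (s\<^sup>2 * r)" using z1(1) rR by simp
    show "0 \<in> ball (0::complex) (s\<^sup>2 * r)" using r s by simp
  qed
  have "0 < M1 * (s\<^sup>2 - 1) / s\<^sup>2" using M1 s2 s by simp
  hence nc: "f z1 \<noteq> f 0" using z1(2) by auto
  have fM2: "cmod (f x) < M2" if "x \<in> ball 0 (s\<^sup>2 * r)" for x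
    by (rule strict_bound_of_nonconstant[OF f open_ball connected_ball M2 z1R nc that])
  have "{z. z \<in> ball 0 (r / s) \<and> f z - w0 = 0} \<noteq> {}" using N(1,3) by (metis (no_types, lifting) not_one_le_zero sum.empty)
  then obtain a where a: "a \<in> ball 0 (r / s)" "f a = w0" by auto
  have "r / s < r" using s r by (simp add: field_simps)
  hence aR: "a \<in> ball 0 (s\<^sup>2 * r)" using a rR by simp
  have w0: "cmod w0 < M2" using fM2[OF aR] a by simp
  obtain \<rho> where \<rho>: "r / s \<le> \<rho>" "\<rho> \<le> mid_radius s * r"
    "\<And>w. w \<in> ball w0 s0 \<Longrightarrow> N \<le> (\<Sum>z | z \<in> ball 0 \<rho> \<and> f z - w = 0. zorder (\<lambda>z. f z - w) z)"
    using valency_persists[OF s(1) r f M2 M1(1) z1 aR a(2)]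
    unfolding s0_def K_def \<Lambda>_def N(3) by blast
  have \<Lambda>0: "0 \<le> \<Lambda>"
  proof -
    have "(s\<^sup>2 - 1) * M1 \<le> 4 * s\<^sup>2 * M2" using M1 s2 by (intro mult_mono) auto
    moreover have "(s\<^sup>2 - 1) * M1 > 0" using s2 M1 by simp
    ultimately have "1 \<le> 4 * s\<^sup>2 * M2 / ((s\<^sup>2 - 1) * M1)" by (simp only: le_divide_eq_1_pos)
    thus ?thesis unfolding \<Lambda>_def by (rule ln_ge_zero)
  qed
  have K0: "0 \<le> K"
  proof -
    note mid = mid_radius_bounds[OF s(1)]
    have Q: "(s ^ 4 - s\<^sup>2 + 1) / s\<^sup>2 = 1 + (s\<^sup>2 - 1)\<^sup>2 / s\<^sup>2"
      using s by (simp add: field_simps eval_nat_numeral)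
    have E: "s - 1 \<le> 24 * exp 1 * s ^ 3"
    proof -
      have "s - 1 \<le> s * 1 * 1" by simp
      also have "\<dots> \<le> s * (24 * exp 1) * s\<^sup>2"
        using s s2 exp_ge_add_one_self[of "1::real"] by (intro mult_mono) auto
      finally show ?thesis by (simp add: eval_nat_numeral mult_ac)
    qed
    have "0 \<le> ln ((s ^ 4 - s\<^sup>2 + 1) / s\<^sup>2)" unfolding Q by (intro ln_ge_zero) simp
    moreover have "0 \<le> ln (24 * exp 1 * s ^ 3 / (s - 1))" using E s by (intro ln_ge_zero) (simp add: pos_le_divide_eq)
    moreover have "0 \<le> (1 + mid_radius s) * (s\<^sup>2 + 1) / ((1 - mid_radius s) * (s\<^sup>2 - 1))"
      using mid s2 by (intro divide_nonneg_nonneg mult_nonneg_nonneg) auto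
    ultimately show ?thesis unfolding K_def circle_const_def
      by (intro add_nonneg_nonneg divide_nonneg_nonneg[of "ln _" "ln _"])
  qed
  have s0: "s0 \<le> 2 * M2" "0 < s0" using M20 K0 \<Lambda>0 by (auto simp: s0_def mult_le_cancel_left1)
  have disc: "cmod (h x u) \<le> exp (C * p) * \<delta>" if x: "x \<in> ball 0 r" and u: "u \<in> ball w0 s0" for x u
  proof -
    have uW: "u \<in> ball 0 (3 * M2)"
      using u w0 s0 norm_triangle_sub[of u w0] by (simp add: dist_norm norm_minus_commute)
    obtain z2 where z2: "z2 \<in> ball 0 (s\<^sup>2 * r)" "f z2 \<noteq> u" using z1R nc by metis
    show ?thesis unfolding C_def T_def
    proof (rule bound_where_valency_is_large[OF s r f _ open_ball uW z2 cont hol1[OF uW] hol2 holf _ N(1,2) \<rho>(3)[OF u] \<rho>(2) \<delta> pq(1) x])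
      show "f x \<in> ball 0 (3 * M2)" if "x \<in> ball 0 (s\<^sup>2 * r)" for x using fM2[OF that] M20 by simp
    qed (use growth[OF uW] in auto)
  qed
  define n where "n = nat \<lceil>K * \<Lambda>\<rceil>"
  have n: "K * \<Lambda> \<le> real n" "real n \<le> K * \<Lambda> + 1"
    using K0 \<Lambda>0 by (auto simp: n_def)
  have ball_r: "cmod (h x u) \<le> exp (real n * q) * (exp (C * p) * \<delta>)" if x: "x \<in> ball 0 r" and u: "u \<in> ball 0 M2" for x u
  proof (rule bernstein_chain[where k = "h x" and q = q and n = n and w = u and v = w0 and \<rho> = "cmod w0 + M2" and D = "3 * M2"])
    have xR: "x \<in> ball 0 (s\<^sup>2 * r)" using x rR by simp
    show "cmod (h x y) \<le> exp q * B" if "0 < \<sigma>" "cball v (exp 1 * \<sigma>) \<subseteq> ball 0 (3 * M2)"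
      "\<And>w. w \<in> ball v \<sigma> \<Longrightarrow> cmod (h x w) \<le> B" "y \<in> ball v (exp 1 * \<sigma>)" for v \<sigma> B y
      by (rule bern[OF xR that])
    show "0 < cmod w0 + M2" using M20 by (simp add: add_nonneg_pos)
    show "cmod w0 + (cmod w0 + M2) < 3 * M2" using w0 by simp
    show "u \<in> ball w0 (cmod w0 + M2)" using u norm_triangle_ineq4[of w0 u] by (simp add: dist_norm)
    fix y assume y: "y \<in> ball w0 ((cmod w0 + M2) / exp 1 ^ n)"
    have "(cmod w0 + M2) / exp 1 ^ n = (cmod w0 + M2) * exp (- real n)"
      by (simp add: exp_minus exp_of_nat_mult[of n 1, simplified] divide_inverse)
    also have "\<dots> \<le> 2 * M2 * exp (- (K * \<Lambda>))" using w0 n M20 by (intro mult_mono) auto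
    finally have "y \<in> ball w0 s0" using y by (simp add: s0_def)
    thus "cmod (h x y) \<le> exp (C * p) * \<delta>" by (rule disc[OF x])
  qed
  have wW: "w \<in> ball 0 (3 * M2)" using zw M20 by simp
  have "cmod (h z w) \<le> exp p * (exp (real n * q) * (exp (C * p) * \<delta>))"
    by (rule growth[OF wW _ zw(1)]) (use ball_r zw(2) in auto)
  also have "\<dots> = exp (p + C * p + real n * q) * \<delta>" by (simp add: exp_add)
  also have "\<dots> \<le> exp (p + C * p + (K * \<Lambda> + 1) * q) * \<delta>"
    using n(2) pq \<delta>0 by (intro mult_right_mono) (auto intro!: mult_right_mono)
  also have "\<dots> \<le> exp (a2_const s * ln (a1_const s * M2 / M1) * (p + q)) * \<delta>"
    using exponent_le[OF s M1 pq] \<delta>0 unfolding C_def T_def K_def \<Lambda>_def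
    by (intro mult_right_mono) (auto simp only: exp_le_cancel_iff)
  finally show ?thesis .
qed

section \<open>Differentiable functions of several variables along curves\<close>

lemma tendsto_L2_set:
  assumes "\<And>i. i \<in> I \<Longrightarrow> ((\<lambda>x. f x i) \<longlongrightarrow> l i) F"
  shows "((\<lambda>x. L2_set (f x) I) \<longlongrightarrow> L2_set l I) F"
  unfolding L2_set_def by (intro tendsto_intros assms)

text \<open>Where the norm in the denominator is zero, the quotient is zero by convention, but then
  \<open>x = a\<close> and the formula still holds.\<close>
lemma remainder_expansion:
  fixes g :: "('i \<Rightarrow> complex) \<Rightarrow> complex"
  assumes "finite I" and ext: "x \<in> extensional I" "a \<in> extensional I"
  shows "g x - g a = (\<Sum>i\<in>I. L i * (x i - a i)) +
    (g x - g a - (\<Sum>i\<in>I. L i * (x i - a i))) / complex_of_real (L2_set (\<lambda>i. cmod (x i - a i)) I)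
      * complex_of_real (L2_set (\<lambda>i. cmod (x i - a i)) I)"
proof (cases "L2_set (\<lambda>i. cmod (x i - a i)) I = 0")
  case True
  hence "\<forall>i\<in>I. x i = a i" using assms(1) by (simp add: L2_set_eq_0_iff)
  hence "x = a" using ext by (auto intro: extensionalityI)
  thus ?thesis by simp
qed simp

lemma holomorphic_vars_on_continuous:
  fixes g :: "('i::countable \<Rightarrow> complex) \<Rightarrow> complex"
  assumes hol: "holomorphic_vars_on I g U" and I: "finite I"
    and U: "U \<subseteq> extensional I"
  shows "continuous_on U g"
  unfolding continuous_on_def
proof
  fix a assume a: "a \<in> U"
  define n where "n = (\<lambda>x. complex_of_real (L2_set (\<lambda>i. cmod (x i - a i)) I))"
  obtain L where L: "((\<lambda>x. (g x - g a - (\<Sum>i\<in>I. L i * (x i - a i))) / n x) \<longlongrightarrow> 0) (at a within U)"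
    using hol a unfolding holomorphic_vars_on_def n_def by blast
  have coord: "((\<lambda>x. x i) \<longlongrightarrow> a i) (at a within U)" for i
    using continuous_on_product_coordinates[of i]
    by (metis UNIV_I continuous_on_def subset_UNIV tendsto_within_subset)
  have "((\<lambda>x. L2_set (\<lambda>i. cmod (x i - a i)) I) \<longlongrightarrow> L2_set (\<lambda>i. cmod (a i - a i)) I) (at a within U)"
    by (intro tendsto_L2_set tendsto_intros coord)
  hence "((\<lambda>x. L2_set (\<lambda>i. cmod (x i - a i)) I) \<longlongrightarrow> 0) (at a within U)" by (simp add: L2_set_def)
  hence n: "(n \<longlongrightarrow> of_real 0) (at a within U)" unfolding n_def by (intro tendsto_of_real)
  have "((\<lambda>x. g a + ((\<Sum>i\<in>I. L i * (x i - a i)) + (g x - g a - (\<Sum>i\<in>I. L i * (x i - a i))) / n x * n x))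
      \<longlongrightarrow> g a + ((\<Sum>i\<in>I. L i * (a i - a i)) + 0 * of_real 0)) (at a within U)"
    by (intro tendsto_intros coord L n)
  hence lim: "((\<lambda>x. g a + ((\<Sum>i\<in>I. L i * (x i - a i)) + (g x - g a - (\<Sum>i\<in>I. L i * (x i - a i))) / n x * n x))
      \<longlongrightarrow> g a) (at a within U)" by simp
  have "\<forall>\<^sub>F x in at a within U. x \<in> U" by (simp add: eventually_at_topological) blast
  hence "\<forall>\<^sub>F x in at a within U. g a + ((\<Sum>i\<in>I. L i * (x i - a i)) + (g x - g a - (\<Sum>i\<in>I. L i * (x i - a i))) / n x * n x) = g x"
  proof eventually_elim
    case (elim x)
    have "g x - g a = (\<Sum>i\<in>I. L i * (x i - a i)) + (g x - g a - (\<Sum>i\<in>I. L i * (x i - a i))) / n x * n x"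
      unfolding n_def by (rule remainder_expansion[OF I]) (use U elim a in auto)
    thus ?case by (metis add_diff_cancel_left' diff_add_cancel add.commute)
  qed
  thus "(g \<longlongrightarrow> g a) (at a within U)" by (rule Lim_transform_eventually[OF lim])
qed

lemma holomorphic_vars_on_curve:
  fixes \<gamma> :: "complex \<Rightarrow> 'i::countable \<Rightarrow> complex"
  assumes hol: "holomorphic_vars_on I g U" and I: "finite I"
    and U: "U \<subseteq> extensional I"
    and S: "open S" "\<And>z. z \<in> S \<Longrightarrow> \<gamma> z \<in> U" "\<And>i. i \<in> I \<Longrightarrow> (\<lambda>z. \<gamma> z i) holomorphic_on S"
  shows "(\<lambda>z. g (\<gamma> z)) holomorphic_on S"
proof (rule holomorphic_onI)
  fix z0 assume z0: "z0 \<in> S"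
  define a where "a = \<gamma> z0"
  have a: "a \<in> U" using S z0 by (simp add: a_def)
  define n where "n = (\<lambda>x. complex_of_real (L2_set (\<lambda>i. cmod (x i - a i)) I))"
  obtain L where L: "((\<lambda>x. (g x - g a - (\<Sum>i\<in>I. L i * (x i - a i))) / n x) \<longlongrightarrow> 0) (at a within U)"
    using hol a unfolding holomorphic_vars_on_def n_def by blast
  define Q where "Q = (\<lambda>x. (g x - g a - (\<Sum>i\<in>I. L i * (x i - a i))) / n x)"
  have Qa: "Q a = 0" by (simp add: Q_def)
  hence Qcont: "continuous (at a within U) Q" using L by (simp add: continuous_within Q_def)
  have inS: "\<forall>\<^sub>F z in at z0. z \<in> S" using S(1) z0 by (rule eventually_at_in_open')
  have \<gamma>cont: "continuous_on S \<gamma>"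
  proof (rule continuous_on_coordinatewise_then_product)
    fix i show "continuous_on S (\<lambda>z. \<gamma> z i)"
    proof (cases "i \<in> I")
      case True thus ?thesis using S(3) holomorphic_on_imp_continuous_on by blast
    next
      case False
      hence "\<gamma> z i = a i" if "z \<in> S" for z 
        using extensional_arb[OF subsetD[OF U S(2)[OF that]] False]
          extensional_arb[OF subsetD[OF U a] False] by simp
      thus ?thesis by (simp cong: continuous_on_cong)
    qed
  qed
  have "continuous (at z0 within S) (\<lambda>z. Q (\<gamma> z))"
  proof (rule continuous_within_compose2[where f = \<gamma> and g = Q])
    show "continuous (at z0 within S) \<gamma>" using \<gamma>cont z0 by (simp add: continuous_on_eq_continuous_within)
    show "continuous (at (\<gamma> z0) within \<gamma> ` S) Q"
      using continuous_within_subset[OF Qcont, of "\<gamma> ` S"] S(2) by (auto simp: a_def)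
  qed
  hence Qlim: "((\<lambda>z. Q (\<gamma> z)) \<longlongrightarrow> 0) (at z0)"
    using Qa at_within_open[OF z0 S(1)] by (simp add: continuous_within a_def)
  define D where "D = (\<lambda>i. deriv (\<lambda>z. \<gamma> z i) z0)"
  have D: "((\<lambda>z. (\<gamma> z i - a i) / (z - z0)) \<longlongrightarrow> D i) (at z0)" if "i \<in> I" for i
    using holomorphic_derivI[OF S(3)[OF that] S(1) z0] by (simp add: has_field_derivative_iff D_def a_def)
  have "((\<lambda>z. L2_set (\<lambda>i. cmod ((\<gamma> z i - a i) / (z - z0))) I) \<longlongrightarrow> L2_set (\<lambda>i. cmod (D i)) I) (at z0)"
    by (intro tendsto_L2_set tendsto_norm D)
  hence "((\<lambda>z. cmod (Q (\<gamma> z)) * L2_set (\<lambda>i. cmod ((\<gamma> z i - a i) / (z - z0))) I) \<longlongrightarrow> cmod 0 * L2_set (\<lambda>i. cmod (D i)) I) (at z0)"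
    by (intro tendsto_mult tendsto_norm Qlim)
  hence lim0: "((\<lambda>z. cmod (Q (\<gamma> z)) * L2_set (\<lambda>i. cmod ((\<gamma> z i - a i) / (z - z0))) I) \<longlongrightarrow> 0) (at z0)"
    by simp
  have rem: "((\<lambda>z. Q (\<gamma> z) * n (\<gamma> z) / (z - z0)) \<longlongrightarrow> 0) (at z0)"
  proof (rule tendsto_norm_zero_cancel, rule Lim_transform_eventually[OF lim0])
    show "\<forall>\<^sub>F z in at z0. cmod (Q (\<gamma> z)) * L2_set (\<lambda>i. cmod ((\<gamma> z i - a i) / (z - z0))) I
       = cmod (Q (\<gamma> z) * n (\<gamma> z) / (z - z0))"
      using eventually_neq_at_within[of z0 z0 UNIV]
    proof eventually_elim
      case (elim z)
      have "L2_set (\<lambda>i. cmod (\<gamma> z i - a i)) I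
         = cmod (z - z0) * L2_set (\<lambda>i. cmod ((\<gamma> z i - a i) / (z - z0))) I"
        using elim by (simp add: L2_set_right_distrib norm_divide)
      thus ?case using elim by (simp add: n_def norm_mult norm_divide L2_set_nonneg)
    qed
  qed
  have "((\<lambda>z. (\<Sum>i\<in>I. L i * ((\<gamma> z i - a i) / (z - z0))) + Q (\<gamma> z) * n (\<gamma> z) / (z - z0))
      \<longlongrightarrow> (\<Sum>i\<in>I. L i * D i) + 0) (at z0)"
    by (intro tendsto_intros D rem)
  hence "((\<lambda>z. (g (\<gamma> z) - g (\<gamma> z0)) / (z - z0)) \<longlongrightarrow> (\<Sum>i\<in>I. L i * D i) + 0) (at z0)"
  proof (rule Lim_transform_eventually)
    show "\<forall>\<^sub>F z in at z0. (\<Sum>i\<in>I. L i * ((\<gamma> z i - a i) / (z - z0))) + Q (\<gamma> z) * n (\<gamma> z) / (z - z0)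
        = (g (\<gamma> z) - g (\<gamma> z0)) / (z - z0)"
      using inS
    proof eventually_elim
      case (elim z)
      have "g (\<gamma> z) - g a = (\<Sum>i\<in>I. L i * (\<gamma> z i - a i)) + Q (\<gamma> z) * n (\<gamma> z)"
        unfolding Q_def n_def by (rule remainder_expansion[OF I]) (use U S(2)[OF elim] a in auto)
      thus ?case by (simp add: a_def add_divide_distrib sum_divide_distrib)
    qed
  qed
  hence "((\<lambda>z. g (\<gamma> z)) has_field_derivative ((\<Sum>i\<in>I. L i * D i) + 0)) (at z0)"
    by (simp add: has_field_derivative_iff)
  thus "(\<lambda>z. g (\<gamma> z)) field_differentiable at z0 within S"
    using field_differentiable_at_within field_differentiable_def by blast
qed

section \<open>Suprema, Bernstein index and valency as estimates in the reals\<close>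

lemma M_sup_le_iff:
  assumes "0 \<le> C"
  shows "M_sup f r z0 \<le> ennreal C \<longleftrightarrow> (\<forall>z\<in>ball z0 r. cmod (f z) \<le> C)"
  using assms by (simp add: M_sup_def SUP_le_iff)

lemma le_M_sup: "z \<in> ball z0 r \<Longrightarrow> ennreal (cmod (f z)) \<le> M_sup f r z0"
  unfolding M_sup_def by (rule SUP_upper)

lemma M_sup_growth_bound:
  assumes "M_sup F R 0 \<le> ennreal (exp p) * M_sup F r 0" "0 < r"
    and C: "\<And>z. z \<in> ball 0 r \<Longrightarrow> cmod (F z) \<le> C" and z: "z \<in> ball 0 R"
  shows "cmod (F z) \<le> exp p * C"
proof -
  have C0: "0 \<le> C" using C[of 0] assms(2) order_trans[OF norm_ge_zero] by simp
  have "M_sup F R 0 \<le> ennreal (exp p) * ennreal C"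
    using assms(1) C C0 by (meson M_sup_le_iff mult_left_mono order_trans zero_le)
  also have "\<dots> = ennreal (exp p * C)" using C0 by (simp add: ennreal_mult)
  finally show ?thesis using C0 z by (simp add: M_sup_le_iff)
qed

text \<open>Finiteness of the supremum over the small disc allows it to be used as one of the real
  bounds \<open>C\<close>. The set \<open>S\<close> and the function \<open>G\<close> are arbitrary because the estimates compare \<open>F\<close> with
  itself on a larger disc and with a function of several variables on a polydisc.\<close>
lemma M_sup_growthI:
  assumes bdd: "\<And>z. z \<in> ball 0 r \<Longrightarrow> cmod (F z) \<le> B" and r: "0 < r"
    and g: "\<And>C z. 0 \<le> C \<Longrightarrow> (\<And>z. z \<in> ball 0 r \<Longrightarrow> cmod (F z) \<le> C) \<Longrightarrow> z \<in> S \<Longrightarrow> cmod (G z) \<le> c * C"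
    and c: "0 \<le> c"
  shows "(SUP z\<in>S. ennreal (cmod (G z))) \<le> ennreal c * M_sup F r 0"
proof -
  have B0: "0 \<le> B" using bdd[of 0] r order_trans[OF norm_ge_zero] by simp
  have "M_sup F r 0 \<le> ennreal B" using bdd B0 by (simp add: M_sup_le_iff)
  hence fin: "M_sup F r 0 = ennreal (enn2real (M_sup F r 0))"
    using le_less_trans[OF _ ennreal_less_top] by simp
  have le: "cmod (F z) \<le> enn2real (M_sup F r 0)" if "z \<in> ball 0 r" for z
    using le_M_sup[OF that, of F] fin by (metis enn2real_nonneg ennreal_le_iff)
  have "cmod (G z) \<le> c * enn2real (M_sup F r 0)" if "z \<in> S" for z by (rule g[OF _ le that]) simp
  hence "(SUP z\<in>S. ennreal (cmod (G z))) \<le> ennreal (c * enn2real (M_sup F r 0))"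
    by (intro SUP_least ennreal_leI)
  also have "\<dots> = ennreal c * M_sup F r 0" using c fin by (simp add: ennreal_mult)
  finally show ?thesis .
qed

text \<open>The extended-valued conventions do not interfere: in the extended reals subtracting \<open>-\<infinity>\<close> gives
  \<open>\<infinity>\<close>, so unless \<open>k\<close> is identically zero a finite index excludes that \<open>k\<close> vanishes on a small disc.\<close>
lemma bernstein_index_bound:
  assumes b: "bernstein_index k D 0 \<le> ereal q" and \<sigma>: "0 < \<sigma>" "cball v (exp 1 * \<sigma>) \<subseteq> ball 0 D"
    and C: "\<And>w. w \<in> ball v \<sigma> \<Longrightarrow> cmod (k w) \<le> C" and w: "w \<in> ball v (exp 1 * \<sigma>)"
  shows "cmod (k w) \<le> exp q * C"
proof -
  have C0: "0 \<le> C" using C[of v] \<sigma> order_trans[OF norm_ge_zero] by simp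
  have wD: "w \<in> ball 0 D" using w \<sigma> by (meson ball_subset_cball subsetD)
  show ?thesis
  proof (cases "\<forall>z\<in>ball 0 D. k z = 0")
    case True
    thus ?thesis using wD C0 by simp
  next
    case False
    define A where "A = M_sup k (exp 1 * \<sigma>) v"
    define B where "B = M_sup k \<sigma> v"
    have "m_sup k (exp 1 * \<sigma>) v - m_sup k \<sigma> v \<le> bernstein_index k D 0"
      unfolding bernstein_index_def using False \<sigma> 
      by (auto simp del: ball_eq_empty intro!: SUP_upper2[of "(v, \<sigma>)"])
    hence le: "eln A - eln B \<le> ereal q" using b unfolding m_sup_def A_def B_def by (rule order_trans)
    have BC: "B \<le> ennreal C" using C C0 by (simp add: B_def M_sup_le_iff)
    have wA: "ennreal (cmod (k w)) \<le> A" using w by (simp add: A_def le_M_sup)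
    have B0: "B \<noteq> 0" using le by (auto simp: eln_def split: if_splits)
    have Btop: "B \<noteq> top" using BC by (auto simp: top_unique)
    have Atop: "A \<noteq> top" using le B0 Btop by (auto simp: eln_def)
    show ?thesis
    proof (cases "A = 0")
      case True
      thus ?thesis using wA C0 by (simp add: ennreal_eq_0_iff)
    next
      case False
      define a b where "a = enn2real A" and "b = enn2real B"
      have ab: "A = ennreal a" "B = ennreal b" "0 < a" "0 < b"
        using False Atop B0 Btop by (auto simp: a_def b_def enn2real_positive_iff less_top zero_less_iff_neq_zero)
      have "ln a - ln b \<le> q" using le False Atop B0 Btop by (simp add: eln_def a_def b_def)
      hence "ln a \<le> ln (exp q * b)" using ab by (simp add: ln_mult)
      hence "a \<le> exp q * b" using ab by simp
      also have "b \<le> C" using BC ab C0 by simp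
      finally have "a \<le> exp q * C" by simp
      moreover have "cmod (k w) \<le> a" using wA ab by simp
      ultimately show ?thesis by linarith
    qed
  qed
qed

text \<open>The number of zeros is an integer, and at least \<open>1\<close> for the value \<open>f 0\<close>. The factor \<open>9 / 10\<close> spares a
  proof that the supremum defining the valency is attained.\<close>
lemma valency_witness:
  fixes f :: "complex \<Rightarrow> complex"
  assumes f: "f holomorphic_on ball 0 R" and \<rho>: "0 < \<rho>" "\<rho> < R" and nc: "z1 \<in> ball 0 R" "f z1 \<noteq> f 0"
    and c: "0 < c" and p: "0 \<le> p" "ereal p \<le> ereal c * valency f \<rho> 0"
  obtains w N where "1 \<le> N" "9 / 10 * p \<le> c * of_int N"
    "N = (\<Sum>z | z \<in> ball 0 \<rho> \<and> f z - w = 0. zorder (\<lambda>z. f z - w) z)"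
proof -
  define n where "n = (\<lambda>c. \<Sum>z | z \<in> ball 0 \<rho> \<and> f z + c = 0. zorder (\<lambda>z. f z + c) z)"
  have R0: "0 \<in> ball (0::complex) R" using \<rho> by simp
  have holc: "(\<lambda>z. f z + c) holomorphic_on ball 0 R" for c using f by (intro holomorphic_intros)
  have nz: "\<exists>w\<in>ball 0 R. f w + c \<noteq> 0" for c
    using nc R0 by (metis add_right_cancel)
  have fin: "finite {z \<in> ball 0 \<rho>. f z + c = 0}" for c
  proof -
    from nz[of c] obtain w where "w \<in> ball 0 R" "f w + c \<noteq> 0" by blast
    from finite_zeros_cball[OF holc \<rho>(2) this] show ?thesis by (rule finite_subset[rotated]) auto
  qed
  have nall: "\<not> (\<forall>z\<in>ball 0 \<rho>. f z + c = 0)" for c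
  proof
    assume "\<forall>z\<in>ball 0 \<rho>. f z + c = 0"
    hence "{z \<in> ball 0 \<rho>. f z + c = 0} = ball 0 \<rho>" by auto
    thus False using fin[of c] \<rho> finite_imp_not_open[of "ball (0::complex) \<rho>"] by auto
  qed
  have nzeros: "n_zeros (\<lambda>z. f z + c) \<rho> 0 = ereal (of_int (n c))" for c
    using fin[of c] nall[of c] unfolding n_zeros_def n_def Let_def by simp
  have zord: "z \<in> ball 0 \<rho> \<Longrightarrow> f z + c = 0 \<Longrightarrow> 0 < zorder (\<lambda>z. f z + c) z" for c z
    using zorder_exist_zero[OF holc open_ball connected_ball _ nz, of z c] \<rho> by (auto split: if_splits)
  have n0: "1 \<le> n (- f 0)"
  proof -
    have "0 \<in> {z. z \<in> ball 0 \<rho> \<and> f z + - f 0 = 0}" using \<rho> by simp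
    hence "zorder (\<lambda>z. f z + - f 0) 0 \<le> n (- f 0)"
      unfolding n_def using fin[of "- f 0"] zord[of _ "- f 0"]
      by (intro member_le_sum) (auto intro: less_imp_le)
    moreover have "0 < zorder (\<lambda>z. f z + - f 0) 0" using \<rho> by (intro zord) auto
    ultimately show ?thesis by linarith
  qed
  have "\<exists>b. 1 \<le> n b \<and> 9 / 10 * p \<le> c * of_int (n b)"
  proof (cases "p = 0")
    case True
    thus ?thesis using n0 c by (intro exI[of _ "- f 0"]) auto
  next
    case False
    have "\<exists>b. 9 / 10 * p < c * of_int (n b)"
    proof (rule ccontr)
      assume "\<nexists>b. 9 / 10 * p < c * of_int (n b)"
      hence "c * of_int (n b) \<le> 9 / 10 * p" for b by (simp add: not_less)
      hence "of_int (n b) \<le> 9 / 10 * p / c" for b using c by (simp add: field_simps)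
      hence "valency f \<rho> 0 \<le> ereal (9 / 10 * p / c)"
        unfolding valency_def nzeros by (intro SUP_least) auto
      hence "ereal c * valency f \<rho> 0 \<le> ereal c * ereal (9 / 10 * p / c)"
        using c by (intro ereal_mult_left_mono) auto
      also have "\<dots> = ereal (9 / 10 * p)" using c by simp
      finally have "ereal p \<le> ereal (9 / 10 * p)" using p(2) by (rule order_trans[rotated])
      thus False using False p(1) by simp
    qed
    then obtain b where b: "9 / 10 * p < c * of_int (n b)" by blast
    have "0 < c * of_int (n b)" using b p(1) by linarith
    hence "0 < n b" using c by (simp add: zero_less_mult_iff)
    thus ?thesis using b by (intro exI[of _ b]) auto
  qed
  then obtain b where b: "1 \<le> n b" "9 / 10 * p \<le> c * of_int (n b)" by blast
  show ?thesis by (rule that[OF b, of "- b"]) (simp add: n_def)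
qed

text \<open>Let \<open>\<bar>f z1\<bar>\<close> be the maximum on the closed disc of radius \<open>r / t\<close>. The growth hypothesis makes \<open>\<bar>f 0\<bar>\<close>
  at most \<open>\<bar>f z1\<bar> / t\<close>.\<close>
lemma oscillation_witness:
  assumes f: "f holomorphic_on ball 0 (t * r)" and t: "1 < t" and r: "0 < r" and M: "0 < M1" "0 < M2"
    and M1: "ennreal M1 \<le> M_sup f (r / t) 0" and M2: "M_sup f (t * r) 0 \<le> ennreal M2"
    and q: "ennreal t \<le> M_sup f (r / t) 0 / M_sup f (r / t\<^sup>2) 0"
  obtains z1 where "cmod z1 \<le> r / t" "M1 * (t - 1) / t \<le> cmod (f z1 - f 0)" "M1 \<le> M2"
    "\<And>z. z \<in> ball 0 (t * r) \<Longrightarrow> cmod (f z) \<le> M2"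
proof -
  have tt: "r / t < t * r" "0 < r / t"
  proof -
    have "r / t < r" "r < t * r" using t r by (auto simp: pos_divide_less_eq)
    thus "r / t < t * r" by linarith
  qed (use t r in auto)
  have fM2: "cmod (f z) \<le> M2" if "z \<in> ball 0 (t * r)" for z using M2 M that by (simp add: M_sup_le_iff)
  have "\<exists>x\<in>cball 0 (r / t). \<forall>y\<in>cball 0 (r / t). cmod (f y) \<le> cmod (f x)"
  proof (rule continuous_attains_sup)
    show "cball (0::complex) (r / t) \<noteq> {}" using less_imp_le[OF tt(2)] by (simp only: cball_eq_empty not_less)
    show "continuous_on (cball 0 (r / t)) (\<lambda>x. cmod (f x))"
      using tt(1)
      by (intro continuous_on_norm holomorphic_on_imp_continuous_on holomorphic_on_subset[OF f]) auto
  qed simp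
  then obtain z1 where z1: "z1 \<in> cball 0 (r / t)" "\<And>y. y \<in> cball 0 (r / t) \<Longrightarrow> cmod (f y) \<le> cmod (f z1)" by blast
  define m where "m = cmod (f z1)"
  have Mm: "M_sup f (r / t) 0 \<le> ennreal m" unfolding m_def by (subst M_sup_le_iff) (auto intro!: z1)
  hence M1m: "M1 \<le> m" using M1 M by (metis ennreal_le_iff m_def norm_ge_zero order_trans)
  have mM2: "m \<le> M2" unfolding m_def using z1(1) tt by (intro fM2) auto
  define B where "B = M_sup f (r / t\<^sup>2) 0"
  have t2: "0 < r / t\<^sup>2" using t r by simp
  have fB: "ennreal (cmod (f 0)) \<le> B" unfolding B_def using t2 by (intro le_M_sup) simp
  have f0: "t * cmod (f 0) \<le> m"
  proof (cases "B = 0")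
    case True
    thus ?thesis using fB by (simp add: m_def ennreal_eq_0_iff)
  next
    case False
    have "M_sup f (r / t) 0 / B \<noteq> 0" using q t unfolding B_def[symmetric] by (metis ennreal_eq_0_iff le_zero_eq not_le order_less_trans zero_less_one)
    hence "B \<noteq> top" by (auto simp: ennreal_divide_top)
    have "ennreal t * B \<le> M_sup f (r / t) 0 / B * B"
      using q unfolding B_def[symmetric] by (rule mult_right_mono) simp
    also have "\<dots> = M_sup f (r / t) 0" 
      using mult_divide_eq_ennreal[OF False \<open>B \<noteq> top\<close>, of "M_sup f (r / t) 0"]
      by (simp add: ennreal_times_divide mult.commute)
    also have "\<dots> \<le> ennreal m" by (rule Mm)
    finally have "ennreal t * ennreal (cmod (f 0)) \<le> ennreal m" using mult_left_mono[OF fB, of "ennreal t"] by (simp add: order_trans)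
    thus ?thesis using t by (simp add: ennreal_mult[symmetric] m_def)
  qed
  have "M1 * (t - 1) / t \<le> m * (t - 1) / t" using M1m t by (intro divide_right_mono mult_right_mono) auto
  also have "\<dots> = m - m / t" using t by (simp add: field_simps)
  also have "\<dots> \<le> m - cmod (f 0)" using f0 t by (simp add: field_simps)
  also have "\<dots> \<le> cmod (f z1 - f 0)" unfolding m_def by (rule norm_triangle_ineq2)
  finally show ?thesis using that[of z1] z1(1) M1m mM2 fM2 by simp
qed

section \<open>Substituting all the functions, one variable at a time\<close>

text \<open>The argument of \<open>g\<close> after the variables in \<open>J\<close> have been replaced by the functions \<open>f i\<close>, the others
  being frozen at \<open>w\<close>.\<close>
definition subst_point :: "nat \<Rightarrow> (nat \<Rightarrow> complex \<Rightarrow> complex) \<Rightarrow> nat set \<Rightarrow> (nat \<Rightarrow> complex) \<Rightarrow> complex \<Rightarrow> nat \<Rightarrow> complex" where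
  "subst_point k f J w z = (\<lambda>i\<in>{0..k}. if i = 0 then z else if i \<in> J then f i z else w i)"

lemma polydisc_extensional: "polydisc I R \<subseteq> extensional I"
  by (auto simp: polydisc_def PiE_def)

lemma subst_point_in_polydisc:
  assumes "z \<in> ball 0 R" "\<And>i. i \<in> {1..k} \<Longrightarrow> i \<in> J \<Longrightarrow> cmod (f i z) < 3 * M i"
    "\<And>i. i \<in> {1..k} \<Longrightarrow> i \<notin> J \<Longrightarrow> w i \<in> ball 0 (3 * M i)"
  shows "subst_point k f J w z \<in> polydisc {0..k} (\<lambda>i. if i = 0 then R else 3 * M i)"
  using assms by (auto simp: subst_point_def polydisc_def PiE_iff)

lemma subst_point_update_insert:
  "i \<in> {1..k} \<Longrightarrow> i \<notin> J \<Longrightarrow> subst_point k f J (w(i := f i z)) z = subst_point k f (insert i J) w z"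
  by (auto simp: subst_point_def fun_eq_iff restrict_def)

text \<open>This instantiates \<open>substitution_estimate\<close> with \<open>g\<close> as a function of \<open>z\<close> and the \<open>i\<close>-th variable. The
  variables already substituted are, for fixed \<open>z\<close>, just points of the discs of radius
  \<open>3 * M2 l\<close>, so the Bernstein index in the \<open>i\<close>-th variable is still at most \<open>q\<close>.\<close>
lemma substitute_one_variable:
  fixes g :: "(nat \<Rightarrow> complex) \<Rightarrow> complex"
  assumes s: "1 < s" "s \<le> 3" and r: "0 < r" and i: "i \<in> {1..k}" "i \<notin> J"
    and f: "\<And>l. l \<in> {1..k} \<Longrightarrow> f l holomorphic_on ball 0 (s\<^sup>2 * r)"
    and fM: "\<And>l z. l \<in> {1..k} \<Longrightarrow> z \<in> ball 0 (s\<^sup>2 * r) \<Longrightarrow> cmod (f l z) < M2 l"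
    and M: "0 < M1 i" "M1 i \<le> M2 i"
    and z1: "cmod z1 \<le> r / s\<^sup>2" "M1 i * (s\<^sup>2 - 1) / s\<^sup>2 \<le> cmod (f i z1 - f i 0)"
    and g: "holomorphic_vars_on {0..k} g
      (polydisc {0..k} (\<lambda>i. if i = 0 then s\<^sup>2 * r else 3 * M2 i))"
    and F: "\<And>w. w \<in> polydisc ({1..k} - {i}) (\<lambda>j. 3 * M2 j) \<Longrightarrow>
        (\<lambda>z v. g (w(0 := z, i := v))) \<in> F_class p0 q r (s\<^sup>2) (M2 i)"
    and growth: "\<And>w C z. (\<And>l. l \<in> {1..k} \<Longrightarrow> w l \<in> ball 0 (3 * M2 l)) \<Longrightarrow>
        (\<And>z. z \<in> ball 0 r \<Longrightarrow> cmod (g (subst_point k f J w z)) \<le> C) \<Longrightarrow> z \<in> ball 0 (s\<^sup>2 * r) \<Longrightarrow>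
        cmod (g (subst_point k f J w z)) \<le> exp p * C"
    and val: "ereal p \<le> ereal (ln ((1 + s\<^sup>2) / (2 * s))) * valency (f i) (r / s) 0"
    and pq: "0 \<le> p" "0 \<le> q"
    and w: "\<And>l. l \<in> {1..k} \<Longrightarrow> w l \<in> ball 0 (3 * M2 l)"
    and C: "\<And>z. z \<in> ball 0 r \<Longrightarrow> cmod (g (subst_point k f (insert i J) w z)) \<le> C"
    and zv: "z \<in> ball 0 (s\<^sup>2 * r)" "v \<in> ball 0 (M2 i)"
  shows "cmod (g (subst_point k f J (w(i := v)) z))
    \<le> exp (a2_const s * ln (a1_const s * M2 i / M1 i) * (p + q)) * C"
proof -
  define U where "U = polydisc {0..k} (\<lambda>i. if i = 0 then s\<^sup>2 * r else 3 * M2 i)"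
  define h where "h = (\<lambda>z v. g (subst_point k f J (w(i := v)) z))"
  have s2: "1 < s\<^sup>2" using one_less_power[of s 2] s by simp
  have MM: "0 < M2 l" if "l \<in> {1..k}" for l
    using fM[OF that, of 0] r s order_le_less_trans[OF norm_ge_zero] by simp
  have Uext: "U \<subseteq> extensional {0..k}" unfolding U_def by (rule polydisc_extensional)
  have w': "(w(i := v)) l \<in> ball 0 (3 * M2 l)" if "l \<in> {1..k}" "v \<in> ball 0 (3 * M2 i)" for l v
    using w that by auto
  have inU: "subst_point k f J (w(i := v)) z \<in> U" if "z \<in> ball 0 (s\<^sup>2 * r)" "v \<in> ball 0 (3 * M2 i)" for z v
    unfolding U_def
  proof (rule subst_point_in_polydisc[OF that(1)])
    fix l assume "l \<in> {1..k}"
    thus "cmod (f l z) < 3 * M2 l" using fM[of l z] MM[of l] that(1) by simp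
    show "(w(i := v)) l \<in> ball 0 (3 * M2 l)" by (rule w') fact+
  qed
  have gU: "holomorphic_vars_on {0..k} g U" using g by (simp add: U_def)
  have contg: "continuous_on U g"
    by (rule holomorphic_vars_on_continuous[OF gU finite_atLeastAtMost Uext])
  have cont: "continuous_on (ball 0 (s\<^sup>2 * r) \<times> ball 0 (3 * M2 i)) (\<lambda>(z, v). h z v)"
  proof -
    have "continuous_on (ball 0 (s\<^sup>2 * r) \<times> ball 0 (3 * M2 i)) (\<lambda>x. subst_point k f J (w(i := snd x)) (fst x))"
    proof (rule continuous_on_coordinatewise_then_product)
      fix l
      have "continuous_on (ball 0 (s\<^sup>2 * r) \<times> ball 0 (3 * M2 i)) (\<lambda>x. f l (fst x))" if "l \<in> {1..k}"
        by (rule continuous_on_compose2[OF holomorphic_on_imp_continuous_on[OF f[OF that]]])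
           (auto intro!: continuous_intros)
      thus "continuous_on (ball 0 (s\<^sup>2 * r) \<times> ball 0 (3 * M2 i)) (\<lambda>x. subst_point k f J (w(i := snd x)) (fst x) l)"
        by (cases "l \<in> {0..k}"; cases "l = 0"; cases "l \<in> J"; cases "l = i")
           (auto simp: subst_point_def intro!: continuous_intros)
    qed
    hence "continuous_on (ball 0 (s\<^sup>2 * r) \<times> ball 0 (3 * M2 i)) (\<lambda>x. g (subst_point k f J (w(i := snd x)) (fst x)))"
      by (rule continuous_on_compose2[OF contg]) (use inU in auto)
    thus ?thesis by (simp add: h_def case_prod_unfold)
  qed
  have coord: "(\<lambda>z. subst_point k f J' u z l) holomorphic_on ball 0 (s\<^sup>2 * r)" if "l \<in> {0..k}" for u J' l
    using that f[of l] by (cases "l = 0"; cases "l \<in> J'") (auto simp: subst_point_def)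
  have hol1: "(\<lambda>z. h z v) holomorphic_on ball 0 (s\<^sup>2 * r)" if "v \<in> ball 0 (3 * M2 i)" for v
    unfolding h_def
    by (rule holomorphic_vars_on_curve[OF gU finite_atLeastAtMost Uext]) (use inU that coord in auto)
  have hol2: "h z holomorphic_on ball 0 (3 * M2 i)" if "z \<in> ball 0 (s\<^sup>2 * r)" for z
  proof -
    have "(\<lambda>v. g (subst_point k f J (w(i := v)) z)) holomorphic_on ball 0 (3 * M2 i)"
    proof (rule holomorphic_vars_on_curve[OF gU finite_atLeastAtMost Uext])
      fix l assume "l \<in> {0..k}"
      thus "(\<lambda>v. subst_point k f J (w(i := v)) z l) holomorphic_on ball 0 (3 * M2 i)"
        by (cases "l = 0"; cases "l \<in> J"; cases "l = i") (auto simp: subst_point_def)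
    qed (use inU that in auto)
    thus ?thesis by (simp add: h_def)
  qed
  have fi3: "f i z \<in> ball 0 (3 * M2 i)" if "z \<in> ball 0 (s\<^sup>2 * r)" for z
    using fM[OF i(1) that] MM[OF i(1)] by simp
  have h_f: "h z (f i z) = g (subst_point k f (insert i J) w z)" for z
    unfolding h_def by (simp only: subst_point_update_insert[OF i])
  have holf: "(\<lambda>z. h z (f i z)) holomorphic_on ball 0 (s\<^sup>2 * r)"
    unfolding h_f
  proof (rule holomorphic_vars_on_curve[OF gU finite_atLeastAtMost Uext])
    show "subst_point k f (insert i J) w z \<in> U" if "z \<in> ball 0 (s\<^sup>2 * r)" for z
      using inU[OF that fi3[OF that]] by (simp only: subst_point_update_insert[OF i])
  qed (use coord in auto)
  have bern: "cmod (h z y) \<le> exp q * B"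
    if z: "z \<in> ball 0 (s\<^sup>2 * r)" and \<sigma>: "0 < \<sigma>" "cball x (exp 1 * \<sigma>) \<subseteq> ball 0 (3 * M2 i)"
      and B: "\<And>y. y \<in> ball x \<sigma> \<Longrightarrow> cmod (h z y) \<le> B" and y: "y \<in> ball x (exp 1 * \<sigma>)" for z x \<sigma> B y
  proof -
    \<comment> \<open>The frozen variables together with the values substituted so far.\<close>
    define u where "u = (\<lambda>l\<in>{1..k} - {i}. if l \<in> J then f l z else w l)"
    have u: "u \<in> polydisc ({1..k} - {i}) (\<lambda>j. 3 * M2 j)"
      unfolding u_def polydisc_def
    proof (intro restrict_PiE_iff[THEN iffD2] ballI)
      fix l assume "l \<in> {1..k} - {i}"
      thus "(if l \<in> J then f l z else w l) \<in> ball 0 (3 * M2 l)"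
        using fM[of l z] MM[of l] z w[of l] by auto
    qed
    have "u(0 := z, i := v) = subst_point k f J (w(i := v)) z" for v
      using i by (auto simp: u_def subst_point_def fun_eq_iff restrict_def)
    hence eq: "(\<lambda>v. g (u(0 := z, i := v))) = h z" by (simp only: h_def)
    have "bernstein_index (\<lambda>v. g (u(0 := z, i := v))) (3 * M2 i) 0 \<le> ereal q"
      using F[OF u] z unfolding F_class_def by auto
    hence "bernstein_index (h z) (3 * M2 i) 0 \<le> ereal q" unfolding eq .
    thus ?thesis using \<sigma> B y by (rule bernstein_index_bound)
  qed
  have Y: "0 < ln ((1 + s\<^sup>2) / (2 * s))"
  proof -
    have "0 < (s - 1)\<^sup>2" using s by simp
    hence "2 * s < 1 + s\<^sup>2" by (simp add: power2_eq_square algebra_simps)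
    thus ?thesis using s by simp
  qed
  have rs: "0 < r / s" "r / s < s\<^sup>2 * r"
  proof -
    have "r / s < r" using r s by (simp add: pos_divide_less_eq)
    also have "r < s\<^sup>2 * r" using r s2 by simp
    finally show "r / s < s\<^sup>2 * r" .
  qed (use r s in auto)
  have "0 < M1 i * (s\<^sup>2 - 1) / s\<^sup>2" using M s s2 by simp
  hence nc: "f i z1 \<noteq> f i 0" using z1(2) by auto
  have z1R: "z1 \<in> ball 0 (s\<^sup>2 * r)"
  proof -
    have "r / s\<^sup>2 < r" using s s2 r divide_strict_left_mono[of 1 "s\<^sup>2" r] by simp
    moreover have "r < s\<^sup>2 * r" using r s2 by simp
    ultimately show ?thesis using z1(1) by simp
  qed
  obtain w0 N where N: "1 \<le> N" "9 / 10 * p \<le> ln ((1 + s\<^sup>2) / (2 * s)) * of_int N"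
    "N = (\<Sum>z | z \<in> ball 0 (r / s) \<and> f i z - w0 = 0. zorder (\<lambda>z. f i z - w0) z)"
    by (rule valency_witness[OF f[OF i(1)] rs z1R nc Y pq(1) val])
  have "cmod (h z v) \<le> exp (a2_const s * ln (a1_const s * M2 i / M1 i) * (p + q)) * C"
  proof (rule substitution_estimate[OF s r f[OF i(1)] _ M z1 cont hol1 hol2 holf _ bern N _ pq zv])
    show "cmod (f i z) \<le> M2 i" if "z \<in> ball 0 (s\<^sup>2 * r)" for z using fM[OF i(1) that] by simp
    show "cmod (h z v) \<le> exp p * B" if "v \<in> ball 0 (3 * M2 i)" "\<And>z. z \<in> ball 0 r \<Longrightarrow> cmod (h z v) \<le> B"
      "z \<in> ball 0 (s\<^sup>2 * r)" for v B z
      using growth[OF w'[OF _ that(1)], of B z] that(2,3) unfolding h_def by blast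
    show "cmod (h z (f i z)) \<le> C" if "z \<in> ball 0 r" for z unfolding h_f by (rule C[OF that])
  qed auto
  thus ?thesis by (simp add: h_def)
qed

text \<open>\<open>X j w\<close> is the function of \<open>z\<close> after \<open>j\<close> substitutions. The claim \<open>step\<close> bounds \<open>X j\<close> in terms of
  \<open>X (Suc j)\<close>; taking the substituted value as the new variable turns it into the growth
  hypothesis for \<open>X (Suc j)\<close>, and iterating it on the small polydisc multiplies the factors.\<close>
lemma substitution_theorem:
  fixes g :: "(nat \<Rightarrow> complex) \<Rightarrow> complex"
  assumes s: "1 < s" "s \<le> 3" and r: "0 < r" and k: "1 \<le> k"
    and f: "\<forall>i\<in>{1..k}. f i holomorphic_on ball 0 (s\<^sup>2 * r)"
    and M: "\<forall>i\<in>{1..k}. M1 i > 0 \<and> M2 i > 0 \<and>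
            M_sup (f i) (r / s\<^sup>2) 0 \<ge> ennreal (M1 i) \<and>
            M_sup (f i) (s\<^sup>2 * r) 0 \<le> ennreal (M2 i) \<and>
            M_sup (f i) (r / s\<^sup>2) 0 / M_sup (f i) (r / (s\<^sup>2)^2) 0 \<ge> ennreal (s\<^sup>2)"
    and \<sigma>: "bij_betw \<sigma> {1..k} {1..k}"
    and g: "holomorphic_vars_on {0..k} g
      (polydisc {0..k} (\<lambda>i. if i = 0 then s\<^sup>2 * r else 3 * M2 i))"
    and p: "0 \<le> p" and q: "\<forall>i\<in>{1..k}. q i \<ge> 0"
    and F: "\<forall>i\<in>{1..k}. \<forall>w \<in> polydisc ({1..k} - {i}) (\<lambda>j. 3 * M2 j).
            (\<lambda>z v. g (w(0 := z, i := v))) \<in> F_class p (q i) r (s\<^sup>2) (M2 i)"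
    and P0: "P 0 = p"
    and P: "\<forall>j\<in>{1..k}. P j =
            c_const (a1_const s) (a2_const s) (M1 (\<sigma> j)) (M2 (\<sigma> j)) * (P (j - 1) + q (\<sigma> j))"
    and val: "\<forall>j\<in>{0..k - 1}. ereal (P j) \<le>
            ereal (ln ((1 + s\<^sup>2) / (2 * s))) * valency (f (\<sigma> (j + 1))) (r / s) 0"
  shows "(SUP x \<in> polydisc {0..k} (\<lambda>i. if i = 0 then r else M2 i). ennreal (cmod (g x)))
            \<le> ennreal (exp (\<Sum>j=1..k. P j)) * M_sup (g_Phi k g f) r 0"
    and "M_sup (g_Phi k g f) (s\<^sup>2 * r) 0 \<le> ennreal (exp (P k)) * M_sup (g_Phi k g f) r 0"
proof -
  define R where "R = s\<^sup>2 * r"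
  have s2: "1 < s\<^sup>2" using one_less_power[of s 2] s by simp
  have rR: "r < R" using s2 r by (simp add: R_def)
  define W where "W = {w. \<forall>l\<in>{1..k}. w l \<in> ball (0::complex) (3 * M2 l)}"
  define X where "X = (\<lambda>j w z. g (subst_point k f (\<sigma> ` {1..j}) w z))"
  have osc: "\<exists>z1. cmod z1 \<le> r / s\<^sup>2 \<and> M1 i * (s\<^sup>2 - 1) / s\<^sup>2 \<le> cmod (f i z1 - f i 0) \<and> M1 i \<le> M2 i
     \<and> (\<forall>z\<in>ball 0 R. cmod (f i z) < M2 i)" if i: "i \<in> {1..k}" for i
  proof -
    have Mi: "0 < M1 i" "0 < M2 i" "ennreal (M1 i) \<le> M_sup (f i) (r / s\<^sup>2) 0"
      "M_sup (f i) (s\<^sup>2 * r) 0 \<le> ennreal (M2 i)"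
      "ennreal (s\<^sup>2) \<le> M_sup (f i) (r / s\<^sup>2) 0 / M_sup (f i) (r / (s\<^sup>2)^2) 0" using M i by auto
    have fi: "f i holomorphic_on ball 0 (s\<^sup>2 * r)" using f i by blast
    obtain z1 where z1: "cmod z1 \<le> r / s\<^sup>2" "M1 i * (s\<^sup>2 - 1) / s\<^sup>2 \<le> cmod (f i z1 - f i 0)" "M1 i \<le> M2 i"
      "\<And>z. z \<in> ball 0 (s\<^sup>2 * r) \<Longrightarrow> cmod (f i z) \<le> M2 i"
      using oscillation_witness[OF fi s2 r Mi] by blast
    have "0 < M1 i * (s\<^sup>2 - 1) / s\<^sup>2" using Mi s s2 by simp
    hence nc: "f i z1 \<noteq> f i 0" using z1(2) by auto
    have "r / s\<^sup>2 < r" using s s2 r divide_strict_left_mono[of 1 "s\<^sup>2" r] by simp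
    hence z1R: "z1 \<in> ball 0 (s\<^sup>2 * r)" "0 \<in> ball (0::complex) (s\<^sup>2 * r)" using z1(1) rR r s unfolding R_def by (simp_all only: mem_ball_0) (linarith | simp)+
    have "cmod (f i z) < M2 i" if "z \<in> ball 0 R" for z
      by (rule strict_bound_of_nonconstant[OF fi open_ball connected_ball z1(4) z1R nc]) (use that in \<open>simp_all add: R_def\<close>)
    thus ?thesis using z1 by blast
  qed
  have fM: "cmod (f i z) < M2 i" if "i \<in> {1..k}" "z \<in> ball 0 R" for i z using osc that by blast
  have \<sigma>i: "\<sigma> (Suc j) \<in> {1..k}" "\<sigma> (Suc j) \<notin> \<sigma> ` {1..j}" "\<sigma> ` {1..Suc j} = insert (\<sigma> (Suc j)) (\<sigma> ` {1..j})"
    if "j < k" for j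
  proof -
    show "\<sigma> (Suc j) \<in> {1..k}" using bij_betwE[OF \<sigma>] that by auto
    show "\<sigma> (Suc j) \<notin> \<sigma> ` {1..j}" 
    proof
      assume "\<sigma> (Suc j) \<in> \<sigma> ` {1..j}"
      then obtain l where l: "l \<in> {1..j}" "\<sigma> (Suc j) = \<sigma> l" by auto
      have "Suc j = l" by (rule inj_onD[OF bij_betw_imp_inj_on[OF \<sigma>] l(2)]) (use l(1) that in auto)
      thus False using l(1) by simp
    qed
    show "\<sigma> ` {1..Suc j} = insert (\<sigma> (Suc j)) (\<sigma> ` {1..j})" by (simp add: atLeastAtMostSuc_conv)
  qed
  have c0: "0 \<le> a2_const s * ln (a1_const s * M2 i / M1 i)" if i: "i \<in> {1..k}" for i
  proof -
    have "M1 i \<le> M2 i" "0 < M1 i" using osc[OF i] M i by auto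
    hence "1 \<le> M2 i / M1 i" by simp
    hence "1 * 1 \<le> a1_const s * (M2 i / M1 i)"
      using a1_const_bounds(1)[OF s(1)] by (intro mult_mono) auto
    hence "0 \<le> ln (a1_const s * M2 i / M1 i)" by simp
    thus ?thesis using growth_log_le(2)[OF s] by simp
  qed
  have PS: "P (Suc j) = a2_const s * ln (a1_const s * M2 (\<sigma> (Suc j)) / M1 (\<sigma> (Suc j))) * (P j + q (\<sigma> (Suc j)))"
    if "j < k" for j using P that by (simp add: c_const_def)
  have Ppos: "j \<le> k \<Longrightarrow> 0 \<le> P j" for j
  proof (induction j)
    case (Suc j)
    hence "0 \<le> P j + q (\<sigma> (Suc j))" using q \<sigma>i(1)[of j] by (intro add_nonneg_nonneg) auto
    thus ?case using PS[of j] c0[OF \<sigma>i(1)[of j]] Suc.prems by simp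
  qed (use P0 p in simp)
  have step: "cmod (X j (w(\<sigma> (Suc j) := v)) z) \<le> exp (P (Suc j)) * C"
    if j: "j < k" and growth: "\<And>w C z. w \<in> W \<Longrightarrow> (\<And>z. z \<in> ball 0 r \<Longrightarrow> cmod (X j w z) \<le> C) \<Longrightarrow> z \<in> ball 0 R \<Longrightarrow>
          cmod (X j w z) \<le> exp (P j) * C"
      and w: "w \<in> W" and C: "\<And>z. z \<in> ball 0 r \<Longrightarrow> cmod (X (Suc j) w z) \<le> C"
      and zv: "z \<in> ball 0 R" "v \<in> ball 0 (M2 (\<sigma> (Suc j)))" for j w C z v
  proof -
    define i where "i = \<sigma> (Suc j)"
    have i: "i \<in> {1..k}" "i \<notin> \<sigma> ` {1..j}" using \<sigma>i[OF j] by (auto simp: i_def)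
    obtain z1 where z1: "cmod z1 \<le> r / s\<^sup>2" "M1 i * (s\<^sup>2 - 1) / s\<^sup>2 \<le> cmod (f i z1 - f i 0)" "M1 i \<le> M2 i"
      using osc[OF i(1)] by blast
    have "cmod (g (subst_point k f (\<sigma> ` {1..j}) (w(i := v)) z))
      \<le> exp (a2_const s * ln (a1_const s * M2 i / M1 i) * (P j + q i)) * C"
    proof (rule substitute_one_variable[OF s r i _ _ _ _ _ _ g, where p = "P j" and q = "q i" and ?p0.0 = p and ?z1.0 = z1])
      show "f l holomorphic_on ball 0 (s\<^sup>2 * r)" if "l \<in> {1..k}" for l using f that by blast
      show "cmod (f l z) < M2 l" if "l \<in> {1..k}" "z \<in> ball 0 (s\<^sup>2 * r)" for l z
        using fM[OF that(1)] that(2) by (simp add: R_def)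
      show "0 < M1 i" using M i by blast
      show "M1 i \<le> M2 i" "cmod z1 \<le> r / s\<^sup>2" "M1 i * (s\<^sup>2 - 1) / s\<^sup>2 \<le> cmod (f i z1 - f i 0)"
        by (fact z1)+
      show "(\<lambda>z v. g (w(0 := z, i := v))) \<in> F_class p (q i) r (s\<^sup>2) (M2 i)"
        if "w \<in> polydisc ({1..k} - {i}) (\<lambda>j. 3 * M2 j)" for w using F i that by blast
      show "cmod (g (subst_point k f (\<sigma> ` {1..j}) w z)) \<le> exp (P j) * C"
        if "\<And>l. l \<in> {1..k} \<Longrightarrow> w l \<in> ball 0 (3 * M2 l)"
          "\<And>z. z \<in> ball 0 r \<Longrightarrow> cmod (g (subst_point k f (\<sigma> ` {1..j}) w z)) \<le> C" "z \<in> ball 0 (s\<^sup>2 * r)" for w C z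
        using growth[of w C z] that by (auto simp: W_def X_def R_def)
      show "ereal (P j) \<le> ereal (ln ((1 + s\<^sup>2) / (2 * s))) * valency (f i) (r / s) 0"
        using val j by (auto simp: i_def)
      show "0 \<le> P j" using Ppos j by simp
      show "0 \<le> q i" using q i by blast
      show "w l \<in> ball 0 (3 * M2 l)" if "l \<in> {1..k}" for l using w that by (auto simp: W_def)
      show "cmod (g (subst_point k f (insert i (\<sigma> ` {1..j})) w z)) \<le> C" if "z \<in> ball 0 r" for z
        using C[OF that] \<sigma>i(3)[OF j] by (simp add: X_def i_def)
    qed (use zv in \<open>simp_all add: R_def i_def\<close>)
    thus ?thesis using PS[OF j] by (simp add: X_def i_def)
  qed
  have growth: "j \<le> k \<Longrightarrow> w \<in> W \<Longrightarrow> (\<And>z. z \<in> ball 0 r \<Longrightarrow> cmod (X j w z) \<le> C) \<Longrightarrow> z \<in> ball 0 R \<Longrightarrow>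
          cmod (X j w z) \<le> exp (P j) * C" for j w C z
  proof (induction j arbitrary: w C z)
    case 0
    \<comment> \<open>The growth in \<open>z\<close> is part of each of the class hypotheses; that for the first variable is used.\<close>
    define u where "u = (\<lambda>l\<in>{1..k} - {1}. w l)"
    have u: "u \<in> polydisc ({1..k} - {1}) (\<lambda>j. 3 * M2 j)"
      using 0 by (auto simp: u_def polydisc_def W_def PiE_iff)
    have eq: "u(0 := z, 1 := w 1) = subst_point k f {} w z" for z
      using k by (auto simp: u_def subst_point_def fun_eq_iff restrict_def)
    have "(\<lambda>z v. g (u(0 := z, 1 := v))) \<in> F_class p (q 1) r (s\<^sup>2) (M2 1)" using F u k by auto
    moreover have "w 1 \<in> ball 0 (3 * M2 1)" using 0 k by (auto simp: W_def)
    ultimately have "M_sup (\<lambda>z. g (u(0 := z, 1 := w 1))) R 0 \<le> ennreal (exp p) * M_sup (\<lambda>z. g (u(0 := z, 1 := w 1))) r 0"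
      unfolding F_class_def R_def by blast
    hence "M_sup (X 0 w) R 0 \<le> ennreal (exp p) * M_sup (X 0 w) r 0"
      unfolding eq X_def by simp
    from M_sup_growth_bound[OF this r 0(3,4)] show ?case by (simp add: P0)
  next
    case (Suc j)
    have j: "j < k" using Suc.prems by simp
    have "cmod (X j (w(\<sigma> (Suc j) := f (\<sigma> (Suc j)) z)) z) \<le> exp (P (Suc j)) * C"
      by (rule step[OF j Suc.IH Suc.prems(2,3,4)]) (use j fM[OF \<sigma>i(1)[OF j] Suc.prems(4)] in auto)
    thus ?case unfolding X_def by (simp only: subst_point_update_insert[OF \<sigma>i(1,2)[OF j]] \<sigma>i(3)[OF j])
  qed
  have M2W: "w \<in> W" if "\<And>l. l \<in> {1..k} \<Longrightarrow> w l \<in> ball 0 (M2 l)" for w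
    using that M by (fastforce simp: W_def)
  have total: "j \<le> k \<Longrightarrow> (\<And>l. l \<in> {1..k} \<Longrightarrow> w l \<in> ball 0 (M2 l)) \<Longrightarrow>
      (\<And>z. z \<in> ball 0 r \<Longrightarrow> cmod (X j w z) \<le> C) \<Longrightarrow> z \<in> ball 0 r \<Longrightarrow>
          cmod (X 0 w z) \<le> exp (\<Sum>i=1..j. P i) * C" for j w C z
  proof (induction j arbitrary: C z)
    case (Suc j)
    have j: "j < k" using Suc.prems by simp
    have "cmod (X 0 w z) \<le> exp (\<Sum>i=1..j. P i) * (exp (P (Suc j)) * C)"
    proof (rule Suc.IH)
      fix z assume z: "z \<in> ball (0::complex) r"
      have "cmod (X j (w(\<sigma> (Suc j) := w (\<sigma> (Suc j)))) z) \<le> exp (P (Suc j)) * C"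
        by (rule step[OF j growth M2W Suc.prems(3)]) (use j z rR \<sigma>i(1)[OF j] Suc.prems(2) in auto)
      thus "cmod (X j w z) \<le> exp (P (Suc j)) * C" by simp
    qed (use j Suc.prems in auto)
    thus ?case by (simp add: exp_add mult.assoc)
  qed simp
  have \<sigma>k: "\<sigma> ` {1..k} = {1..k}" using \<sigma> by (rule bij_betw_imp_surj_on)
  have Xk: "X k w = g_Phi k g f" for w
    unfolding X_def \<sigma>k g_Phi_def subst_point_def fun_eq_iff
    by (auto intro!: arg_cong[where f = g] simp: fun_eq_iff restrict_def)
  have hol: "g_Phi k g f holomorphic_on ball 0 R"
  proof -
    have "(\<lambda>z. g (subst_point k f {1..k} (\<lambda>_. 0) z)) holomorphic_on ball 0 R"
    proof (rule holomorphic_vars_on_curve[OF g finite_atLeastAtMost polydisc_extensional])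
      fix z :: complex assume z: "z \<in> ball 0 R"
      show "subst_point k f {1..k} (\<lambda>_. 0) z \<in> polydisc {0..k} (\<lambda>i. if i = 0 then s\<^sup>2 * r else 3 * M2 i)"
      proof (rule subst_point_in_polydisc)
        show "cmod (f i z) < 3 * M2 i" if "i \<in> {1..k}" for i using fM[OF that z] M that by fastforce
      qed (use z in \<open>auto simp: R_def\<close>)
    next
      fix i assume "i \<in> {0..k}"
      thus "(\<lambda>z. subst_point k f {1..k} (\<lambda>_. 0) z i) holomorphic_on ball 0 R"
        using f by (cases "i = 0") (auto simp: subst_point_def R_def)
    qed auto
    thus ?thesis by (simp only: Xk[of "\<lambda>_. 0", unfolded X_def \<sigma>k])
  qed
  have "compact ((g_Phi k g f) ` cball 0 r)"
    by (intro compact_continuous_image holomorphic_on_imp_continuous_on holomorphic_on_subset[OF hol]) (use rR in auto)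
  then obtain B where "\<forall>x\<in>g_Phi k g f ` cball 0 r. cmod x \<le> B"
    using compact_imp_bounded bounded_iff by metis
  hence B: "cmod (g_Phi k g f z) \<le> B" if "z \<in> ball 0 r" for z
    using that ball_subset_cball[of "0::complex" r] by blast
  have W0: "(\<lambda>_. 0) \<in> W" using M by (auto simp: W_def)
  show "M_sup (g_Phi k g f) (s\<^sup>2 * r) 0 \<le> ennreal (exp (P k)) * M_sup (g_Phi k g f) r 0"
    unfolding M_sup_def[of "g_Phi k g f" "s\<^sup>2 * r"] unfolding R_def[symmetric]
  proof (rule M_sup_growthI[OF B r])
    show "cmod (g_Phi k g f z) \<le> exp (P k) * C"
      if "\<And>z. z \<in> ball 0 r \<Longrightarrow> cmod (g_Phi k g f z) \<le> C" "z \<in> ball 0 R" for C z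
      using growth[of k "\<lambda>_. 0" C z, OF order_refl W0] that unfolding Xk by blast
  qed auto
  show "(SUP x \<in> polydisc {0..k} (\<lambda>i. if i = 0 then r else M2 i). ennreal (cmod (g x)))
            \<le> ennreal (exp (\<Sum>j=1..k. P j)) * M_sup (g_Phi k g f) r 0"
  proof (rule M_sup_growthI[OF B r])
    fix C x assume C: "\<And>z. z \<in> ball 0 r \<Longrightarrow> cmod (g_Phi k g f z) \<le> C"
      and x: "x \<in> polydisc {0..k} (\<lambda>i. if i = 0 then r else M2 i)"
    have x0: "x 0 \<in> ball 0 r" using x by (force simp: polydisc_def PiE_iff)
    have xl: "x l \<in> ball 0 (M2 l)" if "l \<in> {1..k}" for l
      using x that by (force simp: polydisc_def PiE_iff)
    have "cmod (X 0 x (x 0)) \<le> exp (\<Sum>j=1..k. P j) * C"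
      by (rule total[OF order_refl xl _ x0]) (use C in \<open>auto simp: Xk\<close>)
    moreover have "subst_point k f {} x (x 0) = x"
      using x by (auto simp: subst_point_def polydisc_def PiE_iff extensional_def fun_eq_iff)
    ultimately show "cmod (g x) \<le> exp (\<Sum>j=1..k. P j) * C" by (simp add: X_def)
  qed auto
qed

theorem theorem2p3:
  shows "\<forall>t::real. 1 < t \<and> t \<le> 9 \<longrightarrow>
    (\<exists>a1 a2 :: real. a1 > 0 \<and> a2 > 0 \<and>
      a1 \<le> 300 * (sqrt t + 1) * t powr (3/2) / (t - 1)^2 \<and>
      a2 \<le> (36 * (sqrt t + 1)^2 + 162 * ln (108 * exp 1 / (sqrt t - 1))) / (sqrt t - 1)^4 \<and>
      (\<forall>(r::real) (k::nat) (f :: nat \<Rightarrow> complex \<Rightarrow> complex)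
         (M1 :: nat \<Rightarrow> real) (M2 :: nat \<Rightarrow> real) (\<sigma> :: nat \<Rightarrow> nat)
         (g :: (nat \<Rightarrow> complex) \<Rightarrow> complex) (p::real) (q :: nat \<Rightarrow> real) (P :: nat \<Rightarrow> real).
        r > 0 \<longrightarrow> k \<ge> 1 \<longrightarrow>
        (\<forall>i\<in>{1..k}. f i holomorphic_on ball 0 (t * r)) \<longrightarrow>
        (\<forall>i\<in>{1..k}. M1 i > 0 \<and> M2 i > 0 \<and>
            M_sup (f i) (r / t) 0 \<ge> ennreal (M1 i) \<and>
            M_sup (f i) (t * r) 0 \<le> ennreal (M2 i) \<and>
            M_sup (f i) (r / t) 0 / M_sup (f i) (r / t^2) 0 \<ge> ennreal t) \<longrightarrow>
        bij_betw \<sigma> {1..k} {1..k} \<longrightarrow>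
        (\<forall>j\<in>{1..<k}. N_val (f (\<sigma> j)) r t \<le> N_val (f (\<sigma> (j + 1))) r t) \<longrightarrow>
        holomorphic_vars_on {0..k} g
          (polydisc {0..k} (\<lambda>i. if i = 0 then t * r else 3 * M2 i)) \<longrightarrow>
        p \<ge> 0 \<longrightarrow> (\<forall>i\<in>{1..k}. q i \<ge> 0) \<longrightarrow>
        (\<forall>i\<in>{1..k}. \<forall>w \<in> polydisc ({1..k} - {i}) (\<lambda>j. 3 * M2 j).
            (\<lambda>z v. g (w(0 := z, i := v))) \<in> F_class p (q i) r t (M2 i)) \<longrightarrow>
        P 0 = p \<longrightarrow>
        (\<forall>j\<in>{1..k}. P j =
            c_const a1 a2 (M1 (\<sigma> j)) (M2 (\<sigma> j)) * (P (j - 1) + q (\<sigma> j))) \<longrightarrow>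
        (\<forall>j\<in>{0..k - 1}. ereal (P j) \<le>
            ereal (ln ((1 + t) / (2 * sqrt t))) * N_val (f (\<sigma> (j + 1))) r t) \<longrightarrow>
        (SUP x \<in> polydisc {0..k} (\<lambda>i. if i = 0 then r else M2 i). ennreal (cmod (g x)))
            \<le> ennreal (exp (\<Sum>j=1..k. P j)) * M_sup (g_Phi k g f) r 0 \<and>
        M_sup (g_Phi k g f) (t * r) 0
            \<le> ennreal (exp (P k)) * M_sup (g_Phi k g f) r 0))"
proof (intro allI impI, goal_cases)
  case (1 t)
  define s where "s = sqrt t"
  have ts: "t = s\<^sup>2" "sqrt (s\<^sup>2) = s" using 1 by (auto simp: s_def)
  have s: "1 < s" "s \<le> 3" using 1 real_sqrt_le_mono[of t 9] by (auto simp: s_def)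
  have "(s\<^sup>2) powr (3 / 2) = (s powr 2) powr (3 / 2)" using s by simp
  also have "\<dots> = s ^ 3" using s by (simp only: powr_powr) simp
  finally have pw: "(s\<^sup>2) powr (3 / 2) = s ^ 3" .
  have bounds: "0 < a1_const s" "0 < a2_const s"
    "a1_const s \<le> 300 * (sqrt t + 1) * t powr (3 / 2) / (t - 1)\<^sup>2"
    "a2_const s \<le> (36 * (sqrt t + 1)\<^sup>2 + 162 * ln (108 * exp 1 / (sqrt t - 1))) / (sqrt t - 1) ^ 4"
    using a1_const_bounds(1)[OF s(1)] growth_log_le(2)[OF s]
    unfolding ts(1) unfolding ts(2) pw by (simp_all add: a1_const_def a2_const_def)
  show ?case
  proof (rule exI[of _ "a1_const s"], rule exI[of _ "a2_const s"], intro conjI bounds, intro allI impI, goal_cases)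
    case (1 r k f M1 M2 \<sigma> g p q P)
    note hyps = 1[unfolded ts(1), unfolded N_val_def ts(2)]
    show ?case
      unfolding ts(1)
      by (intro conjI substitution_theorem[OF s hyps(1-5) hyps(7-13)])
  qed
qed

end
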